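(* Assume that $a \in (\frac12, \frac23]$ and $p \in (0,1)$. Then there exists a constant $c \in (0,1)$ such that for every $x \in [0,\frac{1}{1-a}]$, \[ \mathbb P_x(\tau>n)\sim cV(x) \lambda_a^n \] as $n \to \infty$, where $\lambda_a=\lambda_a(p) > p$ is the unique positive solution to \[ \sum_{k=0}^{\varkappa_a} \delta_k \left( \frac{p}{\lambda} \right)^{k+1} \Big ( \frac{q}{p} \Big)^{L_k} =1 \] and \[ V(x)= \sum_{k=0}^{\varkappa_a} \Big( \frac{p}{\lambda_a} \Big)^k \Big(\frac{q}{p} \Big)^{L_k}\mathbbm 1 \{ T_a^k(0) \le x \}. \] The function $a \mapsto \lambda_a$ satisfies $\lambda_{1/2}=p$ and is continuous and non-decreasing on $[\frac12, \frac23]$. More specifically, it is constant on every interval contained in $[\frac12, \frac23] \setminus S$ and is constant on no open interval that intersects $S$, which is a closed set of Lebesgue measure zero. Equivalently, the Lebesgue--Stieltjes measure $d \lambda_a$ on $[\frac12, \frac23]$ has no atoms, is singular, and its support is $S$. Moreover, the conditional distributions converge weakly: for every $x,y \in [0, \frac{1}{1-a}]$, \[ \lim_{n \to \infty} \mathbb P_x(X_n \le y \mid \tau>n) = 1- \sum_{k=0}^{\varkappa_a(y)} \delta_k(y) \Big( \frac{p}{\lambda_a} \Big)^{k+1} \Big( \frac{q}{p} \Big)^{L_k(y)}, \] where the right-hand side is the distribution function of a probability measure $\nu_a$ on $[1, 1/(1-a)]$. This measure is quasi-stationary, i.e. \[ \mathbb P_{\nu_a}(X_1\in A\mid\tau>1)=\nu_a(A),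 \quad A\in\mathcal{B}([0,1/(1-a)]). \] This measure has no atoms and is singular with respect to the Lebesgue measure except for the case $a=\frac23$ and $p=\frac12$, where $\nu_{2/3}$ is the uniform distribution on $[0,3]$. Lastly, the (topological) support of $\nu_a$ is the set $Q_a$ if there is no integer $k \ge 1$ such that $T^k_a(0) = \frac{1}{1-a}$, otherwise the support of $\nu_a$ is $Q_a \setminus \cup_{k=0}^\infty T_a^{-k}(0)$.
   Context: Let $a\in(0,1)$ and consider the AR(1) chain $X_{n+1}=aX_n+\xi_{n+1}$, $n\ge 0$, where the innovations $\xi_n$ are i.i.d., independent of $X_0$, with $\mathbb P(\xi_1=1)=p$, $\mathbb P(\xi_1=-1)=q=1-p$. Write $\mathbb P_x$ (resp. $\mathbb P_\nu$) for the law of the chain started at $x$ (resp. with initial distribution $\nu$), and let $\tau=\inf\{n\ge0: X_n<0\}$. The state space of the killed chain is taken to be $[0,\frac1{1-a}]$. For $a\in[\frac12,\frac23]$ let $I_a=\big(\frac{2a-1}{1-a},1\big)$ and define $T_a$ on $[0,\frac1{1-a}]\setminus I_a$ by $T_a(x)=\frac1a(x+1)$ for $0\le x\le \frac{2a-1}{1-a}$ and $T_a(x)=\frac1a(x-1)$ for $1\le x\le\frac1{1-a}$; for $a=\frac23$ one sets $T_{2/3}(1)=0$. Let $\varkappa_a(x)=\inf\{k\ge0: T_a^k(x)\in I_a\}$ (first hitting time of $I_a$ by the orbit of $x$), $\delta_k(x)=\mathbbm 1\{T_a^k(x)<1\}$ for $0\le k<\varkappa_a(x)+1$, $L_0(x)=0$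 and $L_k(x)=\sum_{i=0}^{k-1}\delta_i(x)$ for $1\le k<\varkappa_a(x)+1$. Write $\varkappa_a=\varkappa_a(0)$, $\delta_k=\delta_k(0)$, $L_k=L_k(0)$. Let $S=\{a\in[\frac12,\frac23]: \varkappa_a=\infty\}$ and, for fixed $a$, $Q_a=\{x: \varkappa_a(x)=\infty\}$. $T_a^{-k}(0)$ denotes the preimage of $0$ under the $k$-th iterate of $T_a$.
   Formalization: The measure ν_a is stated to be a probability measure on [0, 1/(1-a)] instead of [1, 1/(1-a)], since its distribution function gives mass 1 − p/λ_a > 0 to [0,1) (e.g. it is uniform on [0,3] for a=2/3, p=1/2). *)

theory Defs
  imports "HOL-Probability.Probability" "HOL-Library.Landau_Symbols" "HOL-Library.Extended_Nat"
begin

fun chain :: "real \<Rightarrow> real \<Rightarrow> bool list \<Rightarrow> real" where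
  "chain a x [] = x"
| "chain a x (b # bs) = chain a (a * x + (if b then 1 else -1)) bs"

text \<open>tau > n: X_0, ..., X_n are all nonnegative (n = length of the innovation list).\<close>
definition survives :: "real \<Rightarrow> real \<Rightarrow> bool list \<Rightarrow> bool" where
  "survives a x xs \<longleftrightarrow> (\<forall>k \<le> length xs. chain a x (take k xs) \<ge> 0)"

definition weight :: "real \<Rightarrow> bool list \<Rightarrow> real" where
  "weight p xs = p ^ count_list xs True * (1 - p) ^ count_list xs False"

text \<open>P_x(E) for an event E depending on the first n innovations.\<close>
definition Px :: "real \<Rightarrow> real \<Rightarrow> real \<Rightarrow> nat \<Rightarrow> (bool list \<Rightarrow> bool) \<Rightarrow> real" where
  "Px a p x n E = (\<Sum>xs \<in> {xs. length xs = n}. weight p xs * (if E xs then 1 else 0))"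

definition Ia :: "real \<Rightarrow> real set" where
  "Ia a = {(2*a - 1)/(1 - a) <..< 1}"

text \<open>On [0, 1/(1-a)] minus I_a: (x+1)/a for x <= (2a-1)/(1-a), (x-1)/a for x >= 1;
  these two ranges are separated by x < 1 vs x >= 1 (for a = 2/3 this realises T(1) = 0).\<close>
definition Ta :: "real \<Rightarrow> real \<Rightarrow> real" where
  "Ta a x = (if x < 1 then (x + 1) / a else (x - 1) / a)"

definition kappa :: "real \<Rightarrow> real \<Rightarrow> enat" where
  "kappa a x = (if \<exists>k. (Ta a ^^ k) x \<in> Ia a
                then enat (LEAST k. (Ta a ^^ k) x \<in> Ia a) else \<infinity>)"

definition delta :: "real \<Rightarrow> real \<Rightarrow> nat \<Rightarrow> nat" where
  "delta a x k = (if (Ta a ^^ k) x < 1 then 1 else 0)"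

definition Lk :: "real \<Rightarrow> real \<Rightarrow> nat \<Rightarrow> nat" where
  "Lk a x k = (\<Sum>i<k. delta a x i)"

definition char_term :: "real \<Rightarrow> real \<Rightarrow> real \<Rightarrow> nat \<Rightarrow> real" where
  "char_term a p l k = (if enat k \<le> kappa a 0
     then real (delta a 0 k) * (p / l) ^ (k + 1) * ((1 - p) / p) ^ (Lk a 0 k) else 0)"

definition char_eq :: "real \<Rightarrow> real \<Rightarrow> real \<Rightarrow> bool" where
  "char_eq a p l \<longleftrightarrow> (char_term a p l) sums 1"

definition lam :: "real \<Rightarrow> real \<Rightarrow> real" where
  "lam a p = (THE l. l > 0 \<and> char_eq a p l)"

definition V :: "real \<Rightarrow> real \<Rightarrow> real \<Rightarrow> real" where
  "V a p x = (\<Sum>k. if enat k \<le> kappa a 0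
     then (p / lam a p) ^ k * ((1 - p) / p) ^ (Lk a 0 k) * (if (Ta a ^^ k) 0 \<le> x then 1 else 0)
     else 0)"

definition Fqs :: "real \<Rightarrow> real \<Rightarrow> real \<Rightarrow> real" where
  "Fqs a p y = 1 - (\<Sum>k. if enat k \<le> kappa a y
     then real (delta a y k) * (p / lam a p) ^ (k + 1) * ((1 - p) / p) ^ (Lk a y k) else 0)"

definition Sset :: "real set" where
  "Sset = {a \<in> {1/2..2/3}. kappa a 0 = \<infinity>}"

definition Qa :: "real \<Rightarrow> real set" where
  "Qa a = {x \<in> {0..1/(1-a)}. kappa a x = \<infinity>}"

text \<open>T_a^{-k}(0): points of the state space whose orbit is defined up to step k and lands at 0.\<close>
definition Tpre :: "real \<Rightarrow> nat \<Rightarrow> real set" where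
  "Tpre a k = {x \<in> {0..1/(1-a)}. (\<forall>j<k. (Ta a ^^ j) x \<notin> Ia a) \<and> (Ta a ^^ k) x = 0}"

definition msupport :: "real measure \<Rightarrow> real set" where
  "msupport M = {x. \<forall>e>0. emeasure M (ball x e) > 0}"

definition dlam :: "real \<Rightarrow> real measure" where
  "dlam p = interval_measure (\<lambda>t. lam (min (2/3) (max (1/2) t)) p)"

end

theory Submission
  imports Defs
begin

text \<open>
  The indicator of \<open>{y<..}\<close> is mapped by the killed transition operator to a combination of the
  indicators of the whole state space and of \<open>{T y<..}\<close>. Iterating along the orbit of 0 turns the
  survival probabilities into a renewal sequence whose step law is given by the terms of the
  characteristic equation, and the renewal theorem yields the asymptotics and the conditional limits.
  After entering the gap an orbit of the totalised map stays above \<open>1/(1-a)\<close> and never visits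
  \<open>[0,1)\<close> again, so the truncation at \<open>kappa\<close> is automatic.

  The survival function \<open>H\<close> of the limit law satisfies a functional equation along the map;
  lexicographic comparison of itineraries gives monotonicity in the starting point and in the
  parameter, existence of the root, and (with one-sided stability of finite itineraries) continuity.
  The exceptional set is null because itineraries read backwards are surviving paths for the
  parameter 2/3, of which there are at most \<open>C (3/2)^n\<close>, while the parameters sharing an itinerary
  of length \<open>n\<close> form a set of diameter \<open>O(b^n)\<close> with \<open>b < 2/3\<close>. The limit law is singular because the
  Hellinger affinity of the cylinder weights and the lengths solves a defective renewal equation.
\<close>

text \<open>The sums are kept as functions of three independent quantities: the scale
  \<open>m\<close> (standing for \<open>p / lambda\<close>), the ratio \<open>r\<close> (standing
  for \<open>(1 - p) / p\<close>) and the parameter \<open>a\<close>. Separating \<open>m\<close>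
  from \<open>a\<close> allows two parameters to be compared at one and the same \<open>m\<close>.
  For a general \<open>m\<close> the series need not converge, so it is controlled through partial
  sums. The recurring obstacle is the discontinuity of the map at 1. The point 1 belongs to the
  upper branch, so itineraries are stable when the point moves up and the parameter moves down, but
  may change in the other direction. The repair is a coincidence of values:
  \<open>Ta a 1 = 0\<close> and \<open>H 0 = 1\<close> give \<open>H 1 = m\<close>, while points
  just left of 1 are sent close to \<open>2/a \<ge> 1/(1-a)\<close>, where \<open>H\<close>
  vanishes, so \<open>H\<close> tends to \<open>m\<close> from the left as well. The inequality
  \<open>2/a \<ge> 1/(1-a)\<close> is exactly \<open>a \<le> 2/3\<close>; at \<open>a = 2/3\<close>
  it is an equality and the gap is empty, so this value needs separate care whenever the gap next to
  1 is used.\<close>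

definition orbit_term :: "real \<Rightarrow> real \<Rightarrow> real \<Rightarrow> real \<Rightarrow> nat \<Rightarrow> real" where
  "orbit_term m r a y k = real (delta a y k) * m ^ (k + 1) * r ^ Lk a y k"

definition orbit_weight :: "real \<Rightarrow> real \<Rightarrow> real \<Rightarrow> real \<Rightarrow> nat \<Rightarrow> real" where
  "orbit_weight m r a y k = m ^ k * r ^ Lk a y k"

definition orbit_sum :: "real \<Rightarrow> real \<Rightarrow> real \<Rightarrow> nat \<Rightarrow> real \<Rightarrow> real" where
  "orbit_sum m r a n y = (\<Sum>k<n. orbit_term m r a y k)"

definition tail_fun :: "real \<Rightarrow> real \<Rightarrow> real \<Rightarrow> real \<Rightarrow> real" where
  "tail_fun m r a y = (\<Sum>k. orbit_term m r a y k)"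

text \<open>Phrased with partial sums, the condition presupposes no convergence and is closed under
  limits in \<open>m\<close>. For nonnegative \<open>m\<close> and \<open>r\<close> it says that the
  series at 0 converges to at most 1.\<close>

definition subunit :: "real \<Rightarrow> real \<Rightarrow> real \<Rightarrow> bool" where
  "subunit m r a \<longleftrightarrow> (\<forall>n. orbit_sum m r a n 0 \<le> 1)"

section \<open>Shift rules along orbits\<close>

lemma delta_0: "delta a y 0 = (if y < 1 then 1 else 0)"
  by (simp add: delta_def)

lemma delta_Suc: "delta a y (Suc k) = delta a (Ta a y) k"
  by (simp add: delta_def funpow_swap1)

lemma delta_add: "delta a y (n + k) = delta a ((Ta a ^^ n) y) k"
  by (simp add: delta_def add.commute[of n k] funpow_add)

lemma Lk_0 [simp]: "Lk a y 0 = 0"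
  by (simp add: Lk_def)

lemma Lk_Suc: "Lk a y (Suc k) = Lk a y k + delta a y k"
  by (simp add: Lk_def)

lemma Lk_Suc_shift: "Lk a y (Suc k) = delta a y 0 + Lk a (Ta a y) k"
  unfolding Lk_def sum.lessThan_Suc_shift by (simp add: delta_Suc)

lemma Lk_add: "Lk a y (n + k) = Lk a y n + Lk a ((Ta a ^^ n) y) k"
  by (induction k) (simp_all add: Lk_Suc delta_add)

lemma orbit_term_add:
  "orbit_term m r a y (n + k) = orbit_weight m r a y n * orbit_term m r a ((Ta a ^^ n) y) k"
  by (simp add: orbit_term_def orbit_weight_def delta_add Lk_add power_add)

lemma orbit_weight_add:
  "orbit_weight m r a y (n + k) = orbit_weight m r a y n * orbit_weight m r a ((Ta a ^^ n) y) k"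
  by (simp add: orbit_weight_def Lk_add power_add)

lemma orbit_weight_0 [simp]: "orbit_weight m r a y 0 = 1"
  by (simp add: orbit_weight_def)

lemma orbit_weight_Suc:
  "orbit_weight m r a y (Suc k) = m * (if (Ta a ^^ k) y < 1 then r else 1) * orbit_weight m r a y k"
  by (simp add: orbit_weight_def Lk_Suc delta_def)

lemma orbit_sum_0 [simp]: "orbit_sum m r a 0 y = 0"
  by (simp add: orbit_sum_def)

lemma orbit_sum_add:
  "orbit_sum m r a (n + k) y
     = orbit_sum m r a n y + orbit_weight m r a y n * orbit_sum m r a k ((Ta a ^^ n) y)"
  by (induction k) (simp_all add: orbit_sum_def orbit_term_add distrib_left)

lemma orbit_sum_Suc:
  "orbit_sum m r a (Suc n) y
     = m * (if y < 1 then 1 + r * orbit_sum m r a n (Ta a y) else orbit_sum m r a n (Ta a y))"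
  using orbit_sum_add[of m r a 1 n y]
  by (simp add: orbit_sum_def orbit_term_def orbit_weight_def delta_0 Lk_Suc algebra_simps)

lemma orbit_term_nonneg: "0 \<le> m \<Longrightarrow> 0 \<le> r \<Longrightarrow> 0 \<le> orbit_term m r a y k"
  by (simp add: orbit_term_def)

lemma orbit_weight_nonneg: "0 \<le> m \<Longrightarrow> 0 \<le> r \<Longrightarrow> 0 \<le> orbit_weight m r a y k"
  by (simp add: orbit_weight_def)

lemma orbit_weight_pos: "0 < m \<Longrightarrow> 0 < r \<Longrightarrow> 0 < orbit_weight m r a y k"
  by (simp add: orbit_weight_def)

lemma orbit_sum_nonneg: "0 \<le> m \<Longrightarrow> 0 \<le> r \<Longrightarrow> 0 \<le> orbit_sum m r a n y"
  unfolding orbit_sum_def by (intro sum_nonneg orbit_term_nonneg)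

lemma orbit_sum_mono_n:
  "0 \<le> m \<Longrightarrow> 0 \<le> r \<Longrightarrow> n \<le> n' \<Longrightarrow> orbit_sum m r a n y \<le> orbit_sum m r a n' y"
  unfolding orbit_sum_def by (intro sum_mono2) (auto intro: orbit_term_nonneg)

lemma orbit_weight_mono:
  "0 \<le> m \<Longrightarrow> m \<le> m' \<Longrightarrow> 0 \<le> r \<Longrightarrow> orbit_weight m r a y n \<le> orbit_weight m' r a y n"
  unfolding orbit_weight_def by (intro mult_right_mono power_mono) auto

text \<open>Every term contains \<open>m\<close> to a power of at least 1, so lowering
  \<open>m'\<close> to \<open>m\<close> costs at least one factor \<open>m / m'\<close>. This linear
  bound serves as strict monotonicity in \<open>m\<close> wherever roots are compared.\<close>

lemma orbit_term_scale:
  assumes "0 \<le> m" "m \<le> m'" "0 < m'" "0 \<le> r"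
  shows "orbit_term m r a y k \<le> m / m' * orbit_term m' r a y k"
proof -
  have "m ^ k \<le> m' ^ k" using assms by (intro power_mono) auto
  hence "m * m ^ k \<le> m * m' ^ k" using assms by (intro mult_left_mono) auto
  also have "\<dots> = m / m' * m' ^ (k + 1)" using assms by simp
  finally have *: "m ^ (k + 1) \<le> m / m' * m' ^ (k + 1)" by simp
  show ?thesis
    unfolding orbit_term_def
    using mult_right_mono[OF mult_left_mono[OF *, of "real (delta a y k)"], of "r ^ Lk a y k"] assms
    by (simp add: algebra_simps)
qed

lemma orbit_sum_scale:
  assumes "0 \<le> m" "m \<le> m'" "0 < m'" "0 \<le> r"
  shows "orbit_sum m r a n y \<le> m / m' * orbit_sum m' r a n y"
  unfolding orbit_sum_def sum_distrib_left by (intro sum_mono orbit_term_scale assms)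

section \<open>Orbits above the fixed point 1/(1-a), and the gap\<close>

lemma Ta_nonneg: "0 < a \<Longrightarrow> 0 \<le> y \<Longrightarrow> 0 \<le> Ta a y"
  by (simp add: Ta_def)

lemma Ta_iter_nonneg: "0 < a \<Longrightarrow> 0 \<le> y \<Longrightarrow> 0 \<le> (Ta a ^^ k) y"
  by (induction k) (simp_all add: Ta_nonneg)

text \<open>\<open>1/(1-a)\<close> is the fixed point of the upper branch. In the third bound,
  \<open>2/a\<close> is the value that the formula of the lower branch takes at 1.\<close>

lemma M_bounds:
  fixes a :: real
  assumes "1/2 \<le> a" "a \<le> 2/3"
  shows "2 \<le> 1/(1-a)" "1/(1-a) \<le> 3" "1/(1-a) \<le> 2/a" "a * (1/(1-a)) = 1/(1-a) - 1"
  using assms by (auto simp: field_simps)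

lemma Ta_ge_M:
  assumes "1/2 \<le> a" "a \<le> 2/3" "y \<ge> 1/(1-a)"
  shows "Ta a y \<ge> 1/(1-a)"
proof -
  have y: "\<not> y < 1" using M_bounds[OF assms(1,2)] assms(3) by linarith
  have "(y - 1) / a \<ge> (1/(1-a) - 1) / a"
    using assms by (intro divide_right_mono) auto
  also have "(1/(1-a) - 1) / a = 1/(1-a)" using assms by (simp add: field_simps)
  finally show ?thesis using y by (simp add: Ta_def)
qed

lemma Ta_gt_M:
  assumes "1/2 \<le> a" "a \<le> 2/3" "y > 1/(1-a)"
  shows "Ta a y > 1/(1-a)"
proof -
  have y: "\<not> y < 1" using M_bounds[OF assms(1,2)] assms(3) by linarith
  have "(y - 1) / a > (1/(1-a) - 1) / a"
    using assms by (intro divide_strict_right_mono) auto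
  also have "(1/(1-a) - 1) / a = 1/(1-a)" using assms by (simp add: field_simps)
  finally show ?thesis using y by (simp add: Ta_def)
qed

lemma Ta_iter_ge_M:
  assumes "1/2 \<le> a" "a \<le> 2/3" "y \<ge> 1/(1-a)"
  shows "(Ta a ^^ k) y \<ge> 1/(1-a)"
  by (induction k) (use assms in \<open>auto intro: Ta_ge_M\<close>)

lemma Ta_iter_gt_M:
  assumes "1/2 \<le> a" "a \<le> 2/3" "y > 1/(1-a)"
  shows "(Ta a ^^ k) y > 1/(1-a)"
  by (induction k) (use assms in \<open>auto intro: Ta_gt_M\<close>)

lemma delta_eq_0_ge_M:
  assumes "1/2 \<le> a" "a \<le> 2/3" "y \<ge> 1/(1-a)"
  shows "delta a y k = 0"
  using Ta_iter_ge_M[OF assms, of k] M_bounds[OF assms(1,2)] by (simp add: delta_def)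

lemma delta_eq_0_after_M:
  assumes "1/2 \<le> a" "a \<le> 2/3" "(Ta a ^^ N) y \<ge> 1/(1-a)" "N \<le> k"
  shows "delta a y k = 0"
  using delta_eq_0_ge_M[OF assms(1-3), of "k - N"] assms(4) delta_add[of a y N "k - N"] by simp

lemma Ia_step:
  assumes "1/2 \<le> a" "a \<le> 2/3" "y \<in> Ia a"
  shows "Ta a y > 1/(1-a)"
  using assms by (auto simp: Ia_def Ta_def field_simps)

lemma Ia_iter:
  assumes "1/2 \<le> a" "a \<le> 2/3" "(Ta a ^^ j) y \<in> Ia a" "j < k"
  shows "(Ta a ^^ k) y > 1/(1-a)"
proof -
  define i where "i = k - Suc j"
  have k: "k = i + Suc j" using assms(4) by (simp add: i_def)
  have "(Ta a ^^ k) y = (Ta a ^^ i) (Ta a ((Ta a ^^ j) y))" unfolding k funpow_add by simp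
  thus ?thesis using Ta_iter_gt_M[OF assms(1,2) Ia_step[OF assms(1-3)]] by simp
qed

text \<open>The upper branch is increasing with fixed point \<open>1/(1-a)\<close>, so it cannot
  carry a point across that level. A first exit therefore uses the lower branch, and the points it
  sends above \<open>1/(1-a)\<close> form the gap.\<close>

lemma exceeds_imp_Ia:
  assumes "1/2 \<le> a" "a \<le> 2/3" "0 \<le> y" "y \<le> 1/(1-a)" "(Ta a ^^ k) y > 1/(1-a)"
  shows "\<exists>j<k. (Ta a ^^ j) y \<in> Ia a"
  using assms(5)
proof (induction k)
  case (Suc k)
  show ?case
  proof (cases "(Ta a ^^ k) y > 1/(1-a)")
    case True thus ?thesis using Suc.IH less_SucI by blast
  next
    case False
    define z where "z = (Ta a ^^ k) y"
    have z: "z \<le> 1/(1-a)" "Ta a z > 1/(1-a)" using False Suc.prems by (auto simp: z_def)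
    have "z < 1"
    proof (rule ccontr)
      assume *: "\<not> z < 1"
      have "(z - 1) / a \<le> (1/(1-a) - 1) / a" using z assms by (intro divide_right_mono) auto
      also have "\<dots> = 1/(1-a)" using assms by (simp add: field_simps)
      finally show False using z(2) * by (simp add: Ta_def)
    qed
    hence "z \<in> Ia a"
      using z(2) assms(1,2) by (auto simp: Ia_def Ta_def field_simps)
    hence "(Ta a ^^ k) y \<in> Ia a" by (simp add: z_def)
    thus ?thesis by blast
  qed
qed (use assms in auto)

lemma kappa_eq_infinity_iff:
  assumes "1/2 \<le> a" "a \<le> 2/3" "0 \<le> y" "y \<le> 1/(1-a)"
  shows "kappa a y = \<infinity> \<longleftrightarrow> (\<forall>k. (Ta a ^^ k) y \<le> 1/(1-a))"
proof -
  have "(\<exists>k. (Ta a ^^ k) y \<in> Ia a) \<longleftrightarrow> (\<exists>k. (Ta a ^^ k) y > 1/(1-a))"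
    using exceeds_imp_Ia[OF assms] Ia_iter[OF assms(1,2), of _ y] by (meson lessI)
  thus ?thesis by (auto simp: kappa_def not_le)
qed

lemma after_kappa:
  assumes "1/2 \<le> a" "a \<le> 2/3" "\<not> enat k \<le> kappa a y"
  shows "(Ta a ^^ k) y > 1/(1-a)"
proof -
  have ex: "\<exists>k. (Ta a ^^ k) y \<in> Ia a" using assms(3) by (auto simp: kappa_def split: if_splits)
  define j where "j = (LEAST k. (Ta a ^^ k) y \<in> Ia a)"
  have "(Ta a ^^ j) y \<in> Ia a" unfolding j_def using ex by (metis (mono_tags, lifting) LeastI)
  moreover have "j < k" using assms(3) ex by (auto simp: kappa_def j_def split: if_splits)
  ultimately show ?thesis using Ia_iter assms(1,2) by blast
qed

lemma orbit_term_kappa: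
  assumes "1/2 \<le> a" "a \<le> 2/3"
  shows "(if enat k \<le> kappa a y then real (delta a y k) * m ^ (k + 1) * r ^ Lk a y k else 0)
     = orbit_term m r a y k"
proof (cases "enat k \<le> kappa a y")
  case False
  hence "delta a y k = 0"
    using after_kappa[OF assms False] M_bounds[OF assms] by (simp add: delta_def)
  thus ?thesis by (simp add: orbit_term_def)
qed (simp add: orbit_term_def)

text \<open>Larger starting points and smaller parameters make the itinerary lexicographically larger;
  the bound \<open>subunit\<close> says that losing a visit to \<open>[0,1)\<close> cannot be compensated afterwards.\<close>

lemma orbit_sum_antimono:
  assumes "0 < a" "a \<le> b" "0 \<le> m" "0 \<le> r"
    and "\<And>k. k < n \<Longrightarrow> orbit_sum m r b k 0 \<le> 1" and "0 \<le> y" "y \<le> x"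
  shows "orbit_sum m r a n x \<le> orbit_sum m r b n y"
  using assms(5-7)
proof (induction n arbitrary: x y)
  case (Suc n)
  have b: "0 < b" using assms by linarith
  have "0 \<le> x" using Suc.prems by linarith
  hence Tx: "0 \<le> Ta a x" using Ta_nonneg assms(1) by blast
  have IH: "orbit_sum m r a n x' \<le> orbit_sum m r b n y'" if "0 \<le> y'" "y' \<le> x'" for x' y'
    using Suc that by auto
  consider "x < 1" | "1 \<le> y" | "y < 1" "1 \<le> x" by linarith
  thus ?case
  proof cases
    case 1
    have "0 \<le> Ta b y" "Ta b y \<le> Ta a x"
      using 1 Suc.prems assms b by (auto simp: Ta_def intro!: frac_le)
    from IH[OF this] show ?thesis using 1 Suc.prems assms
      by (auto simp: orbit_sum_Suc intro!: mult_left_mono)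
  next
    case 2
    have "0 \<le> Ta b y" "Ta b y \<le> Ta a x"
      using 2 Suc.prems assms b by (auto simp: Ta_def intro!: frac_le)
    from IH[OF this] show ?thesis using 2 Suc.prems assms
      by (auto simp: orbit_sum_Suc intro!: mult_left_mono)
  next
    case 3
    \<comment> \<open>The tail at \<open>a\<close> is compared with the orbit of 0 at
      \<open>b\<close>, so the bound by 1 is required for the larger parameter only.\<close>
    have "orbit_sum m r a n (Ta a x) \<le> orbit_sum m r b n 0" using IH[of 0] Tx by simp
    also have "\<dots> \<le> 1" using Suc.prems by simp
    also have "1 \<le> 1 + r * orbit_sum m r b n (Ta b y)"
      using orbit_sum_nonneg[of m r b n] assms by simp
    finally show ?thesis using 3 assms by (auto simp: orbit_sum_Suc intro!: mult_left_mono)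
  qed
qed simp

lemma orbit_sum_le_1:
  assumes "0 < a" "a \<le> b" "0 \<le> m" "0 \<le> r" "subunit m r b" "0 \<le> y"
  shows "orbit_sum m r a n y \<le> 1"
  using orbit_sum_antimono[of a b m r n 0 y] assms unfolding subunit_def
  by (meson order_refl order_trans)

section \<open>Limits of the partial sums, decay of the weights, existence of the root\<close>

lemma summable_orbit_term:
  assumes "0 < a" "a \<le> b" "0 \<le> m" "0 \<le> r" "subunit m r b" "0 \<le> y"
  shows "summable (orbit_term m r a y)"
  using orbit_sum_le_1[OF assms] orbit_term_nonneg[OF assms(3,4)]
  unfolding orbit_sum_def by (intro summableI_nonneg_bounded[where x = 1]) auto

lemma orbit_sum_tendsto:
  assumes "0 < a" "a \<le> b" "0 \<le> m" "0 \<le> r" "subunit m r b" "0 \<le> y"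
  shows "(\<lambda>n. orbit_sum m r a n y) \<longlonglongrightarrow> tail_fun m r a y"
  using summable_LIMSEQ[OF summable_orbit_term[OF assms]]
  unfolding orbit_sum_def tail_fun_def .

lemma tail_fun_nonneg:
  assumes "0 < a" "a \<le> b" "0 \<le> m" "0 \<le> r" "subunit m r b" "0 \<le> y"
  shows "0 \<le> tail_fun m r a y"
  unfolding tail_fun_def
  by (intro suminf_nonneg summable_orbit_term[OF assms] orbit_term_nonneg assms)

lemma tail_fun_le_1:
  assumes "0 < a" "a \<le> b" "0 \<le> m" "0 \<le> r" "subunit m r b" "0 \<le> y"
  shows "tail_fun m r a y \<le> 1"
  by (rule LIMSEQ_le_const2[OF orbit_sum_tendsto[OF assms]]) (use orbit_sum_le_1[OF assms] in auto)

lemma orbit_sum_le_tail_fun: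
  assumes "0 < a" "a \<le> b" "0 \<le> m" "0 \<le> r" "subunit m r b" "0 \<le> y"
  shows "orbit_sum m r a n y \<le> tail_fun m r a y"
  unfolding orbit_sum_def tail_fun_def
  by (intro sum_le_suminf summable_orbit_term[OF assms]) (auto intro: orbit_term_nonneg assms)

lemma tail_fun_antimono:
  assumes "0 < a" "a \<le> b" "0 \<le> m" "0 \<le> r" "subunit m r b" "0 \<le> y" "y \<le> x"
  shows "tail_fun m r a x \<le> tail_fun m r b y"
proof (rule LIMSEQ_le)
  show "(\<lambda>n. orbit_sum m r a n x) \<longlonglongrightarrow> tail_fun m r a x"
    using assms by (intro orbit_sum_tendsto[where b = b]) auto
  show "(\<lambda>n. orbit_sum m r b n y) \<longlonglongrightarrow> tail_fun m r b y"
    using assms by (intro orbit_sum_tendsto[where b = b]) auto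
  show "\<exists>N. \<forall>n\<ge>N. orbit_sum m r a n x \<le> orbit_sum m r b n y"
    using orbit_sum_antimono[OF assms(1-4) _ assms(6,7)] assms(5) unfolding subunit_def by blast
qed

lemma tail_fun_split:
  assumes "0 < a" "a \<le> b" "0 \<le> m" "0 \<le> r" "subunit m r b" "0 \<le> y"
  shows "tail_fun m r a y
     = orbit_sum m r a n y + orbit_weight m r a y n * tail_fun m r a ((Ta a ^^ n) y)"
proof (rule LIMSEQ_unique)
  show "(\<lambda>k. orbit_sum m r a (n + k) y) \<longlonglongrightarrow> tail_fun m r a y"
    using LIMSEQ_ignore_initial_segment[OF orbit_sum_tendsto[OF assms], of n]
    by (simp add: add.commute)
  show "(\<lambda>k. orbit_sum m r a (n + k) y) \<longlonglongrightarrow>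
    orbit_sum m r a n y + orbit_weight m r a y n * tail_fun m r a ((Ta a ^^ n) y)"
    unfolding orbit_sum_add
    by (intro tendsto_intros orbit_sum_tendsto[where b = b] Ta_iter_nonneg assms)
qed

lemma tail_fun_step:
  assumes "0 < a" "a \<le> b" "0 \<le> m" "0 \<le> r" "subunit m r b" "0 \<le> y"
  shows "tail_fun m r a y
     = m * (if y < 1 then 1 + r * tail_fun m r a (Ta a y) else tail_fun m r a (Ta a y))"
  using tail_fun_split[OF assms, of 1]
  by (simp add: orbit_sum_Suc[of _ _ _ 0, simplified] orbit_weight_Suc[of _ _ _ _ 0, simplified]
      algebra_simps)

lemma tail_fun_eq_0:
  assumes "1/2 \<le> a" "a \<le> 2/3" "y \<ge> 1/(1-a)"
  shows "tail_fun m r a y = 0"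
  by (simp add: tail_fun_def orbit_term_def delta_eq_0_ge_M[OF assms])

lemma tail_fun_eq_orbit_sum:
  assumes "1/2 \<le> a" "a \<le> 2/3" "(Ta a ^^ N) y \<ge> 1/(1-a)"
  shows "tail_fun m r a y = orbit_sum m r a N y"
  unfolding tail_fun_def orbit_sum_def
  by (rule suminf_finite) (auto simp: orbit_term_def delta_eq_0_after_M[OF assms])

lemma iter_dist_M:
  assumes "0 < a" "a < 1" "\<And>j. j < k \<Longrightarrow> (Ta a ^^ j) y \<ge> 1"
  shows "1/(1-a) - (Ta a ^^ k) y = (1/(1-a) - y) / a ^ k"
  using assms(3)
proof (induction k)
  case (Suc k)
  have "(Ta a ^^ k) y \<ge> 1" using Suc.prems by simp
  moreover have "(1/(1-a) - z) / a = 1/(1-a) - (z - 1) / a" for z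
    using assms by (simp add: field_simps)
  ultimately have "1/(1-a) - (Ta a ^^ Suc k) y = (1/(1-a) - (Ta a ^^ k) y) / a"
    by (simp add: Ta_def)
  thus ?case using Suc assms by simp
qed simp

text \<open>Below the repelling fixed point \<open>1/(1-a)\<close> each step of the upper branch
  multiplies the distance to it by \<open>1/a\<close>. An orbit that stays at or above 1 has
  distance at most \<open>1/(1-a) - 1 \<le> 2\<close>, which is eventually violated.\<close>

lemma visits_below_1:
  assumes "1/2 \<le> a" "a \<le> 2/3" "y < 1/(1-a)"
  shows "\<exists>k. delta a y k = 1"
proof (rule ccontr)
  assume "\<not> ?thesis"
  hence ge: "(Ta a ^^ k) y \<ge> 1" for k by (metis delta_def not_less)
  define d where "d = 1/(1-a) - y"
  have d: "d > 0" using assms by (simp add: d_def)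
  obtain k where k: "(1/a) ^ k > 2 / d"
    using real_arch_pow[of "1/a" "2/d"] assms by (auto simp: field_simps)
  have "1/(1-a) - (Ta a ^^ k) y = d * (1/a) ^ k"
    using iter_dist_M[of a k y] ge assms by (simp add: d_def power_divide)
  hence "1/(1-a) - (Ta a ^^ k) y > 2" using k d by (simp add: field_simps)
  thus False using ge[of k] M_bounds[OF assms(1,2)] by linarith
qed

lemma tail_fun_pos:
  assumes "1/2 \<le> a" "a \<le> b" "b \<le> 2/3" "0 < m" "0 < r" "subunit m r b" "0 \<le> y" "y < 1/(1-a)"
  shows "tail_fun m r a y > 0"
proof -
  have a: "0 < a" "a \<le> 2/3" using assms by auto
  obtain k where "delta a y k = 1" using visits_below_1[of a y] assms a by auto
  hence "0 < orbit_term m r a y k" using assms by (simp add: orbit_term_def)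
  moreover have "summable (orbit_term m r a y)"
    using assms a by (intro summable_orbit_term[where b = b]) auto
  ultimately show ?thesis unfolding tail_fun_def
    using suminf_pos2 orbit_term_nonneg assms by (metis less_imp_le)
qed

text \<open>When \<open>r > 1\<close> the factor \<open>m * r\<close> of a low visit may exceed 1,
  so decay is not visible step by step. But after a low visit the new weight is \<open>r\<close>
  times a term of the series, and every other step contracts by \<open>m\<close>; summing these two
  cases telescopes.\<close>

lemma sum_orbit_weight_le:
  assumes "0 \<le> m" "m < 1" "0 \<le> r" "\<And>n. orbit_sum m r a n y \<le> 1"
  shows "(\<Sum>k<n. orbit_weight m r a y k) \<le> (1 + r) / (1 - m)"
proof -
  have "(1 - m) * (\<Sum>k<n. orbit_weight m r a y k) \<le> 1 - orbit_weight m r a y n + r * orbit_sum m r a n y"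
  proof (induction n)
    case (Suc n)
    have "orbit_weight m r a y (Suc n) \<le> m * orbit_weight m r a y n + r * orbit_term m r a y n"
      using orbit_weight_nonneg[of m r a y n] assms
      by (auto simp: orbit_weight_def orbit_term_def Lk_Suc delta_def)
    thus ?case using Suc by (simp add: orbit_sum_def algebra_simps)
  qed simp
  also have "\<dots> \<le> 1 + r * 1"
    using orbit_weight_nonneg[of m r a y n] assms by (intro add_mono mult_left_mono) auto
  finally show ?thesis using assms by (simp add: field_simps)
qed

lemma summable_orbit_weight:
  assumes "0 \<le> m" "m < 1" "0 \<le> r" "\<And>n. orbit_sum m r a n y \<le> 1"
  shows "summable (orbit_weight m r a y)"
  using sum_orbit_weight_le[OF assms] orbit_weight_nonneg[OF assms(1,3)]
  by (intro summableI_nonneg_bounded[where x = "(1 + r) / (1 - m)"]) auto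

lemma orbit_weight_tendsto_0:
  assumes "0 \<le> m" "m < 1" "0 \<le> r" "\<And>n. orbit_sum m r a n y \<le> 1"
  shows "orbit_weight m r a y \<longlonglongrightarrow> 0"
  using summable_LIMSEQ_zero[OF summable_orbit_weight[OF assms]] .

lemma continuous_orbit_sum: "continuous_on UNIV (\<lambda>m. orbit_sum m r a n y)"
  unfolding orbit_sum_def orbit_term_def by (intro continuous_intros)

lemma continuous_orbit_weight: "continuous_on UNIV (\<lambda>m. orbit_weight m r a y n)"
  unfolding orbit_weight_def by (intro continuous_intros)

text \<open>A finite certificate for \<open>subunit\<close>: after time \<open>N\<close> the orbit
  contributes at most what the orbit of 0 contributes in fewer steps, hence at most 1 by induction.
  The certificate is an inequality between polynomials in \<open>m\<close>, so its strict form
  survives a small increase of \<open>m\<close>.\<close>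

lemma subunit_extend:
  assumes "0 < a" "0 \<le> m" "0 \<le> r" "0 < N" "orbit_sum m r a N 0 + orbit_weight m r a 0 N \<le> 1"
  shows "subunit m r a"
proof -
  have "orbit_sum m r a n 0 \<le> 1" for n
  proof (induction n rule: less_induct)
    case (less n)
    show ?case
    proof (cases "n \<le> N")
      case True
      have "orbit_sum m r a n 0 \<le> orbit_sum m r a N 0"
        using True assms by (intro orbit_sum_mono_n) auto
      thus ?thesis using assms(5) orbit_weight_nonneg[OF assms(2,3), of a 0 N] by linarith
    next
      case False
      define k where "k = n - N"
      have n: "n = N + k" "k < n" using False assms(4) by (auto simp: k_def)
      have "orbit_sum m r a k ((Ta a ^^ N) 0) \<le> orbit_sum m r a k 0"
        using less n assms by (intro orbit_sum_antimono Ta_iter_nonneg) auto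
      also have "\<dots> \<le> 1" using less n by blast
      finally have "orbit_sum m r a n 0 \<le> orbit_sum m r a N 0 + orbit_weight m r a 0 N * 1"
        unfolding n(1) orbit_sum_add using orbit_weight_nonneg[OF assms(2,3)]
        by (intro add_left_mono mult_left_mono) auto
      thus ?thesis using assms(5) by linarith
    qed
  qed
  thus ?thesis by (simp add: subunit_def)
qed

text \<open>The root is the supremum of the admissible \<open>m\<close>. If the sum were below 1
  there, the weights would tend to 0, some finite certificate would hold strictly, and slightly
  larger \<open>m\<close> would be admissible. The search stays in \<open>[0,1]\<close> because the
  term \<open>k = 0\<close> equals \<open>m\<close>.\<close>

lemma root_exists:
  assumes "0 < a" "0 < r"
  shows "\<exists>m. 0 < m \<and> m \<le> 1 \<and> subunit m r a \<and> tail_fun m r a 0 = 1"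
proof -
  define A where "A = {m\<in>{0..1}. subunit m r a}"
  have "A = {0..1} \<inter> (\<Inter>n. {m. orbit_sum m r a n 0 \<le> 1})" by (auto simp: A_def subunit_def)
  moreover have "closed {m. orbit_sum m r a n 0 \<le> 1}" for n
    by (intro closed_Collect_le continuous_orbit_sum continuous_intros)
  ultimately have "closed A" by (auto intro!: closed_Int closed_INT)
  moreover have "0 \<in> A"
    by (auto simp: A_def subunit_def orbit_sum_def orbit_term_def intro!: order_trans[OF _ zero_le_one] sum_nonpos)
  moreover have bdd: "bdd_above A" by (auto simp: A_def intro!: bdd_aboveI[of _ 1])
  ultimately have mA: "Sup A \<in> A" using closed_contains_Sup by blast
  define m where "m = Sup A"
  have m: "0 \<le> m" "m \<le> 1" "subunit m r a" using mA by (auto simp: m_def A_def)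
  have le1: "orbit_sum m r a n 0 \<le> 1" for n using m(3) by (simp add: subunit_def)
  have H1: "tail_fun m r a 0 \<le> 1" using m assms by (intro tail_fun_le_1[where b = a]) auto
  have eq: "tail_fun m r a 0 = 1"
  proof (rule ccontr)
    assume "tail_fun m r a 0 \<noteq> 1"
    with H1 have lt: "tail_fun m r a 0 < 1" by simp
    have "m \<noteq> 1"
    proof
      assume "m = 1"
      hence "orbit_sum m r a 1 0 = 1" by (simp add: orbit_sum_Suc[of _ _ _ 0, simplified])
      thus False using orbit_sum_le_tail_fun[of a a m r 0 1] m assms lt by auto
    qed
    hence m1: "m < 1" using m by simp
    have "orbit_weight m r a 0 \<longlonglongrightarrow> 0" using m m1 assms le1 by (intro orbit_weight_tendsto_0) auto
    hence "eventually (\<lambda>n. orbit_weight m r a 0 n < 1 - tail_fun m r a 0) sequentially"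
      using lt by (intro order_tendstoD(2)) auto
    hence "eventually (\<lambda>n. n > 0 \<and> orbit_weight m r a 0 n < 1 - tail_fun m r a 0) sequentially"
      using eventually_gt_at_top eventually_conj by blast
    then obtain N where N: "N > 0" "orbit_weight m r a 0 N < 1 - tail_fun m r a 0"
      by (auto dest: eventually_happens'[OF sequentially_bot])
    define f where "f m = orbit_sum m r a N 0 + orbit_weight m r a 0 N" for m
    have "f m < 1" using N(2) orbit_sum_le_tail_fun[of a a m r 0 N] m assms by (simp add: f_def)
    moreover have "continuous_on UNIV f" unfolding f_def
      by (intro continuous_intros continuous_orbit_sum continuous_orbit_weight)
    hence "(f \<longlongrightarrow> f m) (at_right m)"
      using filterlim_at_split by (fastforce simp: continuous_on_eq_continuous_at isCont_def)
    ultimately have "eventually (\<lambda>x. f x < 1) (at_right m)" by (intro order_tendstoD(2))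
    moreover have "eventually (\<lambda>x. x < 1) (at_right m)"
      using m1 eventually_at_right_field by blast
    ultimately have "eventually (\<lambda>x. f x < 1 \<and> x < 1 \<and> m < x) (at_right m)"
      using eventually_at_right_less[of m] by eventually_elim auto
    then obtain x where x: "f x < 1" "x < 1" "m < x"
      by (auto dest!: eventually_happens'[rotated])
    have "subunit x r a" using x m N assms
      by (intro subunit_extend[of a x r N]) (auto simp: f_def)
    hence "x \<in> A" using x m by (auto simp: A_def)
    thus False using cSup_upper[OF _ bdd, of x] x(3) by (simp add: m_def)
  qed
  have "m \<noteq> 0"
  proof
    assume "m = 0"
    hence "tail_fun m r a 0 = 0" by (simp add: tail_fun_def orbit_term_def)
    thus False using eq by simp
  qed
  thus ?thesis using m eq by (intro exI[of _ m]) auto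
qed

section \<open>The root of the characteristic equation\<close>

text \<open>The bounded variable of the characteristic equation: it lies in \<open>(0,1]\<close>.
  Comparisons are made for \<open>mu\<close> and then carried over to
  \<open>lam = p / mu\<close>.\<close>

definition mu :: "real \<Rightarrow> real \<Rightarrow> real" where
  "mu a p = p / lam a p"

abbreviation odds :: "real \<Rightarrow> real" where
  "odds p \<equiv> (1 - p) / p"

lemma char_eq_iff:
  assumes "1/2 \<le> a" "a \<le> 2/3"
  shows "char_eq a p l \<longleftrightarrow> orbit_term (p / l) (odds p) a 0 sums 1"
proof -
  have "char_term a p l = orbit_term (p / l) (odds p) a 0"
    by (rule ext) (simp only: char_term_def orbit_term_kappa[OF assms])
  thus ?thesis by (simp add: char_eq_def)
qed

lemma orbit_term_sums_1_unique:
  assumes "0 < m" "0 < m'" "0 \<le> r" "orbit_term m r a y sums 1" "orbit_term m' r a y sums 1"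
  shows "m = m'"
proof -
  have *: False if "0 < m" "m < m'" "orbit_term m r a y sums 1" "orbit_term m' r a y sums 1" for m m'
  proof -
    have "1 \<le> m / m' * 1"
      using that assms orbit_term_scale[of m m' r a y]
      by (intro sums_le[OF _ that(3) sums_mult[OF that(4)]]) auto
    thus False using that by simp
  qed
  show ?thesis using *[of m m'] *[of m' m] assms by force
qed

lemma char_root:
  assumes "1/2 \<le> a" "a \<le> 2/3" "0 < p" "p < 1"
  shows "\<exists>!l. l > 0 \<and> char_eq a p l"
    and "0 < lam a p" "0 < mu a p" "mu a p \<le> 1" "subunit (mu a p) (odds p) a"
    and "tail_fun (mu a p) (odds p) a 0 = 1" "orbit_term (mu a p) (odds p) a 0 sums 1"
proof -
  have r: "0 < odds p" using assms by simp
  obtain m where m: "0 < m" "m \<le> 1" "subunit m (odds p) a" "tail_fun m (odds p) a 0 = 1"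
    using root_exists[of a "odds p"] r assms by auto
  have s: "orbit_term m (odds p) a 0 sums 1"
    using summable_sums[OF summable_orbit_term[of a a m "odds p" 0]] m r assms
    by (simp add: tail_fun_def)
  have l: "p / m > 0" "char_eq a p (p / m)"
    using m s assms by (auto simp: char_eq_iff)
  have uniq: "l = p / m" if "l > 0" "char_eq a p l" for l
  proof -
    have "p / l = m"
      using that s assms m r by (intro orbit_term_sums_1_unique[of "p/l" m "odds p" a 0]) (auto simp: char_eq_iff)
    thus ?thesis using that m by (auto simp: field_simps)
  qed
  show "\<exists>!l. l > 0 \<and> char_eq a p l" using l uniq by blast
  have lam: "lam a p = p / m" unfolding lam_def using l uniq by blast
  hence mu: "mu a p = m" using assms m by (simp add: mu_def)
  show "0 < lam a p" "0 < mu a p" "mu a p \<le> 1" "subunit (mu a p) (odds p) a"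
    "tail_fun (mu a p) (odds p) a 0 = 1" "orbit_term (mu a p) (odds p) a 0 sums 1"
    using lam mu m l s by auto
qed

lemma lam_eq: "1/2 \<le> a \<Longrightarrow> a \<le> 2/3 \<Longrightarrow> 0 < p \<Longrightarrow> p < 1 \<Longrightarrow> lam a p = p / mu a p"
  using char_root(2)[of a p] by (simp add: mu_def)

lemma mu_unique:
  assumes "1/2 \<le> a" "a \<le> 2/3" "0 < p" "p < 1" "0 < m" "orbit_term m (odds p) a 0 sums 1"
  shows "mu a p = m"
  using assms char_root[OF assms(1-4)]
  by (intro orbit_term_sums_1_unique[of _ _ "odds p" a 0]) auto

text \<open>For \<open>a > 1/2\<close> the image \<open>1/a\<close> of 0 lies strictly below
  \<open>1/(1-a)\<close>, so the series has a positive contribution beyond its first term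
  \<open>mu a p\<close>.\<close>

lemma mu_less_1:
  assumes "1/2 < a" "a \<le> 2/3" "0 < p" "p < 1"
  shows "mu a p < 1"
proof -
  note c = char_root[of a p]
  have "1/a < 1/(1-a)" using assms by (simp add: field_simps)
  hence "tail_fun (mu a p) (odds p) a (1/a) > 0"
    using assms c by (intro tail_fun_pos[where b = a]) auto
  moreover have "1 = mu a p * (1 + odds p * tail_fun (mu a p) (odds p) a (1/a))"
    using tail_fun_step[of a a "mu a p" "odds p" 0] assms c by (simp add: Ta_def)
  moreover have "odds p > 0" using assms by simp
  ultimately show ?thesis using c assms
    by (smt (verit) mult_pos_pos mult_less_cancel_left1)
qed

lemma lam_greater:
  assumes "1/2 < a" "a \<le> 2/3" "0 < p" "p < 1"
  shows "p < lam a p"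
  using mu_less_1[OF assms] char_root(2,3)[of a p] assms by (simp add: mu_def field_simps)

lemma lam_half:
  assumes "0 < p" "p < 1"
  shows "lam (1/2) p = p"
proof -
  have "Ta (1/2) 0 = 2" by (simp add: Ta_def)
  hence "(Ta (1/2) ^^ 1) 0 \<ge> 1 / (1 - 1/2)" by simp
  hence "delta (1/2) 0 k = 0" if "1 \<le> k" for k
    using delta_eq_0_after_M[of "1/2" 1 0 k] that by simp
  hence "orbit_term 1 (odds p) (1/2) 0 sums (\<Sum>k\<in>{0}. orbit_term 1 (odds p) (1/2) 0 k)"
    by (intro sums_finite) (auto simp: orbit_term_def)
  hence "orbit_term 1 (odds p) (1/2) 0 sums 1" by (simp add: orbit_term_def delta_0)
  hence "mu (1/2) p = 1" using assms by (intro mu_unique) auto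
  thus ?thesis using lam_eq[of "1/2" p] assms by simp
qed

lemma tail_fun_scale:
  assumes "0 < a" "a \<le> b" "0 \<le> m" "m \<le> m'" "0 < m'" "0 \<le> r" "subunit m' r b" "0 \<le> y"
    "subunit m r b"
  shows "tail_fun m r a y \<le> m / m' * tail_fun m' r a y"
  using assms
  by (intro LIMSEQ_le[OF orbit_sum_tendsto tendsto_mult_left[OF orbit_sum_tendsto]]
      exI[of _ 0] allI impI orbit_sum_scale) auto

lemma subunit_mono:
  assumes "0 \<le> m" "m \<le> m'" "0 < m'" "0 \<le> r" "subunit m' r b"
  shows "subunit m r b"
  unfolding subunit_def
proof
  fix n
  have "orbit_sum m r b n 0 \<le> m / m' * orbit_sum m' r b n 0" using assms by (intro orbit_sum_scale)
  also have "\<dots> \<le> 1 * 1"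
    using assms orbit_sum_nonneg[of m' r b n 0] by (intro mult_mono) (auto simp: subunit_def)
  finally show "orbit_sum m r b n 0 \<le> 1" by simp
qed

text \<open>If \<open>mu a p < mu b p\<close>, the value 1 at (\<open>mu a p\<close>,
  \<open>a\<close>) is at most \<open>mu a p / mu b p\<close> times the value at the mixed pair
  (\<open>mu b p\<close>, \<open>a\<close>), and the latter is at most the value 1 at
  (\<open>mu b p\<close>, \<open>b\<close>). The mixed pair is controlled by \<open>subunit\<close>
  at \<open>b\<close>.\<close>

lemma mu_antimono:
  assumes "1/2 \<le> a" "a \<le> b" "b \<le> 2/3" "0 < p" "p < 1"
  shows "mu b p \<le> mu a p"
proof (rule ccontr)
  assume "\<not> ?thesis"
  hence lt: "mu a p < mu b p" by simp
  have ca: "0 < mu a p" "subunit (mu a p) (odds p) a" "tail_fun (mu a p) (odds p) a 0 = 1"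
    and cb: "0 < mu b p" "subunit (mu b p) (odds p) b" "tail_fun (mu b p) (odds p) b 0 = 1"
    using char_root[of a p] char_root[of b p] assms by auto
  have "1 \<le> mu a p / mu b p * tail_fun (mu b p) (odds p) a 0"
    using tail_fun_scale[of a b "mu a p" "mu b p" "odds p" 0] ca cb lt assms
      subunit_mono[of "mu a p" "mu b p" "odds p" b] by auto
  also have "tail_fun (mu b p) (odds p) a 0 \<le> 1"
    using tail_fun_antimono[of a b "mu b p" "odds p" 0 0] cb assms by simp
  hence "mu a p / mu b p * tail_fun (mu b p) (odds p) a 0 \<le> mu a p / mu b p * 1"
    using ca cb by (intro mult_left_mono) auto
  finally show False using lt ca by simp
qed

section \<open>Comparison of itineraries\<close>

lemma orbit_cong:
  assumes "\<And>j. j < N \<Longrightarrow> delta a x j = delta b y j" "n \<le> N"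
  shows "orbit_sum m r a n x = orbit_sum m r b n y" "orbit_weight m r a x n = orbit_weight m r b y n"
proof -
  have L: "Lk a x k = Lk b y k" if "k \<le> N" for k
    using assms that by (simp add: Lk_def)
  show "orbit_sum m r a n x = orbit_sum m r b n y" "orbit_weight m r a x n = orbit_weight m r b y n"
    using assms L by (auto simp: orbit_sum_def orbit_term_def orbit_weight_def)
qed

lemma affine_step_near:
  fixes b y s e :: real
  assumes "0 < b" "0 < e"
  shows "\<exists>d>0. \<forall>a x. \<bar>a - b\<bar> < d \<longrightarrow> \<bar>x - y\<bar> < d \<longrightarrow> \<bar>(x + s) / a - (y + s) / b\<bar> < e"
proof -
  have "isCont (\<lambda>z. (snd z + s) / fst z) (b, y)"
    using assms by (intro continuous_intros) auto
  then obtain d where d: "d > 0"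
    "\<And>z. dist z (b, y) < d \<Longrightarrow> dist ((snd z + s) / fst z) ((y + s) / b) < e"
    using assms(2) unfolding continuous_at_eps_delta by fastforce
  show ?thesis
  proof (intro exI[of _ "d/2"] conjI allI impI)
    fix a x :: real assume "\<bar>a - b\<bar> < d/2" "\<bar>x - y\<bar> < d/2"
    moreover have "dist (a, x) (b, y) \<le> \<bar>a - b\<bar> + \<bar>x - y\<bar>"
      using sqrt_sum_squares_le_sum_abs[of "a - b" "x - y"] by (simp add: dist_prod_def dist_real_def)
    ultimately have "dist (a, x) (b, y) < d" by linarith
    from d(2)[OF this] show "\<bar>(x + s) / a - (y + s) / b\<bar> < e" by (simp add: dist_real_def)
  qed (use d in auto)
qed

text \<open>The threshold 1 belongs to the upper branch, so moving up never changes the branch of a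
  point \<open>\<ge> 1\<close>, and a small move does not change that of a point \<open>< 1\<close>.
  Raising the point and lowering the parameter both push the image up, which keeps the perturbation
  one-sided along the orbit.\<close>

lemma orbit_near_above:
  assumes "0 < b" "0 \<le> y" "0 < e"
  shows "\<exists>d>0. \<forall>a x. 0 < a \<longrightarrow> a \<le> b \<longrightarrow> b - d < a \<longrightarrow> y \<le> x \<longrightarrow> x < y + d \<longrightarrow>
     (\<forall>j<N. delta a x j = delta b y j) \<and> (Ta b ^^ N) y \<le> (Ta a ^^ N) x \<and> (Ta a ^^ N) x < (Ta b ^^ N) y + e"
  using assms(2)
proof (induction N arbitrary: y)
  case 0 show ?case using assms by auto
next
  case (Suc N)
  obtain d1 where d1: "d1 > 0" "\<And>a x. 0 < a \<Longrightarrow> a \<le> b \<Longrightarrow> b - d1 < a \<Longrightarrow> Ta b y \<le> x \<Longrightarrow> x < Ta b y + d1 \<Longrightarrow>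
     (\<forall>j<N. delta a x j = delta b (Ta b y) j) \<and> (Ta b ^^ N) (Ta b y) \<le> (Ta a ^^ N) x
       \<and> (Ta a ^^ N) x < (Ta b ^^ N) (Ta b y) + e"
    using Suc.IH[of "Ta b y"] Ta_nonneg[of b y] assms Suc.prems by blast
  define s :: real where "s = (if y < 1 then 1 else -1)"
  have Ty: "Ta b y = (y + s) / b" by (simp add: Ta_def s_def)
  obtain d2 where d2: "d2 > 0" "\<And>a x. \<bar>a - b\<bar> < d2 \<Longrightarrow> \<bar>x - y\<bar> < d2 \<Longrightarrow> \<bar>(x + s) / a - (y + s) / b\<bar> < d1"
    using affine_step_near[OF assms(1) d1(1), of y s] by blast
  define d where "d = Min {d1, d2, (if y < 1 then 1 - y else 1)}"
  have d: "d > 0" "d \<le> d1" "d \<le> d2" "y < 1 \<Longrightarrow> d \<le> 1 - y" using d1 d2 by (auto simp: d_def)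
  show ?case
  proof (intro exI[of _ d] conjI allI impI)
    fix a x assume h: "0 < a" "a \<le> b" "b - d < a" "y \<le> x" "x < y + d"
    have cls: "x < 1 \<longleftrightarrow> y < 1" using h d by auto
    hence Tx: "Ta a x = (x + s) / a" by (simp add: Ta_def s_def)
    have ys: "0 \<le> y + s" using Suc.prems by (simp add: s_def)
    have "(y + s) / b \<le> (x + s) / a" using h ys by (intro frac_le) auto
    moreover have "(x + s) / a < (y + s) / b + d1" using d2(2)[of a x] h d by auto
    ultimately have *: "(\<forall>j<N. delta a (Ta a x) j = delta b (Ta b y) j) \<and> (Ta b ^^ N) (Ta b y) \<le> (Ta a ^^ N) (Ta a x)
       \<and> (Ta a ^^ N) (Ta a x) < (Ta b ^^ N) (Ta b y) + e"
      using d1(2)[of a "Ta a x"] h d Tx Ty by auto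
    show "(Ta b ^^ Suc N) y \<le> (Ta a ^^ Suc N) x" "(Ta a ^^ Suc N) x < (Ta b ^^ Suc N) y + e"
      using * by (simp_all only: funpow_Suc_right o_apply)
    fix j assume "j < Suc N"
    thus "delta a x j = delta b y j" using * cls by (cases j) (auto simp: delta_0 delta_Suc)
  qed (use d in auto)
qed

lemma orbit_near:
  assumes "0 < b" "0 < e" "\<And>j. j < N \<Longrightarrow> (Ta b ^^ j) y \<noteq> 1"
  shows "\<exists>d>0. \<forall>a x. \<bar>a - b\<bar> < d \<longrightarrow> \<bar>x - y\<bar> < d \<longrightarrow>
     (\<forall>j<N. delta a x j = delta b y j) \<and> \<bar>(Ta a ^^ N) x - (Ta b ^^ N) y\<bar> < e"
  using assms(3)
proof (induction N arbitrary: y)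
  case 0 show ?case using assms by auto
next
  case (Suc N)
  have "(Ta b ^^ j) (Ta b y) \<noteq> 1" if "j < N" for j
    using Suc.prems[of "Suc j"] that by (simp add: funpow_swap1)
  then obtain d1 where d1: "d1 > 0" "\<And>a x. \<bar>a - b\<bar> < d1 \<Longrightarrow> \<bar>x - Ta b y\<bar> < d1 \<Longrightarrow>
     (\<forall>j<N. delta a x j = delta b (Ta b y) j) \<and> \<bar>(Ta a ^^ N) x - (Ta b ^^ N) (Ta b y)\<bar> < e"
    using Suc.IH[of "Ta b y"] by blast
  have y1: "y \<noteq> 1" using Suc.prems[of 0] by simp
  define s :: real where "s = (if y < 1 then 1 else -1)"
  have Ty: "Ta b y = (y + s) / b" by (simp add: Ta_def s_def)
  obtain d2 where d2: "d2 > 0" "\<And>a x. \<bar>a - b\<bar> < d2 \<Longrightarrow> \<bar>x - y\<bar> < d2 \<Longrightarrow> \<bar>(x + s) / a - (y + s) / b\<bar> < d1"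
    using affine_step_near[OF assms(1) d1(1), of y s] by blast
  define d where "d = Min {d1, d2, \<bar>1 - y\<bar>}"
  have d: "d > 0" "d \<le> d1" "d \<le> d2" "d \<le> \<bar>1 - y\<bar>" using d1 d2 y1 by (auto simp: d_def)
  show ?case
  proof (intro exI[of _ d] conjI allI impI)
    fix a x assume h: "\<bar>a - b\<bar> < d" "\<bar>x - y\<bar> < d"
    have cls: "x < 1 \<longleftrightarrow> y < 1" using h d by auto
    hence Tx: "Ta a x = (x + s) / a" by (simp add: Ta_def s_def)
    have *: "(\<forall>j<N. delta a (Ta a x) j = delta b (Ta b y) j) \<and> \<bar>(Ta a ^^ N) (Ta a x) - (Ta b ^^ N) (Ta b y)\<bar> < e"
      using d1(2)[of a "Ta a x"] d2(2)[of a x] h d Tx Ty by auto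
    show "\<bar>(Ta a ^^ Suc N) x - (Ta b ^^ Suc N) y\<bar> < e"
      using * by (simp only: funpow_Suc_right o_apply)
    fix j assume "j < Suc N"
    thus "delta a x j = delta b y j" using * cls by (cases j) (auto simp: delta_0 delta_Suc)
  qed (use d in auto)
qed

text \<open>Both orbits use the same branch, of slope at least \<open>1/b\<close>. Lowering the
  parameter only pushes the upper image further up, because \<open>u + s\<close> is
  nonnegative.\<close>

lemma orbit_gap:
  assumes "0 < a" "a \<le> b" "0 \<le> y" "y \<le> x" "\<And>j. j < k \<Longrightarrow> delta a x j = delta b y j"
  shows "(x - y) / b ^ k \<le> (Ta a ^^ k) x - (Ta b ^^ k) y"
  using assms(5)
proof (induction k)
  case (Suc k)
  define u v where "u = (Ta a ^^ k) x" and "v = (Ta b ^^ k) y"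
  have IH: "(x - y) / b ^ k \<le> u - v" using Suc by (simp add: u_def v_def)
  define s :: real where "s = (if v < 1 then 1 else -1)"
  have "u < 1 \<longleftrightarrow> v < 1"
    using Suc.prems[of k] by (auto simp: delta_def u_def v_def split: if_splits)
  hence T: "Ta a u = (u + s) / a" "Ta b v = (v + s) / b" by (auto simp: Ta_def s_def)
  have "0 \<le> Ta a u" using assms unfolding u_def by (intro Ta_nonneg Ta_iter_nonneg) auto
  hence "0 \<le> u + s" using T assms by (simp add: zero_le_divide_iff)
  hence "(u + s) / b \<le> (u + s) / a" using assms by (intro divide_left_mono) auto
  hence "(u - v) / b \<le> Ta a u - Ta b v" using T by (simp add: diff_divide_distrib add_divide_distrib)
  moreover have "(x - y) / b ^ k / b \<le> (u - v) / b" using IH assms by (intro divide_right_mono) auto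
  ultimately show ?case by (simp add: u_def v_def algebra_simps)
qed simp

lemma orbit_mono:
  assumes "0 < a" "a \<le> b" "0 \<le> y" "y \<le> x" "\<And>j. j < k \<Longrightarrow> delta a x j = delta b y j"
  shows "(Ta b ^^ k) y \<le> (Ta a ^^ k) x"
proof -
  have "0 \<le> (x - y) / b ^ k" using assms by (intro divide_nonneg_nonneg) auto
  also have "\<dots> \<le> (Ta a ^^ k) x - (Ta b ^^ k) y" using assms by (intro orbit_gap) auto
  finally show ?thesis by simp
qed

text \<open>There are two sources of strictness. If the itineraries agree forever, expansion drives
  the upper orbit beyond \<open>1/(1-a)\<close>, where its rest is 0 while that of the lower orbit
  is positive. Otherwise, at the first disagreement, the lower orbit collects \<open>m\<close> plus
  a positive rest and the upper one at most \<open>m\<close>.\<close>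

lemma tail_fun_strict:
  assumes "1/2 \<le> a" "a \<le> b" "b \<le> 2/3" "0 < m" "0 < r" "subunit m r b" "0 \<le> y" "y < x"
    and below: "\<And>k. (Ta b ^^ k) y < 1/(1-b)"
  shows "tail_fun m r a x < tail_fun m r b y"
proof -
  have pos: "tail_fun m r b ((Ta b ^^ k) y) > 0" for k
    using assms below by (intro tail_fun_pos[where b = b] Ta_iter_nonneg) auto
  have w: "orbit_weight m r b y k > 0" for k using assms by (intro orbit_weight_pos)
  have splitb: "tail_fun m r b y = orbit_sum m r b k y + orbit_weight m r b y k * tail_fun m r b ((Ta b ^^ k) y)" for k
    using assms by (intro tail_fun_split[where b = b]) auto
  have splita: "tail_fun m r a x = orbit_sum m r a k x + orbit_weight m r a x k * tail_fun m r a ((Ta a ^^ k) x)" for k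
    using assms by (intro tail_fun_split[where b = b]) auto
  show ?thesis
  proof (cases "\<forall>j. delta a x j = delta b y j")
    case True
    obtain k where k: "(1/b) ^ k > 3 / (x - y)"
      using real_arch_pow[of "1/b" "3/(x-y)"] assms by (auto simp: field_simps)
    have "(x - y) / b ^ k > 3" using k assms by (simp add: field_simps)
    moreover have "(x - y) / b ^ k \<le> (Ta a ^^ k) x - (Ta b ^^ k) y" using True assms by (intro orbit_gap) auto
    moreover have "(Ta b ^^ k) y \<ge> 0" using assms by (intro Ta_iter_nonneg) auto
    ultimately have "(Ta a ^^ k) x \<ge> 1/(1-a)" using M_bounds[of a] assms by linarith
    hence "tail_fun m r a x = orbit_sum m r a k x" using assms by (intro tail_fun_eq_orbit_sum) auto
    also have "\<dots> = orbit_sum m r b k y" using True by (intro orbit_cong) auto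
    finally show ?thesis using splitb[of k] w[of k] pos[of k] by simp
  next
    case False
    then obtain k where k: "delta a x k \<noteq> delta b y k" "\<And>j. j < k \<Longrightarrow> delta a x j = delta b y j"
      using exists_least_iff[of "\<lambda>j. delta a x j \<noteq> delta b y j"] by auto
    have "(Ta b ^^ k) y \<le> (Ta a ^^ k) x" using k assms by (intro orbit_mono) auto
    hence c: "(Ta b ^^ k) y < 1" "\<not> (Ta a ^^ k) x < 1"
      using k(1) by (auto simp: delta_def split: if_splits)
    have nn: "0 \<le> (Ta a ^^ k) x" "0 \<le> (Ta b ^^ k) y" using assms by (auto intro!: Ta_iter_nonneg)
    have "tail_fun m r a ((Ta a ^^ k) x) = m * tail_fun m r a (Ta a ((Ta a ^^ k) x))"
      using tail_fun_step[of a b m r "(Ta a ^^ k) x"] c nn assms by simp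
    also have "\<dots> \<le> m * 1" using assms nn by (intro mult_left_mono tail_fun_le_1[where b = b] Ta_nonneg) auto
    also have "\<dots> < m * (1 + r * tail_fun m r b (Ta b ((Ta b ^^ k) y)))"
      using pos[of "Suc k"] assms by simp
    also have "\<dots> = tail_fun m r b ((Ta b ^^ k) y)"
      using tail_fun_step[of b b m r "(Ta b ^^ k) y"] c nn assms by simp
    finally show ?thesis
      using splita[of k] splitb[of k] w[of k] orbit_cong[of k a x b y k m r] k by simp
  qed
qed

text \<open>Since \<open>Ta a 1 = 0\<close>, hitting 1 makes the orbit of 0 periodic. Every point of
  the cycle leads to 1, whereas orbits at or above \<open>1/(1-a)\<close> never come back
  down.\<close>

lemma orbit_below_M_if_hits_1:
  assumes "1/2 \<le> a" "a \<le> 2/3" "(Ta a ^^ j) 0 = 1"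
  shows "(Ta a ^^ k) 0 < 1/(1-a)"
proof (rule ccontr)
  assume c: "\<not> ?thesis"
  have "(Ta a ^^ Suc j) 0 = 0" using assms(3) by (simp add: Ta_def)
  from funpow_mod_eq[OF this, of k]
  have k: "(Ta a ^^ (k mod Suc j)) 0 \<ge> 1/(1-a)" using c by simp
  have "k mod Suc j \<le> j" using mod_less_divisor[of "Suc j" k] by linarith
  hence "(Ta a ^^ j) 0 = (Ta a ^^ (j - k mod Suc j)) ((Ta a ^^ (k mod Suc j)) 0)"
    by (metis comp_apply funpow_add le_add_diff_inverse2)
  hence "(Ta a ^^ j) 0 \<ge> 1/(1-a)" using Ta_iter_ge_M[OF assms(1,2) k] by metis
  thus False using assms M_bounds[OF assms(1,2)] by linarith
qed

section \<open>Regularity of the root as a function of the parameter\<close>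

text \<open>Smaller parameters near \<open>b\<close> share the first \<open>N\<close> letters of the
  itinerary of 0, even if the orbit at \<open>b\<close> hits 1. Cutting the equation at
  \<open>b\<close> after these letters gives \<open>1 \<le> m / mu a p + w\<close> with a weight
  \<open>w < e\<close>; multiplying by \<open>mu a p \<le> 1\<close> yields the claim.\<close>

lemma mu_left_continuous:
  assumes "1/2 < b" "b \<le> 2/3" "0 < p" "p < 1" "0 < e"
  shows "\<exists>d>0. \<forall>a. 1/2 \<le> a \<longrightarrow> b - d < a \<longrightarrow> a \<le> b \<longrightarrow> mu a p < mu b p + e"
proof -
  define m r where "m = mu b p" and "r = odds p"
  have r: "r > 0" using assms by (simp add: r_def)
  have m: "0 < m" "m < 1" "subunit m r b" "tail_fun m r b 0 = 1"
    using char_root[of b p] mu_less_1[of b p] assms by (auto simp: m_def r_def)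
  have "orbit_weight m r b 0 \<longlonglongrightarrow> 0"
    using m r by (intro orbit_weight_tendsto_0) (auto simp: subunit_def)
  from eventually_happens'[OF sequentially_bot order_tendstoD(2)[OF this assms(5)]]
  obtain N where N: "orbit_weight m r b 0 N < e" by blast
  have "0 < b" using assms by simp
  from orbit_near_above[OF this order.refl zero_less_one, of N] obtain d where d: "d > 0"
    "\<And>a x. 0 < a \<Longrightarrow> a \<le> b \<Longrightarrow> b - d < a \<Longrightarrow> 0 \<le> x \<Longrightarrow> x < 0 + d \<Longrightarrow> (\<forall>j<N. delta a x j = delta b 0 j)"
    by metis
  show ?thesis
  proof (intro exI[of _ d] conjI allI impI)
    fix a assume h: "1/2 \<le> a" "b - d < a" "a \<le> b"
    have a: "0 < mu a p" "mu a p \<le> 1" "subunit (mu a p) r a"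
      using char_root[of a p] h assms by (auto simp: r_def)
    have "1 = orbit_sum m r b N 0 + orbit_weight m r b 0 N * tail_fun m r b ((Ta b ^^ N) 0)"
      using tail_fun_split[of b b m r 0 N] m r assms by simp
    also have "\<dots> \<le> orbit_sum m r b N 0 + orbit_weight m r b 0 N * 1"
      using m r assms by (intro add_left_mono mult_left_mono tail_fun_le_1[where b = b] Ta_iter_nonneg orbit_weight_nonneg) auto
    also have "orbit_sum m r b N 0 = orbit_sum m r a N 0"
      using orbit_cong(1)[of N a 0 b 0 N m r] d(2)[of a 0] d(1) h by simp
    also have "\<dots> \<le> m / mu a p * orbit_sum (mu a p) r a N 0"
      using mu_antimono[of a b p] m r a h assms by (intro orbit_sum_scale) (auto simp: m_def)
    also have "\<dots> \<le> m / mu a p * 1"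
      using a m by (intro mult_left_mono) (auto simp: subunit_def)
    finally have "1 \<le> m / mu a p + orbit_weight m r b 0 N" by simp
    hence "mu a p * 1 \<le> mu a p * (m / mu a p + orbit_weight m r b 0 N)" using a by (intro mult_left_mono) auto
    also have "\<dots> = m + mu a p * orbit_weight m r b 0 N" using a by (simp add: field_simps)
    also have "\<dots> \<le> m + 1 * orbit_weight m r b 0 N"
      using a m r by (intro add_left_mono mult_right_mono orbit_weight_nonneg) auto
    finally show "mu a p < mu b p + e" using N by (simp add: m_def)
  qed (use d in auto)
qed

text \<open>To the right of \<open>b\<close> itineraries are stable only if the orbit of 0 avoids 1.
  If it hits 1 at time \<open>k\<close>, then for larger parameters near \<open>b\<close> the point
  at time \<open>k\<close> is either 1 or so close below 1 that its image passes
  \<open>1/(1-a)\<close>. In both cases the rest equals \<open>mu a p\<close>, just as it equals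
  \<open>m\<close> at \<open>b\<close>, and the root does not move at all.\<close>

lemma mu_right_continuous:
  assumes "1/2 \<le> b" "b \<le> 2/3" "0 < p" "p < 1" "0 < e"
  shows "\<exists>d>0. \<forall>a. a \<le> 2/3 \<longrightarrow> b \<le> a \<longrightarrow> a < b + d \<longrightarrow> mu b p - e < mu a p"
proof (cases "\<exists>j. (Ta b ^^ j) 0 = 1")
  case False
  define m r where "m = mu b p" and "r = odds p"
  define m' where "m' = m - e"
  have r: "r > 0" using assms by (simp add: r_def)
  have m: "0 < m" "m \<le> 1" "subunit m r b" "tail_fun m r b 0 = 1"
    using char_root[of b p] assms by (auto simp: m_def r_def)
  show ?thesis
  proof (cases "m' > 0")
    case False
    show ?thesis
    proof (intro exI[of _ 1] conjI allI impI)
      fix a assume "a \<le> 2/3" "b \<le> a"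
      hence "0 < mu a p" using char_root(3)[of a p] assms by simp
      thus "mu b p - e < mu a p" using False by (simp add: m'_def m_def)
    qed simp
  next
    case True
    \<comment> \<open>Working at \<open>m' = m - e\<close> gives \<open>m' < 1\<close> even when
      \<open>m = 1\<close>, so the weights decay.\<close>
    have m': "0 < m'" "m' < 1" "m' < m" using True m assms by (auto simp: m'_def)
    have sm': "subunit m' r b" using subunit_mono[of m' m r b] m m' r by auto
    have "orbit_weight m' r b 0 \<longlonglongrightarrow> 0"
      using m' r sm' by (intro orbit_weight_tendsto_0) (auto simp: subunit_def)
    moreover have "0 < 1 - m' / m" using m m' by (simp add: field_simps)
    ultimately obtain N where N: "orbit_weight m' r b 0 N < 1 - m' / m"
      using eventually_happens'[OF sequentially_bot order_tendstoD(2)] by blast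
    have b0: "0 < b" using assms by simp
    have avoid: "(Ta b ^^ j) 0 \<noteq> 1" for j using \<open>\<not> (\<exists>j. (Ta b ^^ j) 0 = 1)\<close> by blast
    obtain d where d: "d > 0" "\<And>a x. \<bar>a - b\<bar> < d \<Longrightarrow> \<bar>x - 0\<bar> < d \<Longrightarrow> (\<forall>j<N. delta a x j = delta b 0 j)"
      using orbit_near[OF b0 zero_less_one avoid] by metis
    show ?thesis
    proof (intro exI[of _ d] conjI allI impI)
      fix a assume h: "a \<le> 2/3" "b \<le> a" "a < b + d"
      show "mu b p - e < mu a p"
      proof (rule ccontr)
        assume "\<not> mu b p - e < mu a p"
        hence le: "mu a p \<le> m'" by (simp add: m'_def m_def)
        have a: "0 < mu a p" "mu a p \<le> 1" "subunit (mu a p) r a" "tail_fun (mu a p) r a 0 = 1"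
          using char_root[of a p] h assms by (auto simp: r_def)
        have code: "\<forall>j<N. delta a 0 j = delta b 0 j" using d(2)[of a 0] d(1) h by auto
        have "1 = orbit_sum (mu a p) r a N 0 + orbit_weight (mu a p) r a 0 N * tail_fun (mu a p) r a ((Ta a ^^ N) 0)"
          using tail_fun_split[of a a "mu a p" r 0 N] a r h assms by simp
        also have "\<dots> \<le> orbit_sum (mu a p) r a N 0 + orbit_weight (mu a p) r a 0 N * 1"
          using a r h assms by (intro add_left_mono mult_left_mono tail_fun_le_1[where b = a] Ta_iter_nonneg orbit_weight_nonneg) auto
        also have "\<dots> = orbit_sum (mu a p) r b N 0 + orbit_weight (mu a p) r b 0 N"
          using orbit_cong[of N a 0 b 0 N "mu a p" r] code by simp
        also have "\<dots> \<le> orbit_sum m' r b N 0 + orbit_weight m' r b 0 N"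
        proof (rule add_mono)
          have "orbit_sum (mu a p) r b N 0 \<le> mu a p / m' * orbit_sum m' r b N 0"
            using a le m' r by (intro orbit_sum_scale) auto
          also have "\<dots> \<le> 1 * orbit_sum m' r b N 0" 
            using a le m' r by (intro mult_right_mono orbit_sum_nonneg) auto
          finally show "orbit_sum (mu a p) r b N 0 \<le> orbit_sum m' r b N 0" by simp
          show "orbit_weight (mu a p) r b 0 N \<le> orbit_weight m' r b 0 N"
            using a le r by (intro orbit_weight_mono) auto
        qed
        also have "orbit_sum m' r b N 0 \<le> m' / m * orbit_sum m r b N 0"
          using m m' r by (intro orbit_sum_scale) auto
        also have "\<dots> \<le> m' / m * 1" using m m' by (intro mult_left_mono) (auto simp: subunit_def)
        finally show False using N by simp
      qed
    qed (use d in auto)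
  qed
next
  case True
  define m r where "m = mu b p" and "r = odds p"
  have r: "r > 0" using assms by (simp add: r_def)
  have m: "0 < m" "m \<le> 1" "subunit m r b" "tail_fun m r b 0 = 1"
    using char_root[of b p] assms by (auto simp: m_def r_def)
  show ?thesis
  proof (cases "b = 2/3")
    case True
    show ?thesis
    proof (intro exI[of _ 1] conjI allI impI)
      fix a assume "a \<le> 2/3" "b \<le> a"
      hence "a = b" using True by simp
      thus "mu b p - e < mu a p" using assms by simp
    qed simp
  next
    case False
    obtain k where k: "(Ta b ^^ k) 0 = 1" "\<And>j. j < k \<Longrightarrow> (Ta b ^^ j) 0 \<noteq> 1"
      using True exists_least_iff[of "\<lambda>j. (Ta b ^^ j) 0 = 1"] by auto
    \<comment> \<open>With \<open>4 * h = 2 - 3 * b\<close> the first-order terms of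
      \<open>(2 - h) * (1 - b - h) \<ge> b + h\<close> balance. That inequality makes the lower
      branch send points within \<open>h\<close> below 1 to \<open>1/(1-a)\<close> or beyond, for
      all \<open>a < b + h\<close>.\<close>
    define h where "h = (2 - 3*b)/4"
    have hpos: "h > 0" using False assms by (simp add: h_def)
    have b0: "0 < b" using assms by simp
    obtain d where d: "d > 0" "\<And>a x. \<bar>a - b\<bar> < d \<Longrightarrow> \<bar>x - 0\<bar> < d \<Longrightarrow> 
       (\<forall>j<k. delta a x j = delta b 0 j) \<and> \<bar>(Ta a ^^ k) x - (Ta b ^^ k) 0\<bar> < h"
      using orbit_near[OF b0 hpos k(2)] by metis
    show ?thesis
    proof (intro exI[of _ "min d h"] conjI allI impI)
      fix a assume g: "a \<le> 2/3" "b \<le> a" "a < b + min d h"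
      have a: "0 < mu a p" "mu a p \<le> 1" "subunit (mu a p) r a" "tail_fun (mu a p) r a 0 = 1"
        using char_root[of a p] g assms by (auto simp: r_def)
      have le: "mu a p \<le> m" using mu_antimono[of b a p] g assms by (simp add: m_def)
      define z where "z = (Ta a ^^ k) 0"
      have code: "\<forall>j<k. delta a 0 j = delta b 0 j" and z1: "\<bar>z - 1\<bar> < h"
        using d(2)[of a 0] d(1) g k(1) by (auto simp: z_def)
      have zle: "z \<le> 1" using orbit_mono[of b a 0 0 k] code g k(1) assms by (simp add: z_def)
      have z0: "0 \<le> z" unfolding z_def using g assms by (intro Ta_iter_nonneg) auto
      have tz: "tail_fun (mu a p) r a z = mu a p"
      proof (cases "z = 1")
        case True
        thus ?thesis using tail_fun_step[of a a "mu a p" r z] a r g assms by (simp add: Ta_def)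
      next
        case False
        hence "z < 1" using zle by simp
        have "(2 - h) * (1 - b - h) \<ge> b + h"
        proof -
          have "(2 - h) * (1 - b - h) = 2 - 2*b - 3*h + h*b + h*h" by (simp add: algebra_simps)
          moreover have "0 \<le> h*b" "0 \<le> h*h" using hpos assms by auto
          moreover have "4*h = 2 - 3*b" by (simp add: h_def)
          ultimately show ?thesis by linarith
        qed
        moreover have "(z + 1) * (1 - a) \<ge> (2 - h) * (1 - b - h)"
        proof (rule mult_mono)
          have "4*h = 2 - 3*b" by (simp add: h_def)
          thus "0 \<le> 1 - b - h" using assms by linarith
          show "2 - h \<le> z + 1" "0 \<le> z + 1" using z1 z0 by linarith+
          show "1 - b - h \<le> 1 - a" using g by linarith
        qed
        ultimately have "(z + 1) * (1 - a) \<ge> a" using g by auto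
        hence "Ta a z \<ge> 1/(1-a)" using \<open>z < 1\<close> g assms by (simp add: Ta_def field_simps)
        hence "tail_fun (mu a p) r a (Ta a z) = 0" using g assms by (intro tail_fun_eq_0) auto
        thus ?thesis using tail_fun_step[of a a "mu a p" r z] a r g assms z0 \<open>z < 1\<close> by simp
      qed
      have "1 = orbit_sum (mu a p) r a k 0 + orbit_weight (mu a p) r a 0 k * mu a p"
        using tail_fun_split[of a a "mu a p" r 0 k] tz a r g assms by (simp add: z_def)
      also have "\<dots> = orbit_sum (mu a p) r b k 0 + orbit_weight (mu a p) r b 0 k * mu a p"
        using orbit_cong[of k a 0 b 0 k "mu a p" r] code by simp
      also have "\<dots> \<le> mu a p / m * orbit_sum m r b k 0 + orbit_weight m r b 0 k * mu a p"
        using a le m r by (intro add_mono mult_right_mono orbit_weight_mono orbit_sum_scale) auto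
      also have "\<dots> = mu a p / m * (orbit_sum m r b k 0 + orbit_weight m r b 0 k * m)"
        using m by (simp add: field_simps)
      also have "tail_fun m r b 1 = m"
        using tail_fun_step[of b b m r 1] m r assms by (simp add: Ta_def)
      hence "orbit_sum m r b k 0 + orbit_weight m r b 0 k * m = 1"
        using tail_fun_split[of b b m r 0 k] k(1) m r assms by simp
      finally have "m \<le> mu a p" using m by simp
      thus "mu b p - e < mu a p" using assms by (simp add: m_def)
    qed (use d hpos in auto)
  qed
qed

lemma continuous_mu:
  assumes "0 < p" "p < 1"
  shows "continuous_on {1/2..2/3} (\<lambda>a. mu a p)"
  unfolding continuous_on_iff
proof (intro ballI allI impI)
  fix b e :: real assume b: "b \<in> {1/2..2/3}" and e: "0 < e"
  obtain d1 where d1: "d1 > 0" "\<And>a. a \<le> 2/3 \<Longrightarrow> b \<le> a \<Longrightarrow> a < b + d1 \<Longrightarrow> mu b p - e < mu a p"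
    using mu_right_continuous[of b p e] b e assms by auto
  obtain d2 where d2: "d2 > 0" "\<And>a. 1/2 \<le> a \<Longrightarrow> b - d2 < a \<Longrightarrow> a \<le> b \<Longrightarrow> mu a p < mu b p + e"
  proof (cases "b = 1/2")
    case True
    show ?thesis
    proof (rule that[of 1])
      fix a assume "1/2 \<le> a" "a \<le> b"
      hence "a = b" using True by simp
      thus "mu a p < mu b p + e" using e by simp
    qed simp
  next
    case False
    thus ?thesis using mu_left_continuous[of b p e] b e assms that by auto
  qed
  show "\<exists>d>0. \<forall>a\<in>{1/2..2/3}. dist a b < d \<longrightarrow> dist (mu a p) (mu b p) < e"
  proof (intro exI[of _ "min d1 d2"] conjI ballI impI)
    fix a assume a: "a \<in> {1/2..2/3}" "dist a b < min d1 d2"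
    show "dist (mu a p) (mu b p) < e"
    proof (cases "a \<le> b")
      case True
      thus ?thesis using d2(2)[of a] mu_antimono[of a b p] a b assms by (auto simp: dist_real_def)
    next
      case False
      thus ?thesis using d1(2)[of a] mu_antimono[of b a p] a b assms by (auto simp: dist_real_def)
    qed
  qed (use d1 d2 in auto)
qed

lemma continuous_lam:
  assumes "0 < p" "p < 1"
  shows "continuous_on {1/2..2/3} (\<lambda>a. lam a p)"
proof -
  have "continuous_on {1/2..2/3} (\<lambda>a. p / mu a p)"
    using char_root(3)[of _ p] assms by (intro continuous_intros continuous_mu) force+
  thus ?thesis by (rule continuous_on_eq) (use lam_eq[of _ p] assms in auto)
qed

lemma lam_mono:
  assumes "1/2 \<le> a" "a \<le> b" "b \<le> 2/3" "0 < p" "p < 1"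
  shows "lam a p \<le> lam b p"
  using mu_antimono[OF assms] char_root(3)[of b p] char_root(3)[of a p] assms
  by (auto simp: lam_eq intro!: divide_left_mono)

section \<open>The exceptional set and the flat pieces of the root\<close>

lemma Sset_iff: "a \<in> Sset \<longleftrightarrow> 1/2 \<le> a \<and> a \<le> 2/3 \<and> (\<forall>k. (Ta a ^^ k) 0 \<le> 1/(1-a))"
  using kappa_eq_infinity_iff[of a 0] by (auto simp: Sset_def)

text \<open>Escape at time \<open>N\<close> is a strict inequality, and an escaping orbit of 0
  avoids 1, so nearby parameters share the first \<open>N\<close> letters and escape too. Their
  series reduce to the same polynomial in \<open>m\<close>, hence have the same root.\<close>

lemma locally_constant_off_Sset:
  assumes "1/2 \<le> b" "b \<le> 2/3" "b \<notin> Sset" "0 < p" "p < 1"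
  shows "\<exists>d>0. \<forall>a. 1/2 \<le> a \<longrightarrow> a \<le> 2/3 \<longrightarrow> \<bar>a - b\<bar> < d \<longrightarrow> lam a p = lam b p \<and> a \<notin> Sset"
proof -
  obtain N where N: "(Ta b ^^ N) 0 > 1/(1-b)" using assms by (auto simp: Sset_iff not_le)
  have avoid: "(Ta b ^^ j) 0 \<noteq> 1" for j
    using orbit_below_M_if_hits_1[of b j N] N assms by auto
  define h where "h = ((Ta b ^^ N) 0 - 1/(1-b)) / 2"
  have h: "h > 0" using N by (simp add: h_def)
  obtain d where d: "d > 0" "\<And>a x. \<bar>a - b\<bar> < d \<Longrightarrow> \<bar>x - 0\<bar> < d \<Longrightarrow> 
       (\<forall>j<N. delta a x j = delta b 0 j) \<and> \<bar>(Ta a ^^ N) x - (Ta b ^^ N) 0\<bar> < h"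
    using orbit_near[OF _ h, of b N 0, OF _ avoid] assms(1) by auto
  have "isCont (\<lambda>a::real. 1/(1-a)) b" using assms by (intro continuous_intros) auto
  then obtain d' where d': "d' > 0" "\<And>a. \<bar>a - b\<bar> < d' \<Longrightarrow> \<bar>1/(1-a) - 1/(1-b)\<bar> < h"
    using h unfolding continuous_at_eps_delta dist_real_def by blast
  show ?thesis
  proof (intro exI[of _ "min d d'"] conjI allI impI)
    fix a assume a: "1/2 \<le> a" "a \<le> 2/3" "\<bar>a - b\<bar> < min d d'"
    have code: "\<forall>j<N. delta a 0 j = delta b 0 j" and "\<bar>(Ta a ^^ N) 0 - (Ta b ^^ N) 0\<bar> < h"
      using d(2)[of a 0] d(1) a by auto
    moreover have "\<bar>1/(1-a) - 1/(1-b)\<bar> < h" using d' a by auto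
    moreover have "(Ta b ^^ N) 0 - 1/(1-b) = 2 * h" by (simp add: h_def)
    ultimately have gt: "(Ta a ^^ N) 0 > 1/(1-a)" by linarith
    thus "a \<notin> Sset" using not_le by (auto simp: Sset_iff)
    define m r where "m = mu b p" and "r = odds p"
    have m: "0 < m" "tail_fun m r b 0 = 1" using char_root[of b p] assms by (auto simp: m_def r_def)
    have "orbit_term m r a 0 sums (\<Sum>k\<in>{..<N}. orbit_term m r a 0 k)"
      using gt a delta_eq_0_after_M[of a N 0] by (intro sums_finite) (simp_all add: orbit_term_def)
    also have "(\<Sum>k\<in>{..<N}. orbit_term m r a 0 k) = orbit_sum m r b N 0"
      using orbit_cong(1)[of N a 0 b 0 N m r] code by (simp add: orbit_sum_def)
    also have "\<dots> = 1" using tail_fun_eq_orbit_sum[of b N 0 m r] N m assms by simp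
    finally have "mu a p = m" using a assms m by (intro mu_unique) (auto simp: r_def)
    thus "lam a p = lam b p" using a assms by (simp add: lam_eq m_def)
  qed (use d d' in auto)
qed

lemma lam_constant_off_Sset:
  assumes "0 < p" "p < 1" "is_interval J" "J \<subseteq> {1/2..2/3} - Sset" "b \<in> J" "b' \<in> J"
  shows "lam b p = lam b' p"
proof -
  have "(\<lambda>a. lam a p) constant_on J"
  proof (rule locally_constant_imp_constant)
    show "connected J" using assms is_interval_connected by blast
    fix c assume c: "c \<in> J"
    obtain d where d: "d > 0" "\<And>a. 1/2 \<le> a \<Longrightarrow> a \<le> 2/3 \<Longrightarrow> \<bar>a - c\<bar> < d \<Longrightarrow> lam a p = lam c p"
    proof -
      have "1/2 \<le> c" "c \<le> 2/3" "c \<notin> Sset" using subsetD[OF assms(4) c] by auto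
      from locally_constant_off_Sset[OF this assms(1,2)] show ?thesis using that by metis
    qed
    show "\<exists>T. openin (top_of_set J) T \<and> c \<in> T \<and> (\<forall>x\<in>T. lam x p = lam c p)"
    proof (intro exI[of _ "J \<inter> ball c d"] conjI ballI)
      show "openin (top_of_set J) (J \<inter> ball c d)" by (simp add: openin_open_Int)
      show "c \<in> J \<inter> ball c d" using c d by simp
      fix x assume x: "x \<in> J \<inter> ball c d"
      hence "\<bar>x - c\<bar> < d" by (simp add: dist_real_def abs_minus_commute)
      moreover have "x \<in> {1/2..2/3}" using x assms(4) by blast
      ultimately show "lam x p = lam c p" using d(2)[of x] by simp
    qed
  qed
  thus ?thesis using assms unfolding constant_on_def by metis
qed

lemma closed_Sset: "closed Sset"
proof -
  have "open ({1/2 ..2/3} - Sset \<union> - {1/2..2/3})"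
    unfolding open_dist
  proof (intro ballI)
    fix b assume "b \<in> {1/2..2/3} - Sset \<union> - {1/2..2/3::real}"
    then consider "b \<notin> {1/2..2/3}" | "b \<in> {1/2..2/3}" "b \<notin> Sset" by auto
    thus "\<exists>e>0. \<forall>y. dist y b < e \<longrightarrow> y \<in> {1/2..2/3} - Sset \<union> - {1/2..2/3}"
    proof cases
      case 1
      have "open (- {1/2..2/3::real})" by (simp add: open_Compl)
      thus ?thesis using 1 unfolding open_dist by (metis ComplI UnCI)
    next
      case 2
      obtain d where "d > 0" "\<And>a. 1/2 \<le> a \<Longrightarrow> a \<le> 2/3 \<Longrightarrow> \<bar>a - b\<bar> < d \<Longrightarrow> a \<notin> Sset"
      proof -
        have "1/2 \<le> b" "b \<le> 2/3" "b \<notin> Sset" "0 < (1/2::real)" "1/2 < (1::real)" using 2 by auto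
        from locally_constant_off_Sset[OF this] show ?thesis using that by metis
      qed
      thus ?thesis by (intro exI[of _ d]) (auto simp: dist_real_def)
    qed
  qed
  moreover have "{1/2 ..2/3} - Sset \<union> - {1/2..2/3} = - Sset" by (auto simp: Sset_def)
  ultimately show ?thesis by (simp add: closed_def)
qed

text \<open>If the orbit of 0 stays strictly below \<open>1/(1-b)\<close>, moving left strictly
  lowers the sum at the same \<open>m\<close>. If it equals \<open>1/(1-b)\<close> at time
  \<open>k\<close>, the first \<open>k\<close> terms already add up to 1; moving right keeps these
  terms and puts the point at time \<open>k\<close> strictly below the new fixed point, which adds a
  positive rest. The left endpoint \<open>b = 1/2\<close> falls under the second case.\<close>

lemma mu_not_constant_at_Sset:
  assumes "b \<in> Sset" "u < b" "b < v" "0 < p" "p < 1"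
  shows "\<exists>a. u < a \<and> a < v \<and> 1/2 \<le> a \<and> a \<le> 2/3 \<and> mu a p \<noteq> mu b p"
proof -
  define m r where "m = mu b p" and "r = odds p"
  have b: "1/2 \<le> b" "b \<le> 2/3" "\<And>k. (Ta b ^^ k) 0 \<le> 1/(1-b)" using assms by (auto simp: Sset_iff)
  have r: "r > 0" using assms by (simp add: r_def)
  have m: "0 < m" "subunit m r b" "tail_fun m r b 0 = 1" using char_root[of b p] b assms by (auto simp: m_def r_def)
  show ?thesis
  proof (cases "\<forall>k. (Ta b ^^ k) 0 < 1/(1-b)")
    case True
    have "b \<noteq> 1/2"
    proof
      assume "b = 1/2"
      hence "1 - b = b" by simp
      show False using True[rule_format, of 1] by (simp add: Ta_def \<open>1 - b = b\<close>)
    qed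
    hence b2: "1/2 < b" using b by simp
    define a where "a = max (1/2) ((u + b)/2)"
    have a: "u < a" "a < b" "1/2 \<le> a" "a \<le> 2/3" using b b2 assms(2) by (auto simp: a_def max_def)
    have "mu a p \<noteq> m"
    proof
      assume eq: "mu a p = m"
      have ca: "subunit m r a" "tail_fun m r a 0 = 1" using char_root[of a p] a assms eq by (auto simp: r_def)
      have "(Ta b ^^ k) (Ta b 0) < 1/(1-b)" for k
        using True[rule_format, of "Suc k"] by (simp only: funpow_Suc_right o_apply)
      \<comment> \<open>Both orbits start at 0, so the strict comparison is applied one step later,
        to the distinct points \<open>1/b < 1/a\<close>.\<close>
      hence "tail_fun m r a (1/a) < tail_fun m r b (1/b)"
        using a b m r by (intro tail_fun_strict) (auto simp: Ta_def intro!: divide_strict_left_mono)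
      hence "m * (1 + r * tail_fun m r a (1/a)) < m * (1 + r * tail_fun m r b (1/b))" using m r by simp
      moreover have "m * (1 + r * tail_fun m r a (1/a)) = 1" "m * (1 + r * tail_fun m r b (1/b)) = 1"
        using tail_fun_step[of b b m r 0] tail_fun_step[of a a m r 0] ca m r a b by (simp_all add: Ta_def)
      ultimately show False by linarith
    qed
    thus ?thesis using a assms m_def by (intro exI[of _ a]) auto
  next
    case False
    then obtain k where k: "(Ta b ^^ k) 0 = 1/(1-b)" using b(3) by (meson linorder_not_less order_antisym)
    have avoid: "(Ta b ^^ j) 0 \<noteq> 1" for j
      using orbit_below_M_if_hits_1[of b j k] k b by auto
    have "b \<noteq> 2/3"
    proof
      assume b23: "b = 2/3"
      have "(Ta b ^^ j) 0 \<noteq> 3" for j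
      proof (induction j)
        case (Suc j) thus ?case using avoid[of j] by (auto simp: b23 Ta_def)
      qed simp
      thus False using k b23 by simp
    qed
    hence b23: "b < 2/3" using b by simp
    have b0: "0 < b" using b by simp
    obtain d where d: "d > 0" "\<And>a x. \<bar>a - b\<bar> < d \<Longrightarrow> \<bar>x - 0\<bar> < d \<Longrightarrow> (\<forall>j<k. delta a x j = delta b 0 j)"
      using orbit_near[OF b0 zero_less_one avoid] by metis
    define a where "a = Min {2/3, (b + v)/2, b + d/2}"
    have a: "a \<le> 2/3" "a < v" "b < a" "a < b + d" "u < a"
      using assms(2,3) d(1) b23 by (auto simp: a_def min_def)
    have code: "\<forall>j<k. delta a 0 j = delta b 0 j" using d(2)[of a 0] d(1) a by auto
    have "mu a p \<noteq> m"
    proof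
      assume eq: "mu a p = m"
      have ca: "subunit m r a" "tail_fun m r a 0 = 1" using char_root[of a p] a b assms eq by (auto simp: r_def)
      have "(Ta a ^^ k) 0 \<le> 1/(1-b)" using orbit_mono[of b a 0 0 k] code a b k by simp
      also have "\<dots> < 1/(1-a)" using a b by (intro divide_strict_left_mono) auto
      finally have "tail_fun m r a ((Ta a ^^ k) 0) > 0"
        using a b m r ca by (intro tail_fun_pos[where b = a] Ta_iter_nonneg) auto
      hence "orbit_weight m r a 0 k * tail_fun m r a ((Ta a ^^ k) 0) > 0"
        using orbit_weight_pos[of m r a 0 k] m r by simp
      moreover have "orbit_sum m r a k 0 = 1"
        using tail_fun_eq_orbit_sum[of b k 0 m r] orbit_cong(1)[of k a 0 b 0 k m r] code k m b by simp
      moreover have "1 = orbit_sum m r a k 0 + orbit_weight m r a 0 k * tail_fun m r a ((Ta a ^^ k) 0)"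
        using tail_fun_split[of a a m r 0 k] ca m r a b by simp
      ultimately show False by linarith
    qed
    thus ?thesis using a b m_def by (intro exI[of _ a]) auto
  qed
qed

section \<open>A renewal theorem\<close>

lemma convolution_tendsto:
  fixes b v :: "nat \<Rightarrow> real"
  assumes b: "\<And>k. 0 \<le> b k" "summable b" and v: "\<And>n. \<bar>v n\<bar> \<le> B" "\<And>k. (\<lambda>n. v (\<psi> n - k)) \<longlonglongrightarrow> s"
    and \<psi>: "filterlim \<psi> at_top sequentially"
  shows "(\<lambda>n. \<Sum>k\<le>\<psi> n. b k * v (\<psi> n - k)) \<longlonglongrightarrow> suminf b * s"
proof -
  define f where "f k n = (if k \<le> \<psi> n then b k * v (\<psi> n - k) else 0)" for k n
  have lim: "(\<lambda>n. f k n) \<longlonglongrightarrow> b k * s" for k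
  proof (rule Lim_transform_eventually)
    show "(\<lambda>n. b k * v (\<psi> n - k)) \<longlonglongrightarrow> b k * s" by (intro tendsto_intros v)
    have "eventually (\<lambda>n. k \<le> \<psi> n) sequentially" using \<psi> by (simp add: filterlim_at_top)
    thus "eventually (\<lambda>n. b k * v (\<psi> n - k) = f k n) sequentially"
      by eventually_elim (simp add: f_def)
  qed
  have B: "0 \<le> B" using v(1)[of 0] by linarith
  have bound: "norm (f k n) \<le> b k * B" for k n
    using b(1)[of k] v(1)[of "\<psi> n - k"] B by (auto simp: f_def abs_mult intro!: mult_left_mono)
  have "eventually (\<lambda>(k, n). norm (f k n) \<le> b k * B) (at_top \<times>\<^sub>F sequentially)"
    by (intro always_eventually) (use bound in auto)
  hence "(\<lambda>n. \<Sum>k. f k n) \<longlonglongrightarrow> (\<Sum>k. b k * s)"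
    using tannerys_theorem[of f "\<lambda>k. b k * s" sequentially "\<lambda>k. b k * B", OF lim _ summable_mult2[OF b(2)]]
    by simp
  moreover have "(\<Sum>k. f k n) = (\<Sum>k\<le>\<psi> n. b k * v (\<psi> n - k))" for n
  proof -
    have "(\<Sum>k. f k n) = (\<Sum>k\<in>{..\<psi> n}. f k n)" by (rule suminf_finite) (auto simp: f_def)
    thus ?thesis by (simp add: f_def)
  qed
  ultimately show ?thesis using b(2) by (simp add: suminf_mult2)
qed

text \<open>Convergence of \<open>max s (v n)\<close> to \<open>s\<close> encodes that no limit
  point exceeds \<open>s\<close>; together with the subsequence it says that \<open>s\<close> is the
  limsup.\<close>

lemma bounded_seq_limsup:
  fixes v :: "nat \<Rightarrow> real"
  assumes "\<And>n. \<bar>v n\<bar> \<le> B"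
  obtains s \<phi> where "strict_mono \<phi>" "(\<lambda>n. v (\<phi> n)) \<longlonglongrightarrow> s" "(\<lambda>n. max s (v n)) \<longlonglongrightarrow> s"
proof -
  obtain \<phi> where \<phi>: "strict_mono \<phi>" "((\<lambda>n. ereal (v n)) o \<phi>) \<longlonglongrightarrow> limsup (\<lambda>n. ereal (v n))"
    using limsup_subseq_lim by blast
  have le: "v n \<le> B" "- B \<le> v n" for n using assms[of n] by (simp_all add: abs_le_iff)
  have "limsup (\<lambda>n. ereal (v n)) \<le> ereal B" by (intro Limsup_bounded) (auto simp: le)
  moreover have "ereal (- B) \<le> limsup (\<lambda>n. ereal (v n))"
    by (rule LIMSEQ_le_const[OF \<phi>(2)]) (use le in auto)
  ultimately obtain s where s: "limsup (\<lambda>n. ereal (v n)) = ereal s"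
    by (cases "limsup (\<lambda>n. ereal (v n))") auto
  have "(\<lambda>n. v (\<phi> n)) \<longlonglongrightarrow> s" using \<phi>(2) by (simp add: s o_def)
  moreover have "(\<lambda>n. max s (v n)) \<longlonglongrightarrow> s"
  proof (rule order_tendstoI)
    fix e assume "s < e"
    hence "eventually (\<lambda>n. ereal (v n) < ereal e) sequentially" using s by (intro Limsup_lessD) simp
    thus "eventually (\<lambda>n. max s (v n) < e) sequentially" using \<open>s < e\<close> by (auto elim: eventually_mono)
  qed (auto simp: less_max_iff_disj)
  ultimately show ?thesis using that \<phi>(1) by blast
qed

text \<open>The Erdos-Feller-Pollard argument. Asymptotically \<open>v\<close> is the
  \<open>b\<close>-average of its past, and the past exceeds the limsup \<open>s\<close> by little.
  Where \<open>v\<close> is close to \<open>s\<close>, the value one step earlier, which has the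
  positive weight \<open>b 0\<close>, must be close to \<open>s\<close> too, and by induction so are
  the values any fixed number of steps earlier. The limit of the convolution with
  \<open>\<rho>\<close> then identifies \<open>s\<close>.\<close>

lemma renewal_extreme:
  fixes b g v \<rho> :: "nat \<Rightarrow> real"
  assumes b: "\<And>k. 0 \<le> b k" "0 < b 0" "b sums 1"
    and v: "\<And>n. \<bar>v n\<bar> \<le> B" and g: "g \<longlonglongrightarrow> 0"
    and rec: "\<And>n. v (Suc n) = g (Suc n) + (\<Sum>k\<le>n. b k * v (n - k))"
    and \<rho>: "\<And>k. 0 \<le> \<rho> k" "summable \<rho>" "(\<lambda>n. \<Sum>k\<le>n. \<rho> k * v (n - k)) \<longlonglongrightarrow> G"
    and s: "strict_mono \<phi>" "(\<lambda>n. v (\<phi> n)) \<longlonglongrightarrow> s" "(\<lambda>n. max s (v n)) \<longlonglongrightarrow> s"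
  shows "suminf \<rho> * s = G"
proof -
  have \<phi>: "filterlim \<phi> at_top sequentially" using s(1) by (rule filterlim_subseq)
  define u where "u n = max s (v n)" for n
  have u: "\<bar>u n\<bar> \<le> max \<bar>s\<bar> B" for n using v[of n] by (auto simp: u_def)
  have ulim: "(\<lambda>n. u (\<psi> n - k)) \<longlonglongrightarrow> s" if "filterlim \<psi> at_top sequentially" for \<psi> k
  proof -
    have "filterlim (\<lambda>n. \<psi> n - k) at_top sequentially"
      using that filterlim_compose[OF filterlim_minus_const_nat_at_top] by blast
    from filterlim_compose[OF s(3) this] show ?thesis by (simp add: u_def)
  qed
  have step: "(\<lambda>n. v (\<phi> n - k)) \<longlonglongrightarrow> s" for k
  proof (induction k)
    case 0 thus ?case using s by simp
  next
    case (Suc k)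
    define \<psi> where "\<psi> n = \<phi> n - Suc k" for n
    have \<psi>: "filterlim \<psi> at_top sequentially" unfolding \<psi>_def
      using filterlim_compose[OF filterlim_minus_const_nat_at_top \<phi>] by blast
    have S: "eventually (\<lambda>n. \<phi> n - k = Suc (\<psi> n)) sequentially"
    proof -
      have "eventually (\<lambda>n. Suc k \<le> \<phi> n) sequentially" using \<phi> by (simp add: filterlim_at_top)
      thus ?thesis by eventually_elim (simp add: \<psi>_def)
    qed
    define c where "c n = (\<Sum>k\<le>\<psi> n. b k * u (\<psi> n - k))" for n
    have c: "c \<longlonglongrightarrow> s"
      using convolution_tendsto[of b, OF b(1) _ u ulim[OF \<psi>] \<psi>] sums_unique[OF b(3)] sums_summable[OF b(3)]
      by (simp add: c_def[abs_def])
    have gk: "(\<lambda>n. g (\<phi> n - k)) \<longlonglongrightarrow> 0"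
      using filterlim_compose[OF g filterlim_compose[OF filterlim_minus_const_nat_at_top \<phi>]] .
    \<comment> \<open>Solving the recursion for the term \<open>k = 0\<close> of the average bounds
      \<open>v (\<psi> n)\<close> from below by a sequence with limit \<open>s\<close>.\<close>
    have low: "(\<lambda>n. u (\<psi> n) + (v (\<phi> n - k) - g (\<phi> n - k) - c n) / b 0) \<longlonglongrightarrow> s + (s - 0 - s) / b 0"
      using ulim[OF \<psi>, of 0] b(2) by (intro tendsto_intros Suc.IH gk c) auto
    have "(\<lambda>n. v (\<psi> n)) \<longlonglongrightarrow> s"
    proof (rule tendsto_sandwich)
      show "eventually (\<lambda>n. v (\<psi> n) \<le> u (\<psi> n)) sequentially" by (simp add: u_def)
      show "eventually (\<lambda>n. u (\<psi> n) + (v (\<phi> n - k) - g (\<phi> n - k) - c n) / b 0 \<le> v (\<psi> n)) sequentially"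
        using S
      proof eventually_elim
        case (elim n)
        have "v (\<phi> n - k) - g (\<phi> n - k) = (\<Sum>k\<le>\<psi> n. b k * v (\<psi> n - k))"
          using rec[of "\<psi> n"] elim by simp
        also have "\<dots> \<le> c n - b 0 * (u (\<psi> n) - v (\<psi> n))"
        proof -
          have "(\<Sum>k\<le>\<psi> n. b k * v (\<psi> n - k)) = b 0 * v (\<psi> n) + (\<Sum>k\<in>{..\<psi> n}-{0}. b k * v (\<psi> n - k))"
            by (subst sum.remove[of _ 0]) auto
          also have "\<dots> \<le> b 0 * v (\<psi> n) + (\<Sum>k\<in>{..\<psi> n}-{0}. b k * u (\<psi> n - k))"
            by (intro add_left_mono sum_mono mult_left_mono b) (auto simp: u_def)
          also have "(\<Sum>k\<in>{..\<psi> n}-{0}. b k * u (\<psi> n - k)) = c n - b 0 * u (\<psi> n)"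
            unfolding c_def by (subst sum.remove[of "{..\<psi> n}" 0]) auto
          finally show ?thesis by (simp add: algebra_simps)
        qed
        finally show ?case using b(2) by (simp add: field_simps)
      qed
      show "(\<lambda>n. u (\<psi> n)) \<longlonglongrightarrow> s" using ulim[OF \<psi>, of 0] by simp
      show "(\<lambda>n. u (\<psi> n) + (v (\<phi> n - k) - g (\<phi> n - k) - c n) / b 0) \<longlonglongrightarrow> s" using low by simp
    qed
    thus ?case by (simp add: \<psi>_def)
  qed
  have "(\<lambda>n. \<Sum>k\<le>\<phi> n. \<rho> k * v (\<phi> n - k)) \<longlonglongrightarrow> suminf \<rho> * s"
    by (intro convolution_tendsto[where B = B] \<rho> v step \<phi>)
  moreover have "(\<lambda>n. \<Sum>k\<le>\<phi> n. \<rho> k * v (\<phi> n - k)) \<longlonglongrightarrow> G"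
    using filterlim_compose[OF \<rho>(3) \<phi>] .
  ultimately show ?thesis by (rule LIMSEQ_unique)
qed

text \<open>\<open>b k\<close> is the probability of a step of length \<open>k + 1\<close>, so
  \<open>b 0 > 0\<close> gives aperiodicity and the sum of the tails \<open>\<rho>\<close> is the
  mean step. Convolving \<open>\<rho>\<close> with \<open>v\<close> yields the partial sums of
  \<open>g\<close>. The extremal lemma, applied to \<open>v\<close> and to \<open>-v\<close>, makes
  limsup and liminf agree.\<close>

theorem renewal_theorem:
  fixes b g v \<rho> :: "nat \<Rightarrow> real"
  assumes b: "\<And>k. 0 \<le> b k" "0 < b 0" "b sums 1"
    and g: "\<And>n. 0 \<le> g n" "summable g"
    and rec: "\<And>n. v n = g n + (\<Sum>k<n. b k * v (n - 1 - k))"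
    and \<rho>_def: "\<And>k. \<rho> k = 1 - (\<Sum>j<k. b j)" and \<rho>: "summable \<rho>"
  shows "v \<longlonglongrightarrow> suminf g / suminf \<rho>"
proof -
  have v0: "0 \<le> v n" for n
  proof (induction n rule: less_induct)
    case (less n)
    have "0 \<le> b k * v (n - 1 - k)" if "k < n" for k using less that b(1)[of k] by simp
    thus ?case unfolding rec[of n] using g(1)[of n] by (intro add_nonneg_nonneg sum_nonneg) auto
  qed
  have \<rho>0: "0 \<le> \<rho> k" for k
    using sum_le_suminf[OF sums_summable[OF b(3)], of "{..<k}"] sums_unique[OF b(3)] b(1) \<rho>_def by simp
  have rec': "v (Suc n) = g (Suc n) + (\<Sum>k\<le>n. b k * v (n - k))" for n
    using rec[of "Suc n"] by (simp add: lessThan_Suc_atMost)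
  have conv: "(\<Sum>k\<le>n. \<rho> k * v (n - k)) = (\<Sum>k\<le>n. g k)" for n
  proof (induction n)
    case 0 show ?case using rec[of 0] \<rho>_def[of 0] by simp
  next
    case (Suc n)
    have "(\<Sum>k\<le>Suc n. \<rho> k * v (Suc n - k)) = \<rho> 0 * v (Suc n) + (\<Sum>k\<le>n. \<rho> (Suc k) * v (n - k))"
      by (subst sum.atMost_Suc_shift) simp
    also have "(\<Sum>k\<le>n. \<rho> (Suc k) * v (n - k)) = (\<Sum>k\<le>n. \<rho> k * v (n - k)) - (\<Sum>k\<le>n. b k * v (n - k))"
      unfolding sum_subtractf[symmetric] by (intro sum.cong) (simp_all add: \<rho>_def algebra_simps)
    finally show ?case using Suc rec'[of n] \<rho>_def[of 0] by simp
  qed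
  have le: "v n \<le> suminf g" for n
  proof -
    have "v n = (\<Sum>k\<in>{0}. \<rho> k * v (n - k))" using \<rho>_def[of 0] by simp
    also have "\<dots> \<le> (\<Sum>k\<le>n. \<rho> k * v (n - k))" using \<rho>0 v0 by (intro sum_mono2) auto
    also have "\<dots> \<le> suminf g" unfolding conv using g by (intro sum_le_suminf) auto
    finally show ?thesis .
  qed
  have B: "\<bar>v n\<bar> \<le> suminf g" "\<bar>- v n\<bar> \<le> suminf g" for n using le[of n] v0[of n] by auto
  have gl: "g \<longlonglongrightarrow> 0" using g(2) by (rule summable_LIMSEQ_zero)
  have G: "(\<lambda>n. \<Sum>k\<le>n. \<rho> k * v (n - k)) \<longlonglongrightarrow> suminf g"
    unfolding conv using summable_LIMSEQ'[OF g(2)] .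
  have \<rho>1: "suminf \<rho> \<ge> 1"
    using sum_le_suminf[OF \<rho>, of "{0}"] \<rho>0 \<rho>_def[of 0] by simp
  obtain s \<phi> where s: "strict_mono \<phi>" "(\<lambda>n. v (\<phi> n)) \<longlonglongrightarrow> s" "(\<lambda>n. max s (v n)) \<longlonglongrightarrow> s"
    by (rule bounded_seq_limsup[OF B(1)])
  obtain s' \<phi>' where s': "strict_mono \<phi>'" "(\<lambda>n. - v (\<phi>' n)) \<longlonglongrightarrow> s'" "(\<lambda>n. max s' (- v n)) \<longlonglongrightarrow> s'"
    by (rule bounded_seq_limsup[of "\<lambda>n. - v n", OF B(2)])
  have "suminf \<rho> * s = suminf g"
    by (rule renewal_extreme[OF b B(1) gl rec' \<rho>0 \<rho> G s])
  moreover have "suminf \<rho> * s' = - suminf g"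
  proof (rule renewal_extreme[OF b B(2) _ _ \<rho>0 \<rho> _ s'])
    show "(\<lambda>n. - g n) \<longlonglongrightarrow> 0" using tendsto_minus[OF gl] by simp
    show "- v (Suc n) = - g (Suc n) + (\<Sum>k\<le>n. b k * - v (n - k))" for n
      using rec'[of n] by (simp add: sum_negf)
    show "(\<lambda>n. \<Sum>k\<le>n. \<rho> k * - v (n - k)) \<longlonglongrightarrow> - suminf g"
      using tendsto_minus[OF G] by (simp add: sum_negf)
  qed
  ultimately have eq: "s = suminf g / suminf \<rho>" "- s' = suminf g / suminf \<rho>"
    using \<rho>1 by (simp_all add: field_simps)
  show ?thesis
  proof (rule tendsto_sandwich)
    show "eventually (\<lambda>n. v n \<le> max s (v n)) sequentially"
      "eventually (\<lambda>n. - max s' (- v n) \<le> v n) sequentially" by (auto simp: max_def)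
    show "(\<lambda>n. max s (v n)) \<longlonglongrightarrow> suminf g / suminf \<rho>" using s(3) eq by simp
    show "(\<lambda>n. - max s' (- v n)) \<longlonglongrightarrow> suminf g / suminf \<rho>" using tendsto_minus[OF s'(3)] eq by simp
  qed
qed

section \<open>The killed chain\<close>

definition surv :: "real \<Rightarrow> real \<Rightarrow> nat \<Rightarrow> real set \<Rightarrow> real \<Rightarrow> real" where
  "surv a p n A x = Px a p x n (\<lambda>xs. survives a x xs \<and> chain a x xs \<in> A)"

lemma lists_length_Suc:
  "{xs. length xs = Suc n} = (#) True ` {xs. length xs = n} \<union> (#) False ` {xs. length xs = n}"
  by (auto simp: length_Suc_conv)

lemma finite_bool_lists: "finite {xs :: bool list. length xs = n}"
  by (induction n) (auto simp: lists_length_Suc)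

lemma Px_0: "Px a p x 0 E = (if E [] then 1 else 0)"
  by (simp add: Px_def weight_def)

lemma Px_Suc:
  "Px a p x (Suc n) E
     = p * Px a p x n (\<lambda>xs. E (True # xs)) + (1 - p) * Px a p x n (\<lambda>xs. E (False # xs))"
proof -
  have "Px a p x (Suc n) E
    = (\<Sum>xs\<in>{xs. length xs = n}. weight p (True # xs) * (if E (True # xs) then 1 else 0))
    + (\<Sum>xs\<in>{xs. length xs = n}. weight p (False # xs) * (if E (False # xs) then 1 else 0))"
    unfolding Px_def lists_length_Suc
    by (subst sum.union_disjoint) (auto simp: finite_bool_lists sum.reindex o_def)
  thus ?thesis
    by (simp add: Px_def sum_distrib_left weight_def mult.assoc mult.left_commute)
qed

lemma survives_Nil: "survives a x [] \<longleftrightarrow> 0 \<le> x"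
  by (simp add: survives_def)

lemma survives_Cons: "survives a x (b # bs) \<longleftrightarrow> 0 \<le> x \<and> survives a (a * x + (if b then 1 else -1)) bs"
proof
  assume L: "survives a x (b # bs)"
  have "0 \<le> x" using L unfolding survives_def by (metis chain.simps(1) le0 take0)
  moreover have "0 \<le> chain a (a * x + (if b then 1 else -1)) (take k bs)" if "k \<le> length bs" for k
    using L[unfolded survives_def, rule_format, of "Suc k"] that by simp
  ultimately show "0 \<le> x \<and> survives a (a * x + (if b then 1 else -1)) bs" by (simp add: survives_def)
next
  assume R: "0 \<le> x \<and> survives a (a * x + (if b then 1 else -1)) bs"
  show "survives a x (b # bs)" unfolding survives_def
  proof (intro allI impI)
    fix k assume "k \<le> length (b # bs)"
    thus "0 \<le> chain a x (take k (b # bs))" using R by (cases k) (auto simp: survives_def)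
  qed
qed

lemma Px_x_irrelevant: "Px a p x n E = Px a p x' n E"
  by (simp add: Px_def)

lemma surv_0: "surv a p 0 A x = (if 0 \<le> x \<and> x \<in> A then 1 else 0)"
  by (simp add: surv_def Px_0 survives_Nil)

lemma surv_Suc:
  "surv a p (Suc n) A x
     = (if 0 \<le> x then p * surv a p n A (a * x + 1) + (1 - p) * surv a p n A (a * x - 1) else 0)"
proof (cases "0 \<le> x")
  case True
  thus ?thesis unfolding surv_def Px_Suc survives_Cons
    by (simp add: Px_x_irrelevant[of a p "a * x + 1" n _ x] Px_x_irrelevant[of a p "a * x - 1" n _ x])
next
  case False
  thus ?thesis unfolding surv_def Px_Suc survives_Cons by (simp add: Px_def)
qed

lemma surv_neg: "x < 0 \<Longrightarrow> surv a p n A x = 0"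
  by (cases n) (auto simp: surv_0 surv_Suc)

text \<open>A decomposition by the last step, proved by induction on the first: the identity
  propagates because \<open>a * x + 1\<close> and \<open>a * x - 1\<close> stay at or below
  \<open>1/(1-a)\<close>, while negative points contribute 0.\<close>

lemma surv_last_step:
  assumes a: "1/2 \<le> a" "a \<le> 2/3"
    and base: "\<And>x. 0 \<le> x \<Longrightarrow> x \<le> 1/(1-a) \<Longrightarrow> surv a p 1 A x = c * surv a p 0 UNIV x + d * surv a p 0 B x"
    and "x \<le> 1/(1-a)"
  shows "surv a p (Suc n) A x = c * surv a p n UNIV x + d * surv a p n B x"
  using assms(4)
proof (induction n arbitrary: x)
  case 0
  thus ?case using base[of x] surv_neg[of x a p] by (cases "0 \<le> x") auto
next
  case (Suc n)
  show ?case
  proof (cases "0 \<le> x")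
    case True
    have "a * x \<le> a * (1/(1-a))" using Suc.prems a by (intro mult_left_mono) auto
    hence "a * x + 1 \<le> 1/(1-a)" "a * x - 1 \<le> 1/(1-a)" using M_bounds[OF a] by linarith+
    from Suc.IH[OF this(1)] Suc.IH[OF this(2)] show ?thesis
      unfolding surv_Suc[of a p "Suc n" A x] surv_Suc[of a p n UNIV x] surv_Suc[of a p n B x]
      using True by (simp add: algebra_simps)
  next
    case False
    thus ?thesis by (simp add: surv_neg)
  qed
qed

text \<open>For \<open>y < 1\<close> an upward step always lands above \<open>y\<close>, and a
  downward step does so iff the state exceeds \<open>(y + 1) / a\<close>. For
  \<open>y \<ge> 1\<close> a downward step fails because \<open>a * x - 1 \<le> 1\<close>, and an
  upward step needs a state above \<open>(y - 1) / a\<close>. These thresholds are the two branches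
  of the map.\<close>

lemma surv_strict_step:
  assumes a: "1/2 \<le> a" "a \<le> 2/3" and "0 \<le> y" "x \<le> 1/(1-a)"
  shows "surv a p (Suc n) {y<..} x
    = (if y < 1 then p * surv a p n UNIV x + (1 - p) * surv a p n {Ta a y<..} x
       else p * surv a p n {Ta a y<..} x)"
proof (cases "y < 1")
  case True
  have "surv a p (Suc n) {y<..} x = p * surv a p n UNIV x + (1 - p) * surv a p n {Ta a y<..} x"
  proof (rule surv_last_step[OF a _ assms(4)])
    fix x :: real assume x: "0 \<le> x" "x \<le> 1/(1-a)"
    have "0 \<le> a * x" using x a by simp
    moreover have "0 \<le> a * x - 1 \<and> y < a * x - 1 \<longleftrightarrow> Ta a y < x"
      using True a assms(3) by (auto simp: Ta_def field_simps)
    ultimately show "surv a p 1 {y<..} x = p * surv a p 0 UNIV x + (1 - p) * surv a p 0 {Ta a y<..} x"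
      using x True unfolding One_nat_def surv_Suc surv_0 by auto
  qed
  thus ?thesis using True by simp
next
  case False
  have "surv a p (Suc n) {y<..} x = 0 * surv a p n UNIV x + p * surv a p n {Ta a y<..} x"
  proof (rule surv_last_step[OF a _ assms(4)])
    fix x :: real assume x: "0 \<le> x" "x \<le> 1/(1-a)"
    have "a * x \<le> a * (1/(1-a))" using x a by (intro mult_left_mono) auto
    hence ax: "a * x \<le> 2" "0 \<le> a * x" using M_bounds[OF a] x a by (linarith, simp)
    moreover have "0 \<le> a * x + 1 \<and> y < a * x + 1 \<longleftrightarrow> Ta a y < x"
      using False a ax by (auto simp: Ta_def field_simps)
    ultimately show "surv a p 1 {y<..} x = 0 * surv a p 0 UNIV x + p * surv a p 0 {Ta a y<..} x"
      using x False unfolding One_nat_def surv_Suc surv_0 by auto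
  qed
  thus ?thesis using False by simp
qed

text \<open>Closed rays allow a start from the full state space \<open>{0..}\<close>. The excluded
  case is a genuine exception: for \<open>a = 2/3\<close> a downward step from 3 lands exactly on
  1.\<close>

lemma surv_weak_step:
  assumes a: "1/2 \<le> a" "a \<le> 2/3" and "0 \<le> y" "x \<le> 1/(1-a)" "y \<noteq> 1 \<or> a < 2/3"
  shows "surv a p (Suc n) {y..} x
    = (if y < 1 then p * surv a p n UNIV x + (1 - p) * surv a p n {Ta a y..} x
       else p * surv a p n {Ta a y..} x)"
proof (cases "y < 1")
  case True
  have "surv a p (Suc n) {y..} x = p * surv a p n UNIV x + (1 - p) * surv a p n {Ta a y..} x"
  proof (rule surv_last_step[OF a _ assms(4)])
    fix x :: real assume x: "0 \<le> x" "x \<le> 1/(1-a)"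
    have "0 \<le> a * x" using x a by simp
    moreover have "0 \<le> a * x - 1 \<and> y \<le> a * x - 1 \<longleftrightarrow> Ta a y \<le> x"
      using True a assms(3) by (auto simp: Ta_def field_simps)
    ultimately show "surv a p 1 {y..} x = p * surv a p 0 UNIV x + (1 - p) * surv a p 0 {Ta a y..} x"
      using x True unfolding One_nat_def surv_Suc surv_0 by auto
  qed
  thus ?thesis using True by simp
next
  case False
  have "surv a p (Suc n) {y..} x = 0 * surv a p n UNIV x + p * surv a p n {Ta a y..} x"
  proof (rule surv_last_step[OF a _ assms(4)])
    fix x :: real assume x: "0 \<le> x" "x \<le> 1/(1-a)"
    have "a * x \<le> a * (1/(1-a))" using x a by (intro mult_left_mono) auto
    also have "a * (1/(1-a)) < 1 + y"
    proof (cases "a < 2/3")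
      case True
      hence "a * (1/(1-a)) < 2" using a by (simp add: field_simps)
      thus ?thesis using False by linarith
    next
      case eq: False
      hence "y > 1" using assms(5) False by auto
      thus ?thesis using M_bounds[OF a] by linarith
    qed
    finally have ax: "a * x - 1 < y" "0 \<le> a * x" using x a by auto
    moreover have "0 \<le> a * x + 1 \<and> y \<le> a * x + 1 \<longleftrightarrow> Ta a y \<le> x"
      using False a ax by (auto simp: Ta_def field_simps)
    ultimately show "surv a p 1 {y..} x = 0 * surv a p 0 UNIV x + p * surv a p 0 {Ta a y..} x"
      using x False unfolding One_nat_def surv_Suc surv_0 by auto
  qed
  thus ?thesis using False by simp
qed

text \<open>A recursion along the map with a source \<open>s\<close> at each visit below 1 becomes a
  convolution with the orbit terms. It is applied to tails over open rays, to tails over closed rays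
  and to the affinities \<open>hellinger\<close>; for \<open>y = 0\<close> and
  \<open>s n = R n 0\<close> it is a renewal equation.\<close>

lemma unroll_recursion:
  fixes R :: "nat \<Rightarrow> real \<Rightarrow> real"
  assumes "\<And>n y. y \<in> D \<Longrightarrow> R (Suc n) y = m * (if y < 1 then s n + r * R n (Ta a y) else R n (Ta a y))"
    and "\<And>y. y \<in> D \<Longrightarrow> Ta a y \<in> D" and "y \<in> D"
  shows "R n y = (\<Sum>k<n. orbit_term m r a y k * s (n - 1 - k))
     + orbit_weight m r a y n * R 0 ((Ta a ^^ n) y)"
  using assms(3)
proof (induction n arbitrary: y)
  case (Suc n)
  have t0: "orbit_term m r a y 0 = (if y < 1 then m else 0)" by (simp add: orbit_term_def delta_0)
  have tS: "orbit_term m r a y (Suc k) = m * (if y < 1 then r else 1) * orbit_term m r a (Ta a y) k" for k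
    using orbit_term_add[of m r a y 1 k] orbit_weight_Suc[of m r a y 0] by simp
  have wS: "orbit_weight m r a y (Suc k) = m * (if y < 1 then r else 1) * orbit_weight m r a (Ta a y) k" for k
    using orbit_weight_add[of m r a y 1 k] orbit_weight_Suc[of m r a y 0] by simp
  have "(\<Sum>k<Suc n. orbit_term m r a y k * s (Suc n - 1 - k))
    = (if y < 1 then m else 0) * s n
      + m * (if y < 1 then r else 1) * (\<Sum>k<n. orbit_term m r a (Ta a y) k * s (n - 1 - k))"
    by (subst sum.lessThan_Suc_shift) (simp add: t0 tS sum_distrib_left mult.assoc)
  moreover have "(Ta a ^^ Suc n) y = (Ta a ^^ n) (Ta a y)" by (simp add: funpow_swap1)
  ultimately show ?case
    using assms(1)[OF Suc.prems, of n] Suc.IH[of "Ta a y"] assms(2)[OF Suc.prems]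
    by (simp add: wS algebra_simps)
qed simp

text \<open>A 2-adic argument: every later point of this orbit is an odd multiple of a negative power of 2.\<close>

lemma orbit_two_thirds_neq_1: "(Ta (2/3) ^^ k) 0 \<noteq> 1"
proof (cases k)
  case (Suc j)
  have "\<exists>i::int. odd i \<and> (Ta (2/3) ^^ Suc j) 0 = of_int i / 2 ^ Suc j"
  proof (induction j)
    case 0 show ?case by (rule exI[of _ 3]) (simp add: Ta_def)
  next
    case (Suc j)
    then obtain i :: int where i: "odd i" "(Ta (2/3) ^^ Suc j) 0 = of_int i / 2 ^ Suc j" by blast
    define e :: int where "e = (if (Ta (2/3) ^^ Suc j) 0 < 1 then 1 else -1)"
    have "(Ta (2/3) ^^ Suc (Suc j)) 0 = (of_int i / 2 ^ Suc j + of_int e) / (2/3)"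
      using i(2) by (simp add: Ta_def e_def)
    also have "\<dots> = of_int (3 * (i + e * 2 ^ Suc j)) / 2 ^ Suc (Suc j)"
      by (simp add: field_simps)
    finally show ?case using i(1) by (intro exI[of _ "3 * (i + e * 2 ^ Suc j)"]) auto
  qed
  then obtain i :: int where i: "odd i" "(Ta (2/3) ^^ Suc j) 0 = of_int i / 2 ^ Suc j" by blast
  show ?thesis
  proof
    assume "(Ta (2/3) ^^ k) 0 = 1"
    hence "of_int i = (2 ^ Suc j :: real)" using i(2) Suc by (simp add: field_simps)
    hence "i = 2 ^ Suc j" by (metis of_int_eq_iff of_int_numeral of_int_power)
    thus False using i(1) by simp
  qed
qed simp

section \<open>Survival asymptotics and conditional limits\<close>

definition renewal_mean :: "real \<Rightarrow> real \<Rightarrow> real" where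
  "renewal_mean a p = (\<Sum>k. 1 - orbit_sum (mu a p) (odds p) a k 0)"

lemma scaled_step:
  fixes p l :: real
  assumes "0 < p" "0 < l"
  shows "(p * s + (1 - p) * t) / l ^ Suc n = p / l * (s / l ^ n + (1 - p) / p * (t / l ^ n))"
    and "p * s / l ^ Suc n = p / l * (s / l ^ n)"
  using assms by (simp_all add: field_simps)

lemma surv_unroll_strict:
  assumes a: "1/2 \<le> a" "a \<le> 2/3" and p: "0 < p" "p < 1" and y: "0 \<le> y" and x: "x \<le> 1/(1-a)"
  shows "surv a p n {y<..} x / lam a p ^ n
    = (\<Sum>k<n. orbit_term (mu a p) (odds p) a y k * (surv a p (n-1-k) UNIV x / lam a p ^ (n-1-k)))
      + orbit_weight (mu a p) (odds p) a y n * surv a p 0 {(Ta a ^^ n) y<..} x"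
proof -
  have l: "lam a p > 0" using char_root a p by blast
  have "surv a p (Suc n) {y<..} x / lam a p ^ Suc n = mu a p *
     (if y < 1 then surv a p n UNIV x / lam a p ^ n + odds p * (surv a p n {Ta a y<..} x / lam a p ^ n)
      else surv a p n {Ta a y<..} x / lam a p ^ n)" if "y \<in> {0..}" for n y
    using that scaled_step[OF p(1) l]
    by (simp only: surv_strict_step[OF a _ x] atLeast_iff mu_def split: if_split) simp
  from unroll_recursion[of "{0..}" "\<lambda>n y. surv a p n {y<..} x / lam a p ^ n", OF this] Ta_nonneg[of a] a y
  show ?thesis by simp
qed

lemma surv_unroll_weak:
  assumes a: "1/2 \<le> a" "a \<le> 2/3" and p: "0 < p" "p < 1" and x: "x \<le> 1/(1-a)"
  shows "surv a p n {0..} x / lam a p ^ n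
    = (\<Sum>k<n. orbit_term (mu a p) (odds p) a 0 k * (surv a p (n-1-k) UNIV x / lam a p ^ (n-1-k)))
      + orbit_weight (mu a p) (odds p) a 0 n * surv a p 0 {(Ta a ^^ n) 0..} x"
proof -
  \<comment> \<open>The domain is the orbit of 0, which for \<open>a = 2/3\<close> avoids the point
    1 where the closed-ray step breaks down.\<close>
  define D where "D = range (\<lambda>k. (Ta a ^^ k) 0)"
  have l: "lam a p > 0" using char_root a p by blast
  have D: "0 \<le> y \<and> (y \<noteq> 1 \<or> a < 2/3)" if "y \<in> D" for y
  proof -
    obtain k where y: "y = (Ta a ^^ k) 0" using \<open>y \<in> D\<close> by (auto simp: D_def)
    have "a = 2/3 \<Longrightarrow> y \<noteq> 1" using orbit_two_thirds_neq_1[of k] y by metis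
    moreover have "0 \<le> y" using Ta_iter_nonneg[of a 0 k] y a by simp
    ultimately show ?thesis using a by argo
  qed
  have rec: "surv a p (Suc n) {y..} x / lam a p ^ Suc n = mu a p *
     (if y < 1 then surv a p n UNIV x / lam a p ^ n + odds p * (surv a p n {Ta a y..} x / lam a p ^ n)
      else surv a p n {Ta a y..} x / lam a p ^ n)" if "y \<in> D" for n y
    using D[OF that] scaled_step[OF p(1) l]
    by (simp only: surv_weak_step[OF a _ x] mu_def split: if_split) simp
  have "Ta a y \<in> D" if "y \<in> D" for y
  proof -
    obtain k where "y = (Ta a ^^ k) 0" using \<open>y \<in> D\<close> by (auto simp: D_def)
    hence "Ta a y = (Ta a ^^ Suc k) 0" by simp
    thus ?thesis unfolding D_def by (rule range_eqI)
  qed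
  moreover have "0 \<in> D" unfolding D_def by (rule range_eqI[of _ _ 0]) simp
  ultimately show ?thesis
    using unroll_recursion[of D "\<lambda>n y. surv a p n {y..} x / lam a p ^ n", OF rec] by simp
qed

lemma surv_nonneg_UNIV: "surv a p n {0..} x = surv a p n UNIV x"
proof -
  have "survives a x xs \<Longrightarrow> 0 \<le> chain a x xs" for xs
    unfolding survives_def by (metis order_refl take_all)
  thus ?thesis unfolding surv_def by (metis UNIV_I atLeast_iff)
qed

lemma surv_UNIV: "surv a p n UNIV x = Px a p x n (survives a x)"
  by (simp add: surv_def)

lemma V_eq:
  assumes a: "1/2 \<le> a" "a \<le> 2/3" and x: "x \<le> 1/(1-a)"
  shows "V a p x = (\<Sum>k. orbit_weight (mu a p) (odds p) a 0 k * (if (Ta a ^^ k) 0 \<le> x then 1 else 0))"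
  unfolding V_def
proof (rule suminf_cong)
  fix k
  show "(if enat k \<le> kappa a 0 then (p / lam a p) ^ k * odds p ^ Lk a 0 k * (if (Ta a ^^ k) 0 \<le> x then 1 else 0) else 0)
    = orbit_weight (mu a p) (odds p) a 0 k * (if (Ta a ^^ k) 0 \<le> x then 1 else 0)"
  proof (cases "enat k \<le> kappa a 0")
    case False
    hence "\<not> (Ta a ^^ k) 0 \<le> x" using after_kappa[OF a False] x by simp
    thus ?thesis by simp
  qed (simp add: orbit_weight_def mu_def)
qed

text \<open>The tails of the step law are the rests of the series, that is, a weight times a value
  at most 1, so they inherit summability from the weights. The mean exceeds 1 because the tails at 0
  and 1 are \<open>1\<close> and \<open>1 - m > 0\<close>; its reciprocal is the constant of the
  survival asymptotics.\<close>

lemma renewal_mean: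
  assumes a: "1/2 < a" "a \<le> 2/3" and p: "0 < p" "p < 1"
  shows "summable (\<lambda>k. 1 - orbit_sum (mu a p) (odds p) a k 0)" "1 < renewal_mean a p"
proof -
  define m r where "m = mu a p" and "r = odds p"
  have r: "r > 0" using p by (simp add: r_def)
  have m: "0 < m" "m < 1" "subunit m r a" "tail_fun m r a 0 = 1"
    using char_root[of a p] mu_less_1[OF a p] a p by (auto simp: m_def r_def)
  have nonneg: "0 \<le> 1 - orbit_sum m r a k 0" for k using m by (simp add: subunit_def)
  have le: "1 - orbit_sum m r a k 0 \<le> orbit_weight m r a 0 k" for k
  proof -
    have "1 - orbit_sum m r a k 0 = orbit_weight m r a 0 k * tail_fun m r a ((Ta a ^^ k) 0)"
      using tail_fun_split[of a a m r 0 k] m r a by simp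
    also have "\<dots> \<le> orbit_weight m r a 0 k * 1"
      using m r a by (intro mult_left_mono tail_fun_le_1[where b = a] Ta_iter_nonneg orbit_weight_nonneg) auto
    finally show ?thesis by simp
  qed
  have "summable (orbit_weight m r a 0)" using m r by (intro summable_orbit_weight) (auto simp: subunit_def)
  hence s: "summable (\<lambda>k. 1 - orbit_sum m r a k 0)"
    by (rule summable_comparison_test'[where N = 0]) (use nonneg le in auto)
  thus "summable (\<lambda>k. 1 - orbit_sum (mu a p) (odds p) a k 0)" by (simp add: m_def r_def)
  have "(\<Sum>k\<in>{0,1}. 1 - orbit_sum m r a k 0) \<le> (\<Sum>k. 1 - orbit_sum m r a k 0)"
    by (rule sum_le_suminf[OF s]) (use nonneg in auto)
  moreover have "orbit_sum m r a 1 0 = m" by (simp add: orbit_sum_def orbit_term_def delta_0)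
  ultimately show "1 < renewal_mean a p" using m by (simp add: renewal_mean_def m_def r_def)
qed

lemma scaled_survival_limit:
  assumes a: "1/2 < a" "a \<le> 2/3" and p: "0 < p" "p < 1" and x: "x \<in> {0..1/(1-a)}"
  shows "(\<lambda>n. surv a p n UNIV x / lam a p ^ n) \<longlonglongrightarrow> V a p x / renewal_mean a p" and "1 \<le> V a p x"
proof -
  define m r where "m = mu a p" and "r = odds p"
  have r: "r > 0" using p by (simp add: r_def)
  have m: "0 < m" "m < 1" "subunit m r a" "orbit_term m r a 0 sums 1"
    using char_root[of a p] mu_less_1[OF a p] a p by (auto simp: m_def r_def)
  define g where "g n = orbit_weight m r a 0 n * (if (Ta a ^^ n) 0 \<le> x then 1 else 0)" for n
  define v where "v n = surv a p n UNIV x / lam a p ^ n" for n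
  have sw: "summable (orbit_weight m r a 0)" using m r by (intro summable_orbit_weight) (auto simp: subunit_def)
  have g0: "0 \<le> g n" for n using orbit_weight_nonneg[of m r a 0 n] m r by (simp add: g_def)
  have sg: "summable g"
    by (rule summable_comparison_test'[OF sw, where N = 0])
      (use orbit_weight_nonneg[of m r a 0] m r in \<open>auto simp: g_def\<close>)
  have rec: "v n = g n + (\<Sum>k<n. orbit_term m r a 0 k * v (n - 1 - k))" for n
    using surv_unroll_weak[of a p x n] a p x
    by (simp add: v_def g_def m_def r_def surv_nonneg_UNIV surv_0)
  have V: "V a p x = suminf g" using V_eq[of a x p] a x by (simp add: g_def[abs_def] m_def r_def)
  have "v \<longlonglongrightarrow> suminf g / (\<Sum>k. 1 - orbit_sum m r a k 0)"
  proof (rule renewal_theorem[where b = "orbit_term m r a 0"])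
    show "0 < orbit_term m r a 0 0" using m by (simp add: orbit_term_def delta_0)
    show "summable (\<lambda>k. 1 - orbit_sum m r a k 0)" using renewal_mean[OF a p] by (simp add: m_def r_def)
    show "v n = g n + (\<Sum>k<n. orbit_term m r a 0 k * v (n - 1 - k))" for n by (rule rec)
  qed (use m r g0 sg orbit_term_nonneg in \<open>auto simp: orbit_sum_def\<close>)
  thus "(\<lambda>n. surv a p n UNIV x / lam a p ^ n) \<longlonglongrightarrow> V a p x / renewal_mean a p"
    by (simp add: V renewal_mean_def m_def r_def v_def[abs_def])
  have "(\<Sum>k\<in>{0}. g k) \<le> suminf g" using sg g0 by (intro sum_le_suminf) auto
  thus "1 \<le> V a p x" using x by (simp add: V g_def)
qed

lemma survival_asymptotics:
  assumes a: "1/2 < a" "a \<le> 2/3" and p: "0 < p" "p < 1"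
  shows "\<exists>c. 0 < c \<and> c < 1 \<and> (\<forall>x \<in> {0..1/(1-a)}.
     (\<lambda>n. Px a p x n (survives a x)) \<sim>[at_top] (\<lambda>n. c * V a p x * lam a p ^ n))"
proof (intro exI[of _ "1 / renewal_mean a p"] conjI ballI)
  have R: "1 < renewal_mean a p" using renewal_mean[OF a p] by simp
  thus "0 < 1 / renewal_mean a p" "1 / renewal_mean a p < 1" by simp_all
  fix x assume x: "x \<in> {0..1/(1-a)}"
  have V: "1 \<le> V a p x" using scaled_survival_limit[OF a p x] by simp
  have l: "0 < lam a p" using char_root[of a p] a p by simp
  have "(\<lambda>n. (surv a p n UNIV x / lam a p ^ n) / (V a p x / renewal_mean a p))
     \<longlonglongrightarrow> (V a p x / renewal_mean a p) / (V a p x / renewal_mean a p)"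
    using R V by (intro tendsto_divide scaled_survival_limit[OF a p x] tendsto_const) auto
  hence "(\<lambda>n. Px a p x n (survives a x) / (1 / renewal_mean a p * V a p x * lam a p ^ n)) \<longlonglongrightarrow> 1"
    using R V l by (simp add: surv_UNIV field_simps)
  thus "(\<lambda>n. Px a p x n (survives a x)) \<sim>[at_top] (\<lambda>n. 1 / renewal_mean a p * V a p x * lam a p ^ n)"
    by (rule asymp_equivI')
qed

lemma Fqs_eq:
  assumes "1/2 \<le> a" "a \<le> 2/3"
  shows "Fqs a p y = 1 - tail_fun (mu a p) (odds p) a y"
  unfolding Fqs_def tail_fun_def mu_def[symmetric] orbit_term_kappa[OF assms] by simp

lemma Px_split:
  "Px a p x n (\<lambda>xs. survives a x xs \<and> chain a x xs \<le> y)
     = surv a p n UNIV x - surv a p n {y<..} x"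
  unfolding surv_def Px_def sum_subtractf[symmetric]
  by (intro sum.cong) auto

text \<open>After scaling, the mass above \<open>y\<close> is the survival sequence convolved with
  the orbit terms of \<open>y\<close>, up to a remainder bounded by the decaying weights. Its limit
  is therefore \<open>tail_fun\<close> times the limit of the total mass.\<close>

lemma conditional_limit:
  assumes a: "1/2 < a" "a \<le> 2/3" and p: "0 < p" "p < 1" and x: "x \<in> {0..1/(1-a)}" and y: "0 \<le> y"
  shows "(\<lambda>n. Px a p x n (\<lambda>xs. survives a x xs \<and> chain a x xs \<le> y) / Px a p x n (survives a x))
          \<longlonglongrightarrow> Fqs a p y"
proof -
  define m r where "m = mu a p" and "r = odds p"
  have r: "r > 0" using p by (simp add: r_def)
  have m: "0 < m" "m < 1" "subunit m r a"
    using char_root[of a p] mu_less_1[OF a p] a p by (auto simp: m_def r_def)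
  have l: "0 < lam a p" using char_root[of a p] a p by simp
  define v where "v n = surv a p n UNIV x / lam a p ^ n" for n
  define L where "L = V a p x / renewal_mean a p"
  have L: "L > 0" using scaled_survival_limit[OF a p x] renewal_mean[OF a p] by (simp add: L_def)
  have v: "v \<longlonglongrightarrow> L" using scaled_survival_limit[OF a p x] by (simp add: v_def[abs_def] L_def)
  from convergent_imp_Bseq[OF convergentI[OF v]] obtain B where "\<forall>n. norm (v n) \<le> B"
    by (rule BseqE)
  hence B: "\<bar>v n\<bar> \<le> B" for n by simp
  have s: "summable (orbit_term m r a y)"
    using m r a y by (intro summable_orbit_term[where b = a]) auto
  have "(\<lambda>n. \<Sum>k\<le>n. orbit_term m r a y k * v (n - k)) \<longlonglongrightarrow> suminf (orbit_term m r a y) * L"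
  proof (rule convolution_tendsto[where B = B])
    show "(\<lambda>n. v (n - k)) \<longlonglongrightarrow> L" for k
      using filterlim_compose[OF v filterlim_minus_const_nat_at_top] .
  qed (use m r s B orbit_term_nonneg in \<open>auto simp: filterlim_ident\<close>)
  hence conv: "(\<lambda>n. \<Sum>k<Suc n. orbit_term m r a y k * v (Suc n - 1 - k)) \<longlonglongrightarrow> tail_fun m r a y * L"
    by (simp add: lessThan_Suc_atMost tail_fun_def)
  have "orbit_weight m r a y \<longlonglongrightarrow> 0"
    using m r a y orbit_sum_le_1[of a a m r y] by (intro orbit_weight_tendsto_0) auto
  hence w0: "(\<lambda>n. orbit_weight m r a y (Suc n)) \<longlonglongrightarrow> 0" by (rule LIMSEQ_Suc)
  have "norm (orbit_weight m r a y k * surv a p 0 {z<..} x) \<le> orbit_weight m r a y k" for k z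
    using orbit_weight_nonneg[of m r a y k] m r by (simp add: surv_0)
  hence "(\<lambda>n. orbit_weight m r a y (Suc n) * surv a p 0 {(Ta a ^^ Suc n) y<..} x) \<longlonglongrightarrow> 0"
    by (intro Lim_null_comparison[OF _ w0] always_eventually allI)
  moreover have unroll: "surv a p n {y<..} x / lam a p ^ n = (\<Sum>k<n. orbit_term m r a y k * v (n - 1 - k))
      + orbit_weight m r a y n * surv a p 0 {(Ta a ^^ n) y<..} x" for n
    unfolding v_def m_def r_def by (rule surv_unroll_strict) (use a p x y in auto)
  ultimately have "(\<lambda>n. surv a p (Suc n) {y<..} x / lam a p ^ Suc n) \<longlonglongrightarrow> tail_fun m r a y * L"
    using tendsto_add[OF conv, of _ 0] by (simp only: unroll add_0_right)
  hence "(\<lambda>n. surv a p n {y<..} x / lam a p ^ n) \<longlonglongrightarrow> tail_fun m r a y * L"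
    by (rule LIMSEQ_imp_Suc)
  from tendsto_divide[OF tendsto_diff[OF v this] v]
  have "(\<lambda>n. (v n - surv a p n {y<..} x / lam a p ^ n) / v n) \<longlonglongrightarrow> (L - tail_fun m r a y * L) / L"
    using L by simp
  moreover have "(v n - surv a p n {y<..} x / lam a p ^ n) / v n
    = Px a p x n (\<lambda>xs. survives a x xs \<and> chain a x xs \<le> y) / Px a p x n (survives a x)" for n
    using l by (simp add: v_def Px_split surv_UNIV diff_divide_distrib[symmetric])
  moreover have "(L - tail_fun m r a y * L) / L = Fqs a p y"
    using L Fqs_eq[of a p y] a by (simp add: m_def r_def diff_divide_distrib)
  ultimately show ?thesis by simp
qed

section \<open>The exceptional parameter set is null\<close>

text \<open>For scale \<open>2/3\<close> and ratio 1 the affine function \<open>1 - y/3\<close>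
  solves the functional equation exactly; the subtracted product is the rest after \<open>n\<close>
  steps.\<close>

lemma orbit_sum_two_thirds:
  "orbit_sum (2/3) 1 (2/3) n y = (1 - y/3) - (2/3)^n * (1 - (Ta (2/3) ^^ n) y / 3)"
proof (induction n arbitrary: y)
  case (Suc n)
  define z where "z = Ta (2/3) y"
  define X where "X = (2/3) ^ n * (1 - (Ta (2/3) ^^ n) z / 3)"
  have IH: "orbit_sum (2/3) 1 (2/3) n z = 1 - z/3 - X" using Suc[of z] by (simp add: X_def)
  have X: "(2/3) ^ Suc n * (1 - (Ta (2/3) ^^ Suc n) y / 3) = 2/3 * X"
    by (simp add: X_def z_def funpow_swap1)
  show ?case
  proof (cases "y < 1")
    case True
    hence "z = 3/2 * (y + 1)" by (simp add: z_def Ta_def)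
    thus ?thesis unfolding orbit_sum_Suc X z_def[symmetric] IH using True by simp
  next
    case False
    hence "z = 3/2 * (y - 1)" by (simp add: z_def Ta_def)
    thus ?thesis unfolding orbit_sum_Suc X z_def[symmetric] IH using False by simp
  qed
qed simp

lemma orbit_two_thirds_bounded:
  assumes "0 \<le> y" "y \<le> 3"
  shows "(Ta (2/3) ^^ n) y \<in> {0..3}"
proof -
  have "\<not> (Ta (2/3) ^^ n) y > 1/(1-2/3)"
    using exceeds_imp_Ia[of "2/3" y n] assms by (auto simp: Ia_def)
  thus ?thesis using Ta_iter_nonneg[of "2/3" y n] assms by auto
qed

lemma orbit_term_two_thirds_sums:
  assumes "0 \<le> y" "y \<le> 3"
  shows "orbit_term (2/3) 1 (2/3) y sums (1 - y/3)"
proof -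
  have "(\<lambda>n. (2/3::real)^n * (1 - (Ta (2/3) ^^ n) y / 3)) \<longlonglongrightarrow> 0"
  proof (rule Lim_null_comparison)
    show "(\<lambda>n. (2/3::real)^n) \<longlonglongrightarrow> 0" by (rule LIMSEQ_realpow_zero) auto
    show "\<forall>\<^sub>F n in sequentially. norm ((2/3::real)^n * (1 - (Ta (2/3) ^^ n) y / 3)) \<le> (2/3)^n"
    proof (intro always_eventually allI)
      fix n
      have "\<bar>1 - (Ta (2/3) ^^ n) y / 3\<bar> \<le> 1" using orbit_two_thirds_bounded[OF assms, of n] by auto
      thus "norm ((2/3::real)^n * (1 - (Ta (2/3) ^^ n) y / 3)) \<le> (2/3)^n"
        by (simp add: abs_mult mult_left_le)
    qed
  qed
  from tendsto_diff[OF tendsto_const this, of "1 - y/3"] show ?thesis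
    unfolding sums_def orbit_sum_two_thirds[symmetric] by (simp add: orbit_sum_def)
qed

lemma mu_two_thirds_half: "mu (2/3) (1/2) = 2/3" "lam (2/3) (1/2) = 3/4"
proof -
  show "mu (2/3) (1/2) = 2/3" using orbit_term_two_thirds_sums[of 0] by (intro mu_unique) auto
  hence "lam (2/3) (1/2) = (1/2) / (2/3)" using lam_eq[of "2/3" "1/2"] by (simp only:)
  thus "lam (2/3) (1/2) = 3/4" by simp
qed

lemma weight_half: "weight (1/2) xs = (1/2) ^ length xs"
proof -
  have "count_list xs True + count_list xs False = length xs"
    by (induction xs) auto
  hence "(1/2::real) ^ length xs = (1/2) ^ count_list xs True * (1/2) ^ count_list xs False"
    by (metis power_add)
  thus ?thesis by (simp add: weight_def)
qed

lemma card_survivors: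
  "real (card {xs. length xs = n \<and> survives a x xs}) = 2 ^ n * surv a (1/2) n UNIV x"
proof -
  have "surv a (1/2) n UNIV x = (\<Sum>xs\<in>{xs. length xs = n}. if survives a x xs then (1/2) ^ n else 0)"
    unfolding surv_def Px_def weight_half by (intro sum.cong) auto
  also have "\<dots> = (\<Sum>xs\<in>{xs. length xs = n} \<inter> {xs. survives a x xs}. (1/2) ^ n)"
    by (subst sum.inter_restrict) (auto simp: finite_bool_lists intro!: sum.cong)
  also have "\<dots> = real (card {xs. length xs = n \<and> survives a x xs}) * (1/2)^n"
    by (simp add: Collect_conj_eq)
  finally show ?thesis by (simp add: power_divide)
qed

text \<open>Surviving words are counted through their probability at \<open>p = 1/2\<close>, where
  the decay rate is \<open>3/4\<close>, so the count grows like \<open>2 * 3/4\<close> per step. The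
  start 3 is the largest state; by monotonicity its survivors include all reversed itineraries
  needed below.\<close>

lemma card_survivors_le:
  obtains C where "\<And>n. real (card {xs. length xs = n \<and> survives (2/3) 3 xs}) \<le> C * (3/2) ^ n"
proof -
  have "(\<lambda>n. surv (2/3) (1/2) n UNIV 3 / (3/4) ^ n) \<longlonglongrightarrow> V (2/3) (1/2) 3 / renewal_mean (2/3) (1/2)"
    using scaled_survival_limit(1)[of "2/3" "1/2" 3] mu_two_thirds_half by simp
  from convergent_imp_Bseq[OF convergentI[OF this]] obtain C
    where C: "\<forall>n. norm (surv (2/3) (1/2) n UNIV 3 / (3/4) ^ n) \<le> C" by (rule BseqE)
  have "real (card {xs. length xs = n \<and> survives (2/3) 3 xs}) \<le> C * (3/2) ^ n" for n
  proof -
    have "surv (2/3) (1/2) n UNIV 3 / (3/4) ^ n \<le> C" using C[rule_format, of n] by (simp only: real_norm_def abs_le_iff)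
    hence "surv (2/3) (1/2) n UNIV 3 \<le> C * (3/4) ^ n" by (simp add: divide_le_eq)
    hence "2 ^ n * surv (2/3) (1/2) n UNIV 3 \<le> 2 ^ n * (C * (3/4) ^ n)" by simp
    also have "\<dots> = C * (2 * (3/4)) ^ n" unfolding power_mult_distrib by simp
    finally show ?thesis by (simp add: card_survivors)
  qed
  thus ?thesis using that by blast
qed

section \<open>Reversed itineraries as surviving paths\<close>

lemma survives_mono:
  assumes "survives a x ws" "0 \<le> a" "a \<le> b" "x \<le> y"
  shows "survives b y ws"
  using assms(1,4)
proof (induction ws arbitrary: x y)
  case (Cons w ws)
  have x: "0 \<le> x" using Cons.prems by (simp add: survives_Cons)
  hence "a * x \<le> b * y" using Cons.prems assms by (intro mult_mono) auto
  thus ?case using Cons.IH[of "a * x + (if w then 1 else -1)" "b * y + (if w then 1 else -1)"] Cons.prems x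
    by (simp add: survives_Cons)
qed (simp add: survives_Nil)

primrec backward_word :: "real \<Rightarrow> nat \<Rightarrow> bool list" where
  "backward_word a 0 = []"
| "backward_word a (Suc n) = (\<not> (Ta a ^^ n) 0 < 1) # backward_word a n"

lemma length_backward_word [simp]: "length (backward_word a n) = n"
  by (induction n) auto

text \<open>Inverse branches of the map are the steps of the chain, so reading an itinerary backwards
  gives a surviving path.\<close>

lemma survives_backward_word:
  assumes "0 < a"
  shows "survives a ((Ta a ^^ n) 0) (backward_word a n)"
proof (induction n)
  case (Suc n)
  have "a * Ta a z + (if \<not> z < 1 then 1 else -1) = z" for z using assms by (simp add: Ta_def)
  thus ?case using Suc Ta_iter_nonneg[of a 0 "Suc n"] assms by (simp add: survives_Cons)
qed (simp add: survives_Nil)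

lemma backward_word_delta:
  assumes "backward_word a n = backward_word b n" "j < n"
  shows "delta a 0 j = delta b 0 j"
proof -
  have "(Ta a ^^ j) 0 < 1 \<longleftrightarrow> (Ta b ^^ j) 0 < 1"
    using assms by (induction n) (auto simp: less_Suc_eq)
  thus ?thesis by (simp add: delta_def)
qed

text \<open>The parameters enter at the first step, through the images \<open>1/a\<close> and
  \<open>1/a'\<close> of 0. Their distance is expanded by at least \<open>1/a'\<close> in each of
  the \<open>n\<close> further steps with equal letters, yet the orbit at \<open>a\<close> is
  bounded by \<open>1/(1-a) \<le> 3\<close>. This is why the words have length
  \<open>Suc n\<close>.\<close>

lemma same_word_close:
  assumes "1/2 \<le> a" "a < a'" "a' \<le> b" "b \<le> 2/3" "a \<in> Sset"
    and eq: "backward_word a (Suc n) = backward_word a' (Suc n)"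
  shows "a' - a \<le> 3 * b ^ n"
proof -
  have d: "delta a 0 j = delta a' 0 j" if "j < Suc n" for j using backward_word_delta[OF eq that] .
  have 0: "Ta a 0 = 1/a" "Ta a' 0 = 1/a'" by (auto simp: Ta_def)
  have "(1/a - 1/a') / a' ^ n \<le> (Ta a ^^ n) (1/a) - (Ta a' ^^ n) (1/a')"
  proof (rule orbit_gap)
    fix j assume "j < n"
    thus "delta a (1/a) j = delta a' (1/a') j" using d[of "Suc j"] 0 by (simp add: delta_Suc)
  qed (use assms in \<open>auto intro!: divide_left_mono\<close>)
  also have "\<dots> = (Ta a ^^ Suc n) 0 - (Ta a' ^^ Suc n) 0"
    using 0 by (simp add: funpow_swap1)
  also have "(Ta a ^^ Suc n) 0 - (Ta a' ^^ Suc n) 0 \<le> 3"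
  proof -
    have "(Ta a ^^ Suc n) 0 \<le> 1/(1-a)" using assms(5) by (simp only: Sset_iff)
    moreover have "1/(1-a) \<le> 3" using M_bounds(2)[of a] assms by simp
    moreover have "0 \<le> (Ta a' ^^ Suc n) 0" using assms by (intro Ta_iter_nonneg) auto
    ultimately show ?thesis by linarith
  qed
  finally have "(1/a - 1/a') \<le> 3 * a' ^ n" using assms by (simp add: pos_divide_le_eq)
  moreover have "a' - a \<le> 1/a - 1/a'"
  proof -
    have "a * a' \<le> 1 * 1" using assms by (intro mult_mono) auto
    hence "a' - a \<le> (a' - a) / (a * a')" using assms by (simp add: pos_le_divide_eq mult_left_le)
    thus ?thesis using assms by (simp add: diff_frac_eq)
  qed
  moreover have "a' ^ n \<le> b ^ n" using assms by (intro power_mono) auto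
  ultimately show ?thesis by linarith
qed

text \<open>At most \<open>C * (3/2) ^ Suc n\<close> words with intervals of length
  \<open>6 * b ^ n\<close> give \<open>9 * C * (3/2 * b) ^ n\<close>. The factor
  \<open>3/2 * b\<close> is below 1 only for \<open>b < 2/3\<close>, whence the truncation.\<close>

lemma Sset_truncated_null:
  assumes "1/2 \<le> b" "b < 2/3"
  shows "emeasure lborel (Sset \<inter> {1/2..b}) = 0"
proof -
  define A where "A = Sset \<inter> {1/2..b}"
  obtain C where C: "\<And>n. real (card {xs. length xs = n \<and> survives (2/3) 3 xs}) \<le> C * (3/2) ^ n"
    using card_survivors_le by blast
  have bound: "emeasure lborel A \<le> ennreal (9 * C * (3/2 * b) ^ n)" for n
  proof -
    define W where "W = {xs. length xs = Suc n \<and> survives (2/3) 3 xs}"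
    define pick where "pick w = (SOME a. a \<in> A \<and> backward_word a (Suc n) = w)" for w
    define K where "K w = {pick w - 3 * b^n .. pick w + 3 * b^n}" for w
    have finW: "finite W" unfolding W_def by (rule finite_subset[OF _ finite_bool_lists[of "Suc n"]]) auto
    have "A \<subseteq> (\<Union>w\<in>W. K w)"
    proof
      fix a assume a: "a \<in> A"
      define w where "w = backward_word a (Suc n)"
      have S: "a \<in> Sset" "1/2 \<le> a" "a \<le> b" using a by (auto simp: A_def)
      have "(Ta a ^^ Suc n) 0 \<le> 1/(1-a)" using S(1) by (simp only: Sset_iff)
      hence "(Ta a ^^ Suc n) 0 \<le> 3" using M_bounds(2)[of a] S assms by linarith
      hence "survives (2/3) 3 w"
        using survives_mono[OF survives_backward_word[of a "Suc n"], of "2/3" 3] S assms by (simp add: w_def)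
      hence "w \<in> W" unfolding W_def w_def using length_backward_word by blast
      moreover have "pick w \<in> A \<and> backward_word (pick w) (Suc n) = w"
        unfolding pick_def by (rule someI[of _ a]) (use a w_def in auto)
      hence p: "pick w \<in> Sset" "1/2 \<le> pick w" "pick w \<le> b" "backward_word (pick w) (Suc n) = backward_word a (Suc n)"
        by (auto simp: A_def w_def)
      have "\<bar>a - pick w\<bar> \<le> 3 * b ^ n"
      proof (cases a "pick w" rule: linorder_cases)
        case less
        have "pick w - a \<le> 3 * b ^ n"
          using less S p assms by (intro same_word_close) (auto simp del: backward_word.simps)
        thus ?thesis using less by simp
      next
        case greater
        have "a - pick w \<le> 3 * b ^ n"
          using greater S p assms by (intro same_word_close) (auto simp del: backward_word.simps)
        thus ?thesis using greater by simp
      next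
        case equal
        thus ?thesis using assms by simp
      qed
      hence "a \<in> K w" by (auto simp: K_def abs_le_iff)
      ultimately show "a \<in> (\<Union>w\<in>W. K w)" by blast
    qed
    moreover have "(\<Union>w\<in>W. K w) \<in> sets lborel" using finW by (intro sets.finite_UN) (auto simp: K_def)
    ultimately have "emeasure lborel A \<le> emeasure lborel (\<Union>w\<in>W. K w)" by (rule emeasure_mono)
    also have "\<dots> \<le> (\<Sum>w\<in>W. emeasure lborel (K w))"
      using finW by (intro emeasure_subadditive_finite) (auto simp: K_def)
    also have "\<dots> = (\<Sum>w\<in>W. ennreal (6 * b ^ n))"
      using assms by (intro sum.cong) (auto simp: K_def)
    also have "\<dots> = ennreal (real (card W) * (6 * b ^ n))"
      using assms by (simp add: ennreal_mult ennreal_of_nat_eq_real_of_nat)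
    also have "\<dots> \<le> ennreal (C * (3/2) ^ Suc n * (6 * b ^ n))"
      using C[of "Suc n"] assms by (intro ennreal_leI mult_right_mono) (auto simp: W_def)
    also have "C * (3/2) ^ Suc n * (6 * b ^ n) = 9 * C * (3/2 * b) ^ n"
      by (simp only: power_mult_distrib power_Suc)
    finally show ?thesis .
  qed
  have "(\<lambda>n. 9 * C * (3/2 * b) ^ n) \<longlonglongrightarrow> 9 * C * 0"
    using assms by (intro tendsto_mult_left LIMSEQ_realpow_zero) auto
  hence "(\<lambda>n. ennreal (9 * C * (3/2 * b) ^ n)) \<longlonglongrightarrow> ennreal 0" by (intro tendsto_ennrealI) simp
  from LIMSEQ_le_const[OF this] bound have "emeasure lborel A \<le> ennreal 0" by blast
  thus ?thesis by (simp add: A_def)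
qed

lemma Sset_null: "Sset \<in> null_sets lborel"
proof -
  have S: "Sset \<in> sets borel" using closed_Sset by simp
  \<comment> \<open>The truncation points start at \<open>1/2\<close> and increase to
    \<open>2/3\<close>; the endpoint is added as a null singleton.\<close>
  define b where "b k = 2/3 - 1/(6 * (real k + 1))" for k :: nat
  have b: "1/2 \<le> b k" "b k < 2/3" for k by (auto simp: b_def field_simps)
  have "Sset \<inter> {1/2..b k} \<in> null_sets lborel" for k
    using Sset_truncated_null[OF b] S by (intro null_setsI) auto
  hence "(\<Union>k. Sset \<inter> {1/2..b k}) \<in> null_sets lborel" by (intro null_sets_UN)
  moreover have "{2/3::real} \<in> null_sets lborel" by (intro null_setsI) auto
  ultimately have N: "(\<Union>k. Sset \<inter> {1/2..b k}) \<union> {2/3} \<in> null_sets lborel" by (rule null_sets.Un)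
  moreover have "Sset \<subseteq> (\<Union>k. Sset \<inter> {1/2..b k}) \<union> {2/3}"
  proof
    fix a assume a: "a \<in> Sset"
    show "a \<in> (\<Union>k. Sset \<inter> {1/2..b k}) \<union> {2/3}"
    proof (cases "a = 2/3")
      case False
      hence lt: "1/2 \<le> a" "a < 2/3" using a by (auto simp: Sset_def)
      obtain k where "1 / (6 * (2/3 - a)) < real k" using reals_Archimedean2 by blast
      hence "1 < real k * (6 * (2/3 - a))" using lt by (simp add: pos_divide_less_eq)
      also have "\<dots> \<le> (real k + 1) * (6 * (2/3 - a))" using lt by (intro mult_right_mono) auto
      also have "\<dots> = (2/3 - a) * (6 * (real k + 1))" by (simp only: mult_ac)
      finally have "1 / (6 * (real k + 1)) \<le> 2/3 - a" by (subst pos_divide_le_eq) auto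
      hence "a \<in> Sset \<inter> {1/2..b k}" using a lt by (simp add: b_def)
      thus ?thesis by blast
    qed simp
  qed
  ultimately show ?thesis using null_sets_subset[OF N] S by simp
qed

section \<open>The Stieltjes measure of the root\<close>

lemma emeasure_open_eq_0:
  fixes U :: "real set"
  assumes M: "sets M = sets borel" and U: "open U"
    and null: "\<And>u v. u \<le> v \<Longrightarrow> {u..v} \<subseteq> U \<Longrightarrow> emeasure M {u..v} = 0"
  shows "emeasure M U = 0"
proof -
  define I where "I = {(u, v) \<in> \<rat> \<times> \<rat>. {u..v} \<subseteq> U}"
  have "countable I" unfolding I_def
    by (rule countable_subset[OF _ countable_SIGMA[OF countable_rat]]) (use countable_rat in auto)
  moreover have "(\<lambda>(u, v). {u..v}) z \<in> null_sets M" if "z \<in> I" for z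
  proof -
    obtain u v where z: "z = (u, v)" "{u..v} \<subseteq> U" using \<open>z \<in> I\<close> by (auto simp: I_def)
    have "emeasure M {u..v} = 0" using null[of u v] z(2) by (cases "u \<le> v") auto
    thus ?thesis using M by (auto simp: z(1) null_sets_def)
  qed
  ultimately have "(\<Union>z\<in>I. (\<lambda>(u, v). {u..v}) z) \<in> null_sets M" by (rule null_sets_UN')
  moreover have "U = (\<Union>z\<in>I. (\<lambda>(u, v). {u..v}) z)"
  proof (intro equalityI subsetI)
    fix x assume "x \<in> U"
    then obtain e where e: "e > 0" "ball x e \<subseteq> U" using U openE by blast
    obtain u where u: "u \<in> \<rat>" "x - e < u" "u < x" using Rats_dense_in_real[of "x - e" x] e by auto
    obtain v where v: "v \<in> \<rat>" "x < v" "v < x + e" using Rats_dense_in_real[of x "x + e"] e by auto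
    have "{u..v} \<subseteq> ball x e" using u v by (auto simp: dist_real_def)
    hence "(u, v) \<in> I" using u v e by (auto simp: I_def)
    thus "x \<in> (\<Union>z\<in>I. (\<lambda>(u, v). {u..v}) z)" using u v by (intro UN_I[of "(u, v)"]) auto
  qed (auto simp: I_def)
  ultimately show ?thesis by (metis null_setsD1)
qed

definition clamp_lam :: "real \<Rightarrow> real \<Rightarrow> real" where
  "clamp_lam p t = lam (min (2/3) (max (1/2) t)) p"

lemma clamp_lam_eq: "1/2 \<le> t \<Longrightarrow> t \<le> 2/3 \<Longrightarrow> clamp_lam p t = lam t p"
  by (simp add: clamp_lam_def)

lemma clamp_lam_mono:
  assumes "0 < p" "p < 1" "s \<le> t"
  shows "clamp_lam p s \<le> clamp_lam p t"
  unfolding clamp_lam_def using assms by (intro lam_mono) auto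

lemma continuous_clamp_lam:
  assumes "0 < p" "p < 1"
  shows "continuous_on UNIV (clamp_lam p)"
  unfolding clamp_lam_def
  by (rule continuous_on_compose2[OF continuous_lam[OF assms]]) (auto intro!: continuous_intros)

lemma emeasure_dlam_Icc:
  assumes "0 < p" "p < 1" "s \<le> t"
  shows "emeasure (dlam p) {s..t} = ennreal (clamp_lam p t - clamp_lam p s)"
proof -
  have "dlam p = interval_measure (clamp_lam p)" by (simp add: dlam_def clamp_lam_def[abs_def])
  thus ?thesis
    using emeasure_interval_measure_Icc[OF assms(3) clamp_lam_mono[OF assms(1,2)] continuous_clamp_lam[OF assms(1,2)]]
    by simp
qed

lemma sets_dlam [simp]: "sets (dlam p) = sets borel"
  by (simp add: dlam_def)

lemma dlam_no_atoms:
  assumes "0 < p" "p < 1"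
  shows "emeasure (dlam p) {t} = 0"
  using emeasure_dlam_Icc[OF assms, of t t] by simp

lemma half_two_thirds_in_Sset: "1/2 \<in> Sset" "2/3 \<in> Sset"
proof -
  have "(Ta (1/2) ^^ k) 0 \<le> 2" for k
  proof (cases k)
    case (Suc j)
    have "(Ta (1/2) ^^ j) 2 = 2" by (induction j) (auto simp: Ta_def)
    thus ?thesis using Suc by (simp add: funpow_swap1 Ta_def)
  qed simp
  thus "1/2 \<in> Sset" by (simp add: Sset_iff)
  show "2/3 \<in> Sset" using orbit_two_thirds_bounded[of 0] by (simp add: Sset_iff)
qed

lemma dlam_off_Sset:
  assumes "0 < p" "p < 1"
  shows "emeasure (dlam p) (UNIV - Sset) = 0"
proof (rule emeasure_open_eq_0)
  show "open (UNIV - Sset)" using closed_Sset by (simp add: Compl_eq_Diff_UNIV[symmetric] open_Compl)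
  fix u v :: real assume uv: "u \<le> v" "{u..v} \<subseteq> UNIV - Sset"
  \<comment> \<open>As both endpoints belong to \<open>Sset\<close>, an interval missing
    \<open>Sset\<close> lies left of \<open>1/2\<close>, right of \<open>2/3\<close> or between
    them; in the first two cases the clamped function is constant by construction.\<close>
  have nin: "1/2 \<notin> {u..v}" "2/3 \<notin> {u..v}" using half_two_thirds_in_Sset uv(2) by blast+
  then consider "v < 1/2" | "2/3 < u" | "1/2 \<le> u" "v \<le> 2/3"
    using uv(1) by (cases "v < 1/2"; cases "2/3 < u") auto
  hence "clamp_lam p u = clamp_lam p v"
  proof cases
    case 3
    have "{u..v} \<subseteq> {1/2..2/3} - Sset" using 3 uv(2) by auto
    hence "lam u p = lam v p"
      using lam_constant_off_Sset[OF assms, of "{u..v}" u v] uv(1) by (simp add: is_interval_cc)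
    thus ?thesis using 3 uv(1) by (simp add: clamp_lam_eq)
  qed (use uv(1) in \<open>auto simp: clamp_lam_def\<close>)
  thus "emeasure (dlam p) {u..v} = 0" using emeasure_dlam_Icc[OF assms uv(1)] by simp
qed simp

lemma lam_not_constant_at_Sset:
  assumes "b \<in> Sset" "u < b" "b < v" "0 < p" "p < 1"
  shows "\<exists>a. u < a \<and> a < v \<and> 1/2 \<le> a \<and> a \<le> 2/3 \<and> lam a p \<noteq> lam b p"
proof -
  obtain a where a: "u < a" "a < v" "1/2 \<le> a" "a \<le> 2/3" "mu a p \<noteq> mu b p"
    using mu_not_constant_at_Sset[OF assms] by blast
  thus ?thesis by (intro exI[of _ a]) (auto simp: mu_def)
qed

lemma msupport_dlam:
  assumes "0 < p" "p < 1"
  shows "msupport (dlam p) = Sset"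
proof (intro equalityI subsetI)
  fix t assume t: "t \<in> msupport (dlam p)"
  show "t \<in> Sset"
  proof (rule ccontr)
    assume "t \<notin> Sset"
    moreover have "open (UNIV - Sset)" using closed_Sset by (simp add: Compl_eq_Diff_UNIV[symmetric] open_Compl)
    ultimately obtain e where e: "e > 0" "ball t e \<subseteq> UNIV - Sset" using openE by blast
    have "emeasure (dlam p) (ball t e) \<le> emeasure (dlam p) (UNIV - Sset)"
      using e closed_Sset by (intro emeasure_mono) auto
    thus False using t e dlam_off_Sset[OF assms] by (auto simp: msupport_def)
  qed
next
  fix t assume t: "t \<in> Sset"
  hence t2: "1/2 \<le> t" "t \<le> 2/3" by (auto simp: Sset_def)
  show "t \<in> msupport (dlam p)" unfolding msupport_def
  proof (intro CollectI allI impI)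
    fix e :: real assume e: "e > 0"
    obtain a where a: "t - e < a" "a < t + e" "1/2 \<le> a" "a \<le> 2/3" "lam a p \<noteq> lam t p"
      using lam_not_constant_at_Sset[OF t _ _ assms, of "t - e" "t + e"] e by auto
    have "0 < clamp_lam p (max a t) - clamp_lam p (min a t)"
      using a t2 lam_mono[of a t p] lam_mono[of t a p] assms by (cases "a \<le> t") (auto simp: clamp_lam_eq max_def min_def)
    hence "0 < emeasure (dlam p) {min a t..max a t}"
      using emeasure_dlam_Icc[OF assms, of "min a t" "max a t"] by simp
    also have "\<dots> \<le> emeasure (dlam p) (ball t e)"
      using a e by (intro emeasure_mono) (auto simp: dist_real_def)
    finally show "0 < emeasure (dlam p) (ball t e)" .
  qed
qed

section \<open>The quasi-stationary distribution\<close>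

locale ar_chain =
  fixes a p :: real
  assumes a_gt: "1/2 < a" and a_le: "a \<le> 2/3" and p_pos: "0 < p" and p_less: "p < 1"
begin

definition m :: real where "m = mu a p"
definition r :: real where "r = odds p"
definition M :: real where "M = 1/(1-a)"
definition H :: "real \<Rightarrow> real" where "H = tail_fun m r a"
text \<open>Clamping at 0 extends the distribution function to the whole line;
  \<open>H 0 = 1\<close> makes it vanish on the negative axis.\<close>

definition F :: "real \<Rightarrow> real" where "F y = 1 - H (max 0 y)"
definition qsd :: "real measure" where "qsd = interval_measure F"

lemma a_pos: "0 < a" and a_ge: "1/2 \<le> a" using a_gt by auto

lemma r_pos: "0 < r" using p_pos p_less by (simp add: r_def)

lemma m_props: "0 < m" "m < 1" "subunit m r a" "H 0 = 1"
  using char_root[of a p] mu_less_1[of a p] a_gt a_le p_pos p_less by (auto simp: m_def r_def H_def)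

lemma M_props: "2 \<le> M" "M \<le> 3" "M \<le> 2/a" "a * M = M - 1"
  using M_bounds[OF a_ge a_le] by (auto simp: M_def)

lemma lam_m: "lam a p = p / m" "0 < lam a p"
  using lam_eq[of a p] char_root(2)[of a p] a_ge a_le p_pos p_less by (auto simp: m_def)

section \<open>Functional equation and continuity of the tail function\<close>

lemma H_step: "0 \<le> y \<Longrightarrow> H y = m * (if y < 1 then 1 + r * H (Ta a y) else H (Ta a y))"
  unfolding H_def using m_props r_pos a_pos by (intro tail_fun_step[where b = a]) auto

lemma H_split: "0 \<le> y \<Longrightarrow> H y = orbit_sum m r a n y + orbit_weight m r a y n * H ((Ta a ^^ n) y)"
  unfolding H_def using m_props r_pos a_pos by (intro tail_fun_split[where b = a]) auto

lemma H_antimono: "0 \<le> y \<Longrightarrow> y \<le> x \<Longrightarrow> H x \<le> H y"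
  unfolding H_def using m_props r_pos a_pos by (intro tail_fun_antimono) auto

lemma H_bounds: "0 \<le> y \<Longrightarrow> 0 \<le> H y" "0 \<le> y \<Longrightarrow> H y \<le> 1"
  unfolding H_def using m_props r_pos a_pos
  by (auto intro!: tail_fun_nonneg[where b = a] tail_fun_le_1[where b = a])

lemma H_eq_0: "M \<le> y \<Longrightarrow> H y = 0"
  unfolding H_def M_def using a_ge a_le by (rule tail_fun_eq_0)

lemma H_eq_orbit_sum: "M \<le> (Ta a ^^ N) y \<Longrightarrow> H y = orbit_sum m r a N y"
  unfolding H_def M_def using a_ge a_le by (rule tail_fun_eq_orbit_sum)

lemma H_pos: "0 \<le> y \<Longrightarrow> y < M \<Longrightarrow> 0 < H y"
  unfolding H_def M_def using m_props r_pos a_ge a_le by (intro tail_fun_pos[where b = a]) auto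

lemma H_1: "H 1 = m"
  using H_step[of 1] m_props by (simp add: Ta_def)

lemma weight_pos: "0 < orbit_weight m r a y n"
  using m_props r_pos by (intro orbit_weight_pos)

lemma weight_small:
  assumes "0 \<le> y" "0 < e"
  obtains N where "orbit_weight m r a y N < e"
proof -
  have "orbit_weight m r a y \<longlonglongrightarrow> 0"
    using m_props r_pos a_pos assms orbit_sum_le_1[of a a m r y] by (intro orbit_weight_tendsto_0) auto
  from eventually_happens'[OF sequentially_bot order_tendstoD(2)[OF this assms(2)]] show ?thesis
    using that by blast
qed

lemma same_code_close:
  assumes "0 \<le> x" "0 \<le> y" "\<And>j. j < N \<Longrightarrow> delta a x j = delta a y j"
  shows "\<bar>H x - H y\<bar> \<le> orbit_weight m r a y N"
proof -
  have nn: "0 \<le> (Ta a ^^ N) x" "0 \<le> (Ta a ^^ N) y" using assms a_pos by (auto intro: Ta_iter_nonneg)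
  have "H x - H y = orbit_weight m r a y N * (H ((Ta a ^^ N) x) - H ((Ta a ^^ N) y))"
    using H_split[OF assms(1), of N] H_split[OF assms(2), of N] orbit_cong[of N a x a y N m r] assms(3)
    by (simp add: algebra_simps)
  moreover have "\<bar>H ((Ta a ^^ N) x) - H ((Ta a ^^ N) y)\<bar> \<le> 1"
    using H_bounds[OF nn(1)] H_bounds[OF nn(2)] by linarith
  ultimately show ?thesis using weight_pos[of y N] by (simp add: abs_mult mult_left_le)
qed

lemma H_right_continuous:
  assumes "0 \<le> y" "0 < e"
  shows "\<exists>d>0. \<forall>x. y \<le> x \<longrightarrow> x < y + d \<longrightarrow> \<bar>H x - H y\<bar> < e"
proof -
  obtain N where N: "orbit_weight m r a y N < e" using weight_small[OF assms] .
  obtain d where d: "d > 0" "\<And>b x. 0 < b \<Longrightarrow> b \<le> a \<Longrightarrow> a - d < b \<Longrightarrow> y \<le> x \<Longrightarrow> x < y + d \<Longrightarrow>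
     (\<forall>j<N. delta b x j = delta a y j)"
    using orbit_near_above[OF a_pos assms(1) zero_less_one, of N] by metis
  show ?thesis
  proof (intro exI[of _ d] conjI allI impI)
    fix x assume x: "y \<le> x" "x < y + d"
    have "\<forall>j<N. delta a x j = delta a y j" using d(2)[of a x] d(1) x a_pos by simp
    hence "\<bar>H x - H y\<bar> \<le> orbit_weight m r a y N" using assms x by (intro same_code_close) auto
    thus "\<bar>H x - H y\<bar> < e" using N by linarith
  qed (rule d)
qed

lemma near_same_code:
  assumes "\<And>j. j < N \<Longrightarrow> (Ta a ^^ j) y \<noteq> 1" "0 < e"
  obtains d where "d > 0" "\<And>x j. \<bar>x - y\<bar> < d \<Longrightarrow> j < N \<Longrightarrow> delta a x j = delta a y j"
    "\<And>x. \<bar>x - y\<bar> < d \<Longrightarrow> \<bar>(Ta a ^^ N) x - (Ta a ^^ N) y\<bar> < e"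
proof -
  obtain d where d: "d > 0" "\<And>b x. \<bar>b - a\<bar> < d \<Longrightarrow> \<bar>x - y\<bar> < d \<Longrightarrow>
     (\<forall>j<N. delta b x j = delta a y j) \<and> \<bar>(Ta b ^^ N) x - (Ta a ^^ N) y\<bar> < e"
    using orbit_near[OF a_pos assms(2), of N y, OF assms(1)] by metis
  have "\<bar>a - a\<bar> < d" using d(1) by simp
  note d2 = d(2)[OF this]
  show ?thesis by (rule that[of d]) (use d(1) d2 in blast)+
qed

lemma H_left_avoiding_1:
  assumes "0 \<le> y" "0 < e" "\<And>j. (Ta a ^^ j) y \<noteq> 1"
  shows "\<exists>d>0. \<forall>x. 0 \<le> x \<longrightarrow> y - d < x \<longrightarrow> x \<le> y \<longrightarrow> \<bar>H x - H y\<bar> < e"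
proof -
  obtain N where N: "orbit_weight m r a y N < e" using weight_small[OF assms(1,2)] .
  obtain d where d: "d > 0" "\<And>x j. \<bar>x - y\<bar> < d \<Longrightarrow> j < N \<Longrightarrow> delta a x j = delta a y j"
    using near_same_code[of N y 1] assms(3) zero_less_one by metis
  show ?thesis
  proof (intro exI[of _ d] conjI allI impI)
    fix x assume x: "0 \<le> x" "y - d < x" "x \<le> y"
    have "\<bar>H x - H y\<bar> \<le> orbit_weight m r a y N"
      using x d(2)[of x] assms(1) by (intro same_code_close) auto
    thus "\<bar>H x - H y\<bar> < e" using N by linarith
  qed (rule d)
qed

text \<open>Left of 1 the functional equation reads
  \<open>H x = H 1 + m * r * H ((x + 1) / a)\<close>, with an argument approaching
  \<open>2/a \<ge> M\<close>. Left continuity of \<open>H\<close> at \<open>M\<close> itself is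
  available since the orbit of \<open>M\<close> stays away from 1.\<close>

lemma H_left_continuous_1:
  assumes "0 < e"
  shows "\<exists>d>0. \<forall>x. 0 \<le> x \<longrightarrow> 1 - d < x \<longrightarrow> x \<le> 1 \<longrightarrow> \<bar>H x - H 1\<bar> < e"
proof -
  have e': "0 < e / (m * r)" using assms m_props r_pos by simp
  have "(Ta a ^^ j) M \<noteq> 1" for j
    using Ta_iter_ge_M[OF a_ge a_le, of M j] M_props by (simp add: M_def)
  then obtain d where d: "d > 0" "\<And>x. 0 \<le> x \<Longrightarrow> M - d < x \<Longrightarrow> x \<le> M \<Longrightarrow> \<bar>H x - H M\<bar> < e / (m * r)"
    using H_left_avoiding_1[of M, OF _ e'] M_props by (metis order_trans zero_le_numeral)
  show ?thesis
  proof (intro exI[of _ "a * d"] conjI allI impI)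
    fix x assume x: "0 \<le> x" "1 - a * d < x" "x \<le> 1"
    show "\<bar>H x - H 1\<bar> < e"
    proof (cases "x = 1")
      case False
      hence x1: "x < 1" using x by simp
      define z where "z = (x + 1) / a"
      have "z > (2 - a * d) / a" unfolding z_def using x a_pos by (intro divide_strict_right_mono) auto
      also have "(2 - a * d) / a = 2/a - d" using a_pos by (simp add: diff_divide_distrib)
      finally have z: "M - d < z" using M_props by linarith
      have z0: "0 \<le> z" using x a_pos by (simp add: z_def)
      have "H z < e / (m * r)"
      proof (cases "z \<le> M")
        case True
        thus ?thesis using d(2)[OF z0 z True] H_eq_0[of M] by simp
      qed (use H_eq_0[of z] e' in auto)
      moreover have "H x - H 1 = (m * r) * H z"
        using H_step[OF x(1)] x1 H_1 by (simp add: Ta_def z_def algebra_simps)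
      ultimately show ?thesis using H_bounds(1)[OF z0] m_props r_pos by (simp add: field_simps)
    qed (use assms in auto)
  qed (use a_pos d in simp)
qed

text \<open>Points slightly left of \<open>y\<close> share its letters up to the first hit of 1 and
  arrive there at or below 1, so continuity at 1 is carried back through the positive
  weight.\<close>

lemma H_left_continuous:
  assumes "0 \<le> y" "0 < e"
  shows "\<exists>d>0. \<forall>x. 0 \<le> x \<longrightarrow> y - d < x \<longrightarrow> x \<le> y \<longrightarrow> \<bar>H x - H y\<bar> < e"
proof (cases "\<exists>j. (Ta a ^^ j) y = 1")
  case False
  thus ?thesis using H_left_avoiding_1[OF assms] by blast
next
  case True
  then obtain k where k: "(Ta a ^^ k) y = 1" "\<And>j. j < k \<Longrightarrow> (Ta a ^^ j) y \<noteq> 1"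
    using exists_least_iff[of "\<lambda>j. (Ta a ^^ j) y = 1"] by auto
  define w where "w = orbit_weight m r a y k"
  have w: "w > 0" using weight_pos by (simp add: w_def)
  have ew: "0 < e / w" using w assms by simp
  obtain d1 where d1: "d1 > 0" "\<And>x. 0 \<le> x \<Longrightarrow> 1 - d1 < x \<Longrightarrow> x \<le> 1 \<Longrightarrow> \<bar>H x - H 1\<bar> < e / w"
    using H_left_continuous_1[OF ew] by metis
  obtain d where d: "d > 0" "\<And>x j. \<bar>x - y\<bar> < d \<Longrightarrow> j < k \<Longrightarrow> delta a x j = delta a y j"
    "\<And>x. \<bar>x - y\<bar> < d \<Longrightarrow> \<bar>(Ta a ^^ k) x - (Ta a ^^ k) y\<bar> < d1"
    using near_same_code[OF k(2) d1(1)] by metis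
  show ?thesis
  proof (intro exI[of _ d] conjI allI impI)
    fix x assume x: "0 \<le> x" "y - d < x" "x \<le> y"
    have xy: "\<bar>x - y\<bar> < d" using x by simp
    have code: "delta a x j = delta a y j" if "j < k" for j using d(2)[OF xy that] .
    have z: "0 \<le> (Ta a ^^ k) x" "1 - d1 < (Ta a ^^ k) x" "(Ta a ^^ k) x \<le> 1"
      using Ta_iter_nonneg[OF a_pos x(1)] d(3)[OF xy] k(1)
        orbit_mono[of a a x y k] a_pos x code by (auto simp: abs_less_iff)
    have "H x - H y = w * (H ((Ta a ^^ k) x) - H 1)"
      using H_split[OF x(1), of k] H_split[OF assms(1), of k] orbit_cong[of k a x a y k m r] code k(1)
      by (simp add: algebra_simps w_def)
    hence "\<bar>H x - H y\<bar> = \<bar>H ((Ta a ^^ k) x) - H 1\<bar> * w" using w by (simp add: abs_mult)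
    also have "\<dots> < e" using d1(2)[OF z] w by (simp only: pos_less_divide_eq)
    finally show "\<bar>H x - H y\<bar> < e" .
  qed (rule d)
qed

lemma continuous_H: "continuous_on {0..} H"
  unfolding continuous_on_iff
proof (intro ballI allI impI)
  fix y e :: real assume y: "y \<in> {0..}" and e: "0 < e"
  hence y0: "0 \<le> y" by simp
  obtain d1 where d1: "d1 > 0" "\<And>x. y \<le> x \<Longrightarrow> x < y + d1 \<Longrightarrow> \<bar>H x - H y\<bar> < e"
    using H_right_continuous[OF y0 e] by metis
  obtain d2 where d2: "d2 > 0" "\<And>x. 0 \<le> x \<Longrightarrow> y - d2 < x \<Longrightarrow> x \<le> y \<Longrightarrow> \<bar>H x - H y\<bar> < e"
    using H_left_continuous[OF y0 e] by metis
  show "\<exists>d>0. \<forall>x\<in>{0..}. dist x y < d \<longrightarrow> dist (H x) (H y) < e"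
  proof (intro exI[of _ "min d1 d2"] conjI ballI impI)
    fix x assume x: "x \<in> {0..}" "dist x y < min d1 d2"
    show "dist (H x) (H y) < e"
      using d1(2)[of x] d2(2)[of x] x by (cases "x \<le> y") (auto simp: dist_real_def)
  qed (use d1 d2 in simp)
qed

section \<open>The limit law and its one-step transition\<close>

lemma continuous_F: "continuous_on UNIV F"
  unfolding F_def
  by (intro continuous_intros continuous_on_compose2[OF continuous_H]) auto

lemma F_mono: "x \<le> y \<Longrightarrow> F x \<le> F y"
  unfolding F_def using H_antimono[of "max 0 x" "max 0 y"] by simp

lemma F_eq_0: "y \<le> 0 \<Longrightarrow> F y = 0"
  using m_props by (simp add: F_def max_def)

lemma F_eq_1: "M \<le> y \<Longrightarrow> F y = 1"
  using H_eq_0[of "max 0 y"] by (simp add: F_def)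

lemma F_right: "continuous (at_right y) F"
  using continuous_F by (simp add: continuous_on_eq_continuous_at continuous_at_imp_continuous_within)

lemma F_at_bot: "(F \<longlongrightarrow> 0) at_bot"
  by (rule tendsto_eventually, rule eventually_mono[OF eventually_le_at_bot[of 0]]) (rule F_eq_0)

lemma F_at_top: "(F \<longlongrightarrow> 1) at_top"
  by (rule tendsto_eventually, rule eventually_mono[OF eventually_ge_at_top[of M]]) (rule F_eq_1)

sublocale qsd: real_distribution qsd
  unfolding qsd_def by (rule real_distribution_interval_measure[OF F_mono F_right F_at_bot F_at_top])

lemma emeasure_qsd_Icc: "x \<le> y \<Longrightarrow> emeasure qsd {x..y} = ennreal (F y - F x)"
  unfolding qsd_def by (rule emeasure_interval_measure_Icc[OF _ F_mono continuous_F])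

lemma measure_qsd_Icc: "x \<le> y \<Longrightarrow> measure qsd {x..y} = F y - F x"
  using emeasure_qsd_Icc[of x y] F_mono[of x y] by (simp add: measure_def)

lemma measure_qsd_atMost: "measure qsd {..y} = F y"
  using cdf_interval_measure[OF F_mono F_right F_at_bot] by (simp add: qsd_def cdf_def fun_eq_iff)

lemma measure_qsd_singleton: "measure qsd {t} = 0"
  using measure_qsd_Icc[of t t] by simp

lemma AE_qsd_state_space: "AE x in qsd. x \<in> {0..M}"
proof -
  show ?thesis
    using qsd.prob_eq_1[of "{0..M}"] measure_qsd_Icc[of 0 M] F_eq_0[of 0] F_eq_1[of M] M_props by simp
qed

lemma measure_qsd_cong:
  assumes "A \<in> sets borel" "B \<in> sets borel" "A \<inter> {0..M} = B \<inter> {0..M}"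
  shows "measure qsd A = measure qsd B"
proof (rule qsd.finite_measure_eq_AE)
  show "AE x in qsd. x \<in> A \<longleftrightarrow> x \<in> B" using AE_qsd_state_space by eventually_elim (use assms in blast)
qed (use assms in auto)

lemma measure_qsd_Ioi: "0 \<le> y \<Longrightarrow> measure qsd {y<..} = H y"
proof -
  assume y: "0 \<le> y"
  have "measure qsd {y<..} = measure qsd (UNIV - {..y})" by (rule arg_cong[of _ _ "measure qsd"]) auto
  also have "\<dots> = 1 - F y" using qsd.prob_compl[of "{..y}"] measure_qsd_atMost[of y] by simp
  finally show ?thesis using y by (simp add: F_def)
qed

text \<open>The mass that one step of the chain started from \<open>qsd\<close> carries into
  \<open>A\<close>. Killing is implicit: the sets considered lie in \<open>{0..M}\<close>, so
  negative landing points are not counted.\<close>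

definition next_mass :: "real set \<Rightarrow> real" where
  "next_mass A = p * measure qsd {x. a * x + 1 \<in> A} + (1 - p) * measure qsd {x. a * x - 1 \<in> A}"

lemma preimage_sets [measurable]:
  assumes "A \<in> sets borel"
  shows "{x. a * x + 1 \<in> A} \<in> sets borel" "{x. a * x - 1 \<in> A} \<in> sets borel"
proof -
  have "(\<lambda>x. a * x + c) -` A \<inter> space borel \<in> sets borel" for c :: real
    using assms by (intro measurable_sets) auto
  from this[of 1] this[of "-1"] show "{x. a * x + 1 \<in> A} \<in> sets borel" "{x. a * x - 1 \<in> A} \<in> sets borel"
    by (simp_all add: vimage_def)
qed

text \<open>For \<open>y \<ge> 0\<close> this is the functional equation of \<open>H\<close>
  multiplied by \<open>lam a p\<close>. For \<open>y < 0\<close> the ray covers the state space and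
  the claim is the characteristic equation \<open>lam a p = p + (1 - p) * H (1/a)\<close>.\<close>

lemma next_mass_tail:
  "next_mass ({y<..} \<inter> {0..M}) = lam a p * measure qsd ({y<..} \<inter> {0..M})"
proof -
  have lam: "lam a p * (m * c) = p * c" for c using lam_m m_props by simp
  have pr: "p * r = 1 - p" using p_pos by (simp add: r_def)
  consider "y < 0" | "0 \<le> y" "y < 1" | "1 \<le> y" by linarith
  thus ?thesis
  proof cases
    case 1
    have "measure qsd {x. a * x + 1 \<in> {y<..} \<inter> {0..M}} = measure qsd UNIV"
    proof (rule measure_qsd_cong)
      have "0 \<le> a * x + 1 \<and> a * x + 1 \<le> M" if "0 \<le> x" "x \<le> M" for x
        using that a_pos mult_left_mono[of x M a] M_props by simp
      thus "{x. a * x + 1 \<in> {y<..} \<inter> {0..M}} \<inter> {0..M} = UNIV \<inter> {0..M}" using 1 by fastforce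
    qed auto
    moreover have "measure qsd {x. a * x - 1 \<in> {y<..} \<inter> {0..M}} = measure qsd {1/a..}"
    proof (rule measure_qsd_cong)
      have "x \<in> {x. a * x - 1 \<in> {y<..} \<inter> {0..M}} \<inter> {0..M} \<longleftrightarrow> x \<in> {1/a..} \<inter> {0..M}" for x
      proof -
        have h1: "a * x - 1 \<le> M" if "x \<le> M" using that a_pos mult_left_mono[of x M a] M_props by simp
        have h2: "1/a \<le> x \<longleftrightarrow> 0 \<le> a * x - 1" using a_pos by (simp add: field_simps)
        show ?thesis unfolding Int_iff mem_Collect_eq atLeast_iff h2 using 1 h1 by auto
      qed
      thus "{x. a * x - 1 \<in> {y<..} \<inter> {0..M}} \<inter> {0..M} = {1/a..} \<inter> {0..M}" by blast
    qed auto
    moreover have "measure qsd {1/a..} = H (1/a)"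
    proof -
      have "{1/a..} = {1/a} \<union> {1/a<..}" by auto
      hence "measure qsd {1/a..} = measure qsd {1/a} + measure qsd {1/a<..}"
        by (simp only:) (rule qsd.finite_measure_Union, auto)
      thus ?thesis using measure_qsd_singleton measure_qsd_Ioi[of "1/a"] a_pos by simp
    qed
    moreover have "measure qsd ({y<..} \<inter> {0..M}) = measure qsd UNIV"
      using 1 by (intro measure_qsd_cong) auto
    moreover have "lam a p * 1 = p + (1 - p) * H (1/a)"
    proof -
      have "1 = m * (1 + r * H (1/a))" using H_step[of 0] m_props by (simp add: Ta_def)
      hence "lam a p * 1 = p * (1 + r * H (1/a))" using lam[of "1 + r * H (1/a)"] by simp
      also have "\<dots> = p + (p * r) * H (1/a)" by (simp add: algebra_simps)
      finally show ?thesis using pr by simp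
    qed
    ultimately show ?thesis using qsd.prob_space by (simp add: next_mass_def)
  next
    case 2
    have "measure qsd {x. a * x + 1 \<in> {y<..} \<inter> {0..M}} = measure qsd UNIV"
    proof (rule measure_qsd_cong)
      have "y < a * x + 1 \<and> a * x + 1 \<le> M" if "0 \<le> x" "x \<le> M" for x
        using that a_pos mult_left_mono[of x M a] M_props 2 by (simp add: add_nonneg_pos less_le_trans)
      thus "{x. a * x + 1 \<in> {y<..} \<inter> {0..M}} \<inter> {0..M} = UNIV \<inter> {0..M}" using 2 by fastforce
    qed auto
    moreover have "measure qsd {x. a * x - 1 \<in> {y<..} \<inter> {0..M}} = measure qsd {Ta a y<..}"
    proof (rule measure_qsd_cong)
      have "x \<in> {x. a * x - 1 \<in> {y<..} \<inter> {0..M}} \<inter> {0..M} \<longleftrightarrow> x \<in> {Ta a y<..} \<inter> {0..M}" for x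
      proof -
        have h1: "a * x - 1 \<le> M" if "x \<le> M" using that a_pos mult_left_mono[of x M a] M_props by simp
        have h2: "Ta a y < x \<longleftrightarrow> y < a * x - 1" using a_pos 2 by (simp add: Ta_def field_simps)
        show ?thesis unfolding Int_iff mem_Collect_eq greaterThan_iff h2 using 2 h1 by auto
      qed
      thus "{x. a * x - 1 \<in> {y<..} \<inter> {0..M}} \<inter> {0..M} = {Ta a y<..} \<inter> {0..M}" by blast
    qed auto
    moreover have "measure qsd ({y<..} \<inter> {0..M}) = measure qsd {y<..}"
      by (intro measure_qsd_cong) auto
    moreover have "lam a p * H y = p + (1 - p) * H (Ta a y)"
    proof -
      have "lam a p * H y = p * (1 + r * H (Ta a y))" using H_step[of y] lam[of "1 + r * H (Ta a y)"] 2 by simp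
      also have "\<dots> = p + (p * r) * H (Ta a y)" by (simp add: algebra_simps)
      finally show ?thesis using pr by simp
    qed
    ultimately show ?thesis using qsd.prob_space measure_qsd_Ioi[of y] measure_qsd_Ioi[of "Ta a y"]
        Ta_nonneg[OF a_pos, of y] 2 by (simp add: next_mass_def)
  next
    case 3
    have "measure qsd {x. a * x + 1 \<in> {y<..} \<inter> {0..M}} = measure qsd {Ta a y<..}"
    proof (rule measure_qsd_cong)
      have "x \<in> {x. a * x + 1 \<in> {y<..} \<inter> {0..M}} \<inter> {0..M} \<longleftrightarrow> x \<in> {Ta a y<..} \<inter> {0..M}" for x
      proof -
        have h1: "a * x + 1 \<le> M" if "x \<le> M" using that a_pos mult_left_mono[of x M a] M_props by simp
        have h2: "Ta a y < x \<longleftrightarrow> y < a * x + 1" using a_pos 3 by (simp add: Ta_def field_simps)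
        show ?thesis unfolding Int_iff mem_Collect_eq greaterThan_iff h2 using 3 h1 by auto
      qed
      thus "{x. a * x + 1 \<in> {y<..} \<inter> {0..M}} \<inter> {0..M} = {Ta a y<..} \<inter> {0..M}" by blast
    qed auto
    moreover have "measure qsd {x. a * x - 1 \<in> {y<..} \<inter> {0..M}} = measure qsd {}"
    proof (rule measure_qsd_cong)
      have "a * x - 1 \<le> 1" if "x \<le> M" for x
        using that a_pos mult_left_mono[of x M a] M_props by simp
      thus "{x. a * x - 1 \<in> {y<..} \<inter> {0..M}} \<inter> {0..M} = {} \<inter> {0..M}" using 3 by fastforce
    qed auto
    moreover have "measure qsd ({y<..} \<inter> {0..M}) = measure qsd {y<..}"
      by (intro measure_qsd_cong) auto
    moreover have "lam a p * H y = p * H (Ta a y)"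
      using H_step[of y] lam[of "H (Ta a y)"] 3 by simp
    ultimately show ?thesis using measure_qsd_Ioi[of y] measure_qsd_Ioi[of "Ta a y"]
        Ta_nonneg[OF a_pos, of y] 3 by (simp add: next_mass_def)
  qed
qed

lemma next_mass_eq:
  assumes "A \<in> sets borel"
  shows "next_mass (A \<inter> {0..M}) = lam a p * measure qsd (A \<inter> {0..M})"
proof -
  let ?G = "range (\<lambda>y::real. {y<..})"
  have borel: "sets borel = sigma_sets UNIV ?G"
    by (subst borel_Ioi) (simp add: sets_measure_of)
  have "A \<in> sigma_sets UNIV ?G" using assms borel by simp
  moreover have "Int_stable ?G"
  proof (rule Int_stableI)
    fix S T assume "S \<in> ?G" "T \<in> ?G"
    then obtain x y where "S = {x<..}" "T = {y<..}" by auto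
    hence "S \<inter> T = {max x y<..}" by auto
    thus "S \<inter> T \<in> ?G" by blast
  qed
  moreover have "?G \<subseteq> Pow UNIV" by simp
  ultimately have "Int_stable ?G" "?G \<subseteq> Pow UNIV" "A \<in> sigma_sets UNIV ?G" by blast+
  thus ?thesis
  proof (induction rule: sigma_sets_induct_disjoint)
    case (basic A)
    thus ?case using next_mass_tail by auto
  next
    case empty
    thus ?case by (simp add: next_mass_def)
  next
    case (compl A)
    have A: "A \<in> sets borel" using compl borel by simp
    \<comment> \<open>The ray \<open>{-1<..}\<close> contains the state space, so the tail case
      already proved supplies the total mass for complements.\<close>
    have diff: "measure qsd ({x. f x \<in> (UNIV - A) \<inter> {0..M}})
       = measure qsd {x. f x \<in> {-1<..} \<inter> {0..M}} - measure qsd {x. f x \<in> A \<inter> {0..M}}"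
      if "\<And>B. B \<in> sets borel \<Longrightarrow> {x. f x \<in> B} \<in> sets borel" for f :: "real \<Rightarrow> real"
    proof -
      have "{x. f x \<in> (UNIV - A) \<inter> {0..M}} = {x. f x \<in> {-1<..} \<inter> {0..M}} - {x. f x \<in> A \<inter> {0..M}}" by auto
      moreover have "{x. f x \<in> {-1<..} \<inter> {0..M}} \<in> sets qsd" "{x. f x \<in> A \<inter> {0..M}} \<in> sets qsd"
        unfolding qsd.events_eq_borel using A by (auto intro!: that simp del: Int_iff)
      moreover have "{x. f x \<in> A \<inter> {0..M}} \<subseteq> {x. f x \<in> {-1<..} \<inter> {0..M}}" by auto
      ultimately show ?thesis by (simp only: qsd.finite_measure_Diff)
    qed
    have "next_mass ((UNIV - A) \<inter> {0..M}) = next_mass ({-1<..} \<inter> {0..M}) - next_mass (A \<inter> {0..M})"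
    proof -
      have e: "measure qsd {x. a * x + 1 \<in> (UNIV - A) \<inter> {0..M}}
           = measure qsd {x. a * x + 1 \<in> {-1<..} \<inter> {0..M}} - measure qsd {x. a * x + 1 \<in> A \<inter> {0..M}}"
        "measure qsd {x. a * x - 1 \<in> (UNIV - A) \<inter> {0..M}}
           = measure qsd {x. a * x - 1 \<in> {-1<..} \<inter> {0..M}} - measure qsd {x. a * x - 1 \<in> A \<inter> {0..M}}"
        by (rule diff, erule preimage_sets)+
      show ?thesis unfolding next_mass_def e right_diff_distrib by linarith
    qed
    also have "\<dots> = lam a p * (measure qsd ({-1<..} \<inter> {0..M}) - measure qsd (A \<inter> {0..M}))"
      unfolding next_mass_tail compl.IH right_diff_distrib ..
    also have "measure qsd ({-1<..} \<inter> {0..M}) - measure qsd (A \<inter> {0..M}) = measure qsd ((UNIV - A) \<inter> {0..M})"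
      using diff[of "\<lambda>x. x"] by (simp only: Collect_mem_eq)
    finally show ?case .
  next
    case (union A)
    have A: "A i \<in> sets borel" for i using union.hyps borel by auto
    have sums: "(\<lambda>i. measure qsd {x. f x \<in> A i \<inter> {0..M}}) sums measure qsd {x. f x \<in> (\<Union>i. A i) \<inter> {0..M}}"
      if "\<And>B. B \<in> sets borel \<Longrightarrow> {x. f x \<in> B} \<in> sets borel" for f :: "real \<Rightarrow> real"
    proof -
      have "{x. f x \<in> (\<Union>i. A i) \<inter> {0..M}} = (\<Union>i. {x. f x \<in> A i \<inter> {0..M}})" by auto
      moreover have "disjoint_family (\<lambda>i. {x. f x \<in> A i \<inter> {0..M}})"
        using union.hyps by (auto simp: disjoint_family_on_def)
      moreover have "range (\<lambda>i. {x. f x \<in> A i \<inter> {0..M}}) \<subseteq> sets qsd"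
        unfolding qsd.events_eq_borel using A by (auto intro!: that simp del: Int_iff)
      ultimately show ?thesis by (simp only: qsd.finite_measure_UNION)
    qed
    have "(\<lambda>i. next_mass (A i \<inter> {0..M})) sums next_mass ((\<Union>i. A i) \<inter> {0..M})"
      unfolding next_mass_def by (intro sums_add sums_mult sums preimage_sets)
    moreover have "(\<lambda>i. next_mass (A i \<inter> {0..M})) sums (lam a p * measure qsd ((\<Union>i. A i) \<inter> {0..M}))"
      unfolding union.IH using sums_mult[OF sums[of "\<lambda>x. x"]] by (simp only: Collect_mem_eq)
    ultimately show ?case by (rule sums_unique2)
  qed
qed

lemma integral_one_step:
  assumes A: "A \<in> sets borel" "A \<subseteq> {0..M}"
  shows "(\<integral>x. surv a p 1 A x \<partial>qsd) = lam a p * measure qsd A"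
proof -
  have "(\<integral>x. surv a p 1 A x \<partial>qsd)
     = (\<integral>x. p * indicator {x. a * x + 1 \<in> A} x + (1 - p) * indicator {x. a * x - 1 \<in> A} x \<partial>qsd)"
  proof (rule integral_cong_AE)
    show "AE x in qsd. surv a p 1 A x = p * indicator {x. a * x + 1 \<in> A} x + (1 - p) * indicator {x. a * x - 1 \<in> A} x"
      using AE_qsd_state_space
    proof eventually_elim
      case (elim x)
      thus ?case using A(2) unfolding One_nat_def surv_Suc surv_0 by (auto simp: indicator_def)
    qed
    have "surv a p 1 A = (\<lambda>x. indicator {0..} x * (p * indicator ({x. a * x + 1 \<in> A}) x
        + (1 - p) * indicator {x. a * x - 1 \<in> A} x))"
      using A(2) unfolding One_nat_def by (intro ext) (auto simp: surv_Suc surv_0 indicator_def)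
    thus "surv a p 1 A \<in> borel_measurable qsd" using preimage_sets[OF A(1)] by simp
    show "(\<lambda>x. p * indicator {x. a * x + 1 \<in> A} x + (1 - p) * indicator {x. a * x - 1 \<in> A} x) \<in> borel_measurable qsd"
      using preimage_sets[OF A(1)] by simp
  qed
  also have "\<dots> = next_mass A" unfolding next_mass_def
    using preimage_sets[OF A(1)]
    by (subst Bochner_Integration.integral_add) (auto simp: qsd.emeasure_eq_measure)
  also have "\<dots> = lam a p * measure qsd A" using next_mass_eq[OF A(1)] A(2) by (simp add: Int_absorb2)
  finally show ?thesis .
qed

lemma quasi_stationary:
  assumes A: "A \<in> sets borel" "A \<subseteq> {0..M}"
  shows "(\<integral>x. Px a p x 1 (\<lambda>xs. survives a x xs \<and> chain a x xs \<in> A) \<partial>qsd)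
     / (\<integral>x. Px a p x 1 (survives a x) \<partial>qsd) = measure qsd A"
proof -
  have K: "measure qsd {0..M} = 1"
    using measure_qsd_Icc[of 0 M] F_eq_0[of 0] F_eq_1[of M] M_props by simp
  have "(\<integral>x. surv a p 1 UNIV x \<partial>qsd) = (\<integral>x. surv a p 1 {0..M} x \<partial>qsd)"
  proof (rule integral_cong_AE)
    show "AE x in qsd. surv a p 1 UNIV x = surv a p 1 {0..M} x"
      using AE_qsd_state_space
    proof eventually_elim
      case (elim x)
      hence "a * x \<le> a * M" using a_pos by (intro mult_left_mono) auto
      thus ?case unfolding One_nat_def surv_Suc surv_0 using M_props by auto
    qed
    have "surv a p 1 B = (\<lambda>x. indicator {0..} x * (p * indicator ({x. a * x + 1 \<in> B \<inter> {0..}}) x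
        + (1 - p) * indicator {x. a * x - 1 \<in> B \<inter> {0..}} x))" for B
      unfolding One_nat_def by (intro ext) (auto simp: surv_Suc surv_0 indicator_def)
    hence "surv a p 1 B \<in> borel_measurable borel" if "B \<in> sets borel" for B
      using preimage_sets[of "B \<inter> {0..}"] that by simp
    thus "surv a p 1 UNIV \<in> borel_measurable qsd" "surv a p 1 {0..M} \<in> borel_measurable qsd" by simp_all
  qed
  also have "\<dots> = lam a p" using integral_one_step[of "{0..M}"] K by simp
  finally show ?thesis using integral_one_step[OF A] lam_m(2) by (simp add: surv_def)
qed

end

section \<open>Singularity\<close>

text \<open>With total weight \<open>\<sigma> < 1\<close>, boundedness follows by induction, and the
  limsup satisfies \<open>s \<le> \<sigma> * s\<close>.\<close>

lemma defective_renewal: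
  fixes b e Z :: "nat \<Rightarrow> real"
  assumes b: "\<And>k. 0 \<le> b k" "summable b" "suminf b < 1" and e: "\<And>n. 0 \<le> e n" "e \<longlonglongrightarrow> 0"
    and rec: "\<And>n. Z n = (\<Sum>k<n. b k * Z (n - 1 - k)) + e n"
  shows "Z \<longlonglongrightarrow> 0"
proof -
  define \<sigma> where "\<sigma> = suminf b"
  have \<sigma>: "0 \<le> \<sigma>" "\<sigma> < 1" using b suminf_nonneg[of b] by (auto simp: \<sigma>_def)
  have Z0: "0 \<le> Z n" for n
  proof (induction n rule: less_induct)
    case (less n)
    have "0 \<le> b k * Z (n - 1 - k)" if "k < n" for k using less that b(1)[of k] by simp
    thus ?case unfolding rec[of n] using e(1)[of n] by (intro add_nonneg_nonneg sum_nonneg) auto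
  qed
  obtain E where "\<forall>n. norm (e n) \<le> E" using convergent_imp_Bseq[OF convergentI[OF e(2)]] by (rule BseqE)
  hence E: "e n \<le> E" for n by (simp add: abs_le_iff)
  define B where "B = E / (1 - \<sigma>)"
  have EB: "\<sigma> * B + E = B" using \<sigma> by (simp add: B_def field_simps)
  have B0: "0 \<le> B" using E[of 0] e(1)[of 0] \<sigma> by (simp add: B_def)
  have ZB: "Z n \<le> B" for n
  proof (induction n rule: less_induct)
    case (less n)
    have "(\<Sum>k<n. b k * Z (n - 1 - k)) \<le> (\<Sum>k<n. b k * B)"
      using less b by (intro sum_mono mult_left_mono) auto
    also have "\<dots> = (\<Sum>k<n. b k) * B" by (simp add: sum_distrib_right)
    also have "\<dots> \<le> \<sigma> * B" unfolding \<sigma>_def using b B0 by (intro mult_right_mono sum_le_suminf) auto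
    finally show ?case using rec[of n] E[of n] EB by linarith
  qed
  have ZB': "\<bar>Z n\<bar> \<le> B" for n using Z0[of n] ZB[of n] by simp
  obtain s \<phi> where s: "strict_mono \<phi>" "(\<lambda>n. Z (\<phi> n)) \<longlonglongrightarrow> s" "(\<lambda>n. max s (Z n)) \<longlonglongrightarrow> s"
    by (rule bounded_seq_limsup[OF ZB'])
  have \<phi>: "filterlim \<phi> at_top sequentially" using s(1) by (rule filterlim_subseq)
  have s0: "0 \<le> s" using s(2) Z0 by (intro LIMSEQ_le_const[OF s(2)]) auto
  define u where "u n = max s (Z n)" for n
  define \<psi> where "\<psi> n = \<phi> n - 1" for n
  have \<psi>: "filterlim \<psi> at_top sequentially" unfolding \<psi>_def
    using filterlim_compose[OF filterlim_minus_const_nat_at_top \<phi>] .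
  have "(\<lambda>n. \<Sum>k\<le>\<psi> n. b k * u (\<psi> n - k)) \<longlonglongrightarrow> suminf b * s"
  proof (rule convolution_tendsto[OF b(1,2) _ _ \<psi>])
    show "\<bar>u n\<bar> \<le> max s B" for n using ZB'[of n] s0 by (auto simp: u_def)
    show "(\<lambda>n. u (\<psi> n - k)) \<longlonglongrightarrow> s" for k
      using filterlim_compose[OF s(3) filterlim_compose[OF filterlim_minus_const_nat_at_top \<psi>]] by (simp add: u_def)
  qed
  from tendsto_add[OF this filterlim_compose[OF e(2) \<phi>]]
  have "(\<lambda>n. (\<Sum>k\<le>\<psi> n. b k * u (\<psi> n - k)) + e (\<phi> n)) \<longlonglongrightarrow> \<sigma> * s" by (simp add: \<sigma>_def)
  moreover have "eventually (\<lambda>n. Z (\<phi> n) \<le> (\<Sum>k\<le>\<psi> n. b k * u (\<psi> n - k)) + e (\<phi> n)) sequentially"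
  proof -
    have "eventually (\<lambda>n. 1 \<le> \<phi> n) sequentially" using \<phi> by (simp add: filterlim_at_top)
    thus ?thesis
    proof eventually_elim
      case (elim n)
      hence "{..<\<phi> n} = {..\<psi> n}" by (auto simp: \<psi>_def)
      hence "Z (\<phi> n) = (\<Sum>k\<le>\<psi> n. b k * Z (\<psi> n - k)) + e (\<phi> n)" using rec[of "\<phi> n"] by (simp add: \<psi>_def)
      thus ?case using b by (auto simp: u_def intro!: sum_mono mult_left_mono)
    qed
  qed
  ultimately have "s \<le> \<sigma> * s" using tendsto_le[OF sequentially_bot _ s(2)] by blast
  hence "s * (1 - \<sigma>) \<le> 0" by (simp add: algebra_simps)
  hence "s \<le> 0" using \<sigma> by (simp add: mult_le_0_iff)
  hence "s = 0" using s0 by simp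
  thus ?thesis using s(3) Z0 by (simp add: max_absorb2)
qed

lemma measure_affine_preimage:
  fixes a s :: real
  assumes "0 < a" "B \<in> sets borel"
  shows "{x. (x - s) / a \<in> B} \<in> sets borel"
    and "emeasure lborel {x. (x - s) / a \<in> B} = ennreal a * emeasure lborel B"
proof -
  define S where "S = {x. (x - s) / a \<in> B}"
  have "(\<lambda>x. (x - s) / a) -` B \<inter> space borel \<in> sets borel" using assms by (intro measurable_sets) auto
  thus S: "{x. (x - s) / a \<in> B} \<in> sets borel" by (simp add: vimage_def)
  have "emeasure lborel S = emeasure (density (distr lborel borel (\<lambda>x. s + a * x)) (\<lambda>_. ennreal a)) S"
    using lborel_real_affine[of a s] assms(1) by simp
  also have "\<dots> = ennreal a * emeasure (distr lborel borel (\<lambda>x. s + a * x)) S"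
    using S by (subst emeasure_density_const) (auto simp: S_def)
  also have "emeasure (distr lborel borel (\<lambda>x. s + a * x)) S = emeasure lborel ((\<lambda>x. s + a * x) -` S \<inter> space lborel)"
    using S by (subst emeasure_distr) (auto simp: S_def)
  also have "(\<lambda>x. s + a * x) -` S \<inter> space lborel = B" using assms(1) by (auto simp: S_def)
  finally show "emeasure lborel {x. (x - s) / a \<in> B} = ennreal a * emeasure lborel B" by (simp add: S_def)
qed

lemma measure_affine_preimage_bounded:
  fixes a s c d :: real
  assumes "0 < a" "B \<in> sets borel" "B \<subseteq> {c..d}"
  shows "{x. (x - s) / a \<in> B} \<in> fmeasurable lborel"
    and "measure lborel {x. (x - s) / a \<in> B} = a * measure lborel B"
proof -
  have "emeasure lborel B \<le> emeasure lborel {c..d}" using assms by (intro emeasure_mono) auto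
  also have "\<dots> < \<infinity>" by (cases "c \<le> d") auto
  finally have "emeasure lborel B < \<infinity>" .
  thus "{x. (x - s) / a \<in> B} \<in> fmeasurable lborel"
    using measure_affine_preimage[OF assms(1,2), of s] by (auto simp: fmeasurable_def ennreal_mult_less_top)
  show "measure lborel {x. (x - s) / a \<in> B} = a * measure lborel B"
    using measure_affine_preimage(2)[OF assms(1,2), of s] assms(1) by (simp add: measure_def enn2real_mult)
qed

context ar_chain
begin

text \<open>Discarding the endpoint makes downward steps land strictly below 1; for
  \<open>a = 2/3\<close> the step from \<open>M\<close> would end exactly at 1, in the domain of the
  other branch.\<close>

lemma AE_qsd_below_M: "AE x in qsd. x \<in> {0..<M}"
proof -
  have "{0..M} - {M} = {0..<M}" using M_props by auto
  hence "measure qsd {0..<M} = measure qsd {0..M} - measure qsd {M}"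
    using qsd.finite_measure_Diff[of "{0..M}" "{M}"] M_props by simp
  hence "measure qsd {0..<M} = 1"
    using measure_qsd_Icc[of 0 M] F_eq_0[of 0] F_eq_1[of M] M_props measure_qsd_singleton by simp
  thus ?thesis using qsd.prob_eq_1[of "{0..<M}"] by simp
qed

lemma measure_qsd_mono:
  assumes "A \<in> sets borel" "B \<in> sets borel" "A \<inter> {0..<M} \<subseteq> B"
  shows "measure qsd A \<le> measure qsd B"
proof (rule qsd.finite_measure_mono_AE)
  show "AE x in qsd. x \<in> A \<longrightarrow> x \<in> B" using AE_qsd_below_M by eventually_elim (use assms in blast)
qed (use assms in auto)

text \<open>A set assembled from \<open>A\<close> along the lower branch and \<open>B\<close> along
  the upper one, together with the gap. Including the gap costs no \<open>qsd\<close>-mass and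
  leaves no Lebesgue remainder there.\<close>

definition pull :: "real set \<Rightarrow> real set \<Rightarrow> real set" where
  "pull A B = {x. if x < 1 then (x + 1) / a \<in> A \<or> M < (x + 1) / a else (x - 1) / a \<in> B}"

lemma pull_sets:
  assumes "A \<in> sets borel" "B \<in> sets borel"
  shows "pull A B \<in> sets borel"
proof -
  have "pull A B = ({x. (x - (-1)) / a \<in> A \<union> {M<..}} \<inter> {..<1}) \<union> ({x. (x - 1) / a \<in> B} \<inter> {1..})"
    by (auto simp: pull_def split: if_splits)
  moreover have "{x. (x - (-1)) / a \<in> A \<union> {M<..}} \<in> sets borel"
    using assms by (intro measure_affine_preimage(1)[OF a_pos]) auto
  moreover have "{x. (x - 1) / a \<in> B} \<in> sets borel" using assms by (intro measure_affine_preimage(1)[OF a_pos]) auto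
  ultimately show ?thesis by simp
qed

text \<open>By invariance the mass is read off one step earlier: upward steps start in
  \<open>B\<close>, with factor \<open>p / lam a p = m\<close>, and downward steps start in
  \<open>A\<close>, with factor \<open>(1 - p) / lam a p = m * r\<close>. The gap would require a
  start above \<open>M\<close>.\<close>

lemma measure_qsd_pull:
  assumes A: "A \<in> sets borel" and B: "B \<in> sets borel"
  shows "measure qsd (pull A B) \<le> m * measure qsd B + m * r * measure qsd A"
proof -
  let ?S = "pull A B \<inter> {0..M}"
  have S: "?S \<in> sets borel" using pull_sets[OF A B] by simp
  have "lam a p * measure qsd (pull A B) = lam a p * measure qsd ?S"
    using pull_sets[OF A B] by (subst measure_qsd_cong[of "pull A B" ?S]) auto
  also have "\<dots> = next_mass ?S" using next_mass_eq[OF pull_sets[OF A B]] by simp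
  also have "\<dots> \<le> p * measure qsd B + (1 - p) * measure qsd A"
    unfolding next_mass_def
  proof (intro add_mono mult_left_mono)
    show "measure qsd {x. a * x + 1 \<in> ?S} \<le> measure qsd B"
    proof (rule measure_qsd_mono[OF preimage_sets(1)[OF S] B])
      show "{x. a * x + 1 \<in> ?S} \<inter> {0..<M} \<subseteq> B"
      proof
        fix x assume x: "x \<in> {x. a * x + 1 \<in> ?S} \<inter> {0..<M}"
        hence "a * x + 1 \<in> pull A B" "0 \<le> a * x" using a_pos by auto
        thus "x \<in> B" using a_pos by (auto simp: pull_def split: if_splits)
      qed
    qed
    show "measure qsd {x. a * x - 1 \<in> ?S} \<le> measure qsd A"
    proof (rule measure_qsd_mono[OF preimage_sets(2)[OF S] A])
      show "{x. a * x - 1 \<in> ?S} \<inter> {0..<M} \<subseteq> A"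
      proof
        fix x assume x: "x \<in> {x. a * x - 1 \<in> ?S} \<inter> {0..<M}"
        hence "a * x - 1 \<in> pull A B" "x < M" by auto
        moreover have "a * x < a * M" using \<open>x < M\<close> a_pos by simp
        hence "a * x - 1 < 1" using M_props by linarith
        ultimately show "x \<in> A" using a_pos by (auto simp: pull_def split: if_splits)
      qed
    qed
  qed (use p_pos p_less in auto)
  finally have "lam a p * measure qsd (pull A B) \<le> p * measure qsd B + (1 - p) * measure qsd A" .
  hence "measure qsd (pull A B) \<le> (p * measure qsd B + (1 - p) * measure qsd A) / lam a p"
    using lam_m(2) by (simp add: pos_le_divide_eq mult.commute)
  also have "\<dots> = m * measure qsd B + m * r * measure qsd A"
  proof -
    have "p / lam a p = m" "(1 - p) / lam a p = m * r"
      using p_pos m_props by (simp_all add: lam_m(1) r_def)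
    moreover have "(p * measure qsd B + (1 - p) * measure qsd A) / lam a p
       = p / lam a p * measure qsd B + (1 - p) / lam a p * measure qsd A" by (simp add: add_divide_distrib)
    ultimately show ?thesis by simp
  qed
  finally show ?thesis .
qed

text \<open>Sums over cylinders of square roots of \<open>qsd\<close>-factor times Lebesgue factor,
  the branches having factors \<open>m * a\<close> and \<open>m * r * a\<close>. For
  \<open>y < 1\<close> the upper branch is covered in full, hence \<open>hellinger n 0\<close>, and
  the lower one from \<open>Ta a y\<close> on.\<close>

primrec hellinger :: "nat \<Rightarrow> real \<Rightarrow> real" where
  "hellinger 0 y = 2"
| "hellinger (Suc n) y = sqrt (m * a) * (if y < 1 then hellinger n 0 + sqrt r * hellinger n (Ta a y)
     else hellinger n (Ta a y))"

text \<open>On a branch of \<open>qsd\<close>-factor \<open>c\<close> and Lebesgue factor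
  \<open>a\<close> the weight \<open>t\<close> becomes \<open>t * a / c\<close>; the identity shows
  that the cost is again \<open>sqrt t\<close> times an affinity factor.\<close>

lemma sqrt_rescale:
  assumes "0 < c" "0 < t"
  shows "c * sqrt (t * a / c) = sqrt t * sqrt (c * a)"
proof -
  have "c * sqrt (t * a / c) = sqrt (c\<^sup>2 * (t * a / c))" using assms by (simp only: real_sqrt_mult real_sqrt_abs abs_of_pos)
  also have "c\<^sup>2 * (t * a / c) = t * (c * a)" using assms by (simp add: power2_eq_square)
  finally show ?thesis by (simp add: real_sqrt_mult)
qed

lemma lebesgue_remainder_high:
  assumes "A \<in> sets borel" "B \<in> sets borel" "1 \<le> y"
  shows "measure lborel ({y..M} - pull A B) \<le> a * measure lborel ({Ta a y..M} - B)"
proof -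
  have sub: "{y..M} - pull A B \<subseteq> {x. (x - 1) / a \<in> {Ta a y..M} - B}"
  proof
    fix x assume x: "x \<in> {y..M} - pull A B"
    have "(x - 1) / a \<le> (M - 1) / a" using x a_pos by (intro divide_right_mono) auto
    also have "(M - 1) / a = M" using M_props(4) a_pos by (simp add: field_simps)
    finally have "(x - 1) / a \<le> M" .
    moreover have "(y - 1) / a \<le> (x - 1) / a" using x a_pos by (intro divide_right_mono) auto
    ultimately show "x \<in> {x. (x - 1) / a \<in> {Ta a y..M} - B}" using x assms by (auto simp: pull_def Ta_def)
  qed
  have f: "{x. (x - 1) / a \<in> {Ta a y..M} - B} \<in> fmeasurable lborel"
    by (rule measure_affine_preimage_bounded(1)[OF a_pos, of _ "Ta a y" M]) (use assms in auto)
  have e: "measure lborel {x. (x - 1) / a \<in> {Ta a y..M} - B} = a * measure lborel ({Ta a y..M} - B)"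
    by (rule measure_affine_preimage_bounded(2)[OF a_pos, of _ "Ta a y" M]) (use assms in auto)
  have "{y..M} - pull A B \<in> sets lborel" using pull_sets[OF assms(1,2)] by simp
  from measure_mono_fmeasurable[OF sub this f] show ?thesis unfolding e .
qed

lemma lebesgue_remainder_low:
  assumes "A \<in> sets borel" "B \<in> sets borel" "0 \<le> y" "y < 1"
  shows "measure lborel ({y..M} - pull A B)
     \<le> a * measure lborel ({Ta a y..M} - A) + a * measure lborel ({0..M} - B)"
proof -
  let ?U = "{x. (x - (-1)) / a \<in> {Ta a y..M} - A}" and ?V = "{x. (x - 1) / a \<in> {0..M} - B}"
  have "{y..M} - pull A B \<subseteq> ?U \<union> ?V"
  proof
    fix x assume x: "x \<in> {y..M} - pull A B"
    show "x \<in> ?U \<union> ?V"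
    proof (cases "x < 1")
      case True
      have "(y + 1) / a \<le> (x + 1) / a" using x a_pos by (intro divide_right_mono) auto
      thus ?thesis using x True assms by (auto simp: pull_def Ta_def)
    next
      case False
      have "(x - 1) / a \<le> (M - 1) / a" using x a_pos by (intro divide_right_mono) auto
      also have "(M - 1) / a = M" using M_props(4) a_pos by (simp add: field_simps)
      finally show ?thesis using x False a_pos by (auto simp: pull_def)
    qed
  qed
  moreover have U: "?U \<in> fmeasurable lborel"
    by (rule measure_affine_preimage_bounded(1)[OF a_pos, of _ "Ta a y" M]) (use assms in auto)
  moreover have V: "?V \<in> fmeasurable lborel"
    by (rule measure_affine_preimage_bounded(1)[OF a_pos, of _ 0 M]) (use assms in auto)
  moreover have "{y..M} - pull A B \<in> sets lborel" using pull_sets[OF assms(1,2)] by simp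
  ultimately have "measure lborel ({y..M} - pull A B) \<le> measure lborel (?U \<union> ?V)"
    by (intro measure_mono_fmeasurable) auto
  also have "\<dots> \<le> measure lborel ?U + measure lborel ?V" using U V by (intro measure_Un_le) auto
  also have "measure lborel ?U = a * measure lborel ({Ta a y..M} - A)"
    by (rule measure_affine_preimage_bounded(2)[OF a_pos, of _ "Ta a y" M]) (use assms in auto)
  also have "measure lborel ?V = a * measure lborel ({0..M} - B)"
    by (rule measure_affine_preimage_bounded(2)[OF a_pos, of _ 0 M]) (use assms in auto)
  finally show ?thesis .
qed

text \<open>For every weight \<open>t\<close> the two measures can be separated at cost \<open>sqrt t\<close> times a Hellinger affinity
  of the cylinder weights; this form is invariant under the two affine branches.\<close>

lemma separation:
  assumes "0 \<le> y" "0 < t"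
  shows "\<exists>A\<in>sets borel. measure qsd A + t * measure lborel ({y..M} - A) \<le> sqrt t * hellinger n y"
  using assms
proof (induction n arbitrary: y t)
  case 0
  define s where "s = sqrt t"
  have s: "0 < s" "t = s * s" using 0 by (auto simp: s_def)
  show ?case
  \<comment> \<open>The initial value 2 dominates the better of two trivial choices: the empty set
    costs at most \<open>3 * t\<close>, the whole line costs 1, and \<open>3 * t = 2 * s\<close>
    holds at \<open>s = 2/3\<close>.\<close>
  proof (cases "s \<le> 2/3")
    case True
    have "measure lborel {y..M} \<le> 3" using 0 M_props by (cases "y \<le> M") auto
    hence "t * measure lborel {y..M} \<le> t * 3" using 0 by (intro mult_left_mono) auto
    also have "\<dots> = s * (3 * s)" using s by simp
    also have "\<dots> \<le> s * 2" using True s by (intro mult_left_mono) auto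
    finally show ?thesis by (intro bexI[of _ "{}"]) (auto simp: s_def)
  next
    case False
    thus ?thesis using qsd.prob_space by (intro bexI[of _ UNIV]) (auto simp: s_def)
  qed
next
  case (Suc n)
  have Ty: "0 \<le> Ta a y" using Ta_nonneg a_pos Suc.prems by blast
  have ma: "0 < m" "0 < m * r" using m_props r_pos by auto
  have t2: "0 < t * a / m" "0 < t * a / (m * r)" using Suc.prems a_pos ma by auto
  show ?case
  proof (cases "y < 1")
    case True
    obtain B where B: "B \<in> sets borel"
      "measure qsd B + t * a / m * measure lborel ({0..M} - B) \<le> sqrt (t * a / m) * hellinger n 0"
      using Suc.IH[OF order.refl t2(1)] by blast
    obtain A where A: "A \<in> sets borel"
      "measure qsd A + t * a / (m * r) * measure lborel ({Ta a y..M} - A) \<le> sqrt (t * a / (m * r)) * hellinger n (Ta a y)"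
      using Suc.IH[OF Ty t2(2)] by blast
    have "measure qsd (pull A B) + t * measure lborel ({y..M} - pull A B)
      \<le> (m * measure qsd B + m * r * measure qsd A)
        + t * (a * measure lborel ({Ta a y..M} - A) + a * measure lborel ({0..M} - B))"
      using measure_qsd_pull[OF A(1) B(1)] lebesgue_remainder_low[OF A(1) B(1) Suc.prems(1) True] Suc.prems
      by (intro add_mono mult_left_mono) auto
    also have "\<dots> = m * (measure qsd B + t * a / m * measure lborel ({0..M} - B))
        + m * r * (measure qsd A + t * a / (m * r) * measure lborel ({Ta a y..M} - A))"
      using ma r_pos by (simp add: field_simps)
    also have "\<dots> \<le> m * (sqrt (t * a / m) * hellinger n 0) + m * r * (sqrt (t * a / (m * r)) * hellinger n (Ta a y))"
      using A(2) B(2) ma by (intro add_mono mult_left_mono) auto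
    also have "\<dots> = (m * sqrt (t * a / m)) * hellinger n 0 + (m * r * sqrt (t * a / (m * r))) * hellinger n (Ta a y)"
      by simp
    also have "\<dots> = sqrt t * hellinger (Suc n) y"
      unfolding sqrt_rescale[OF ma(1) Suc.prems(2)] sqrt_rescale[OF ma(2) Suc.prems(2)]
      using True by (simp add: real_sqrt_mult algebra_simps)
    finally show ?thesis using pull_sets[OF A(1) B(1)] by blast
  next
    case False
    obtain B where B: "B \<in> sets borel"
      "measure qsd B + t * a / m * measure lborel ({Ta a y..M} - B) \<le> sqrt (t * a / m) * hellinger n (Ta a y)"
      using Suc.IH[OF Ty t2(1)] by blast
    have "measure qsd (pull {} B) + t * measure lborel ({y..M} - pull {} B)
      \<le> (m * measure qsd B + m * r * measure qsd {}) + t * (a * measure lborel ({Ta a y..M} - B))"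
      using measure_qsd_pull[of "{}" B] B(1) lebesgue_remainder_high[of "{}" B y] False Suc.prems
      by (intro add_mono mult_left_mono) auto
    also have "\<dots> = m * (measure qsd B + t * a / m * measure lborel ({Ta a y..M} - B))"
      using ma by (simp add: field_simps)
    also have "\<dots> \<le> m * (sqrt (t * a / m) * hellinger n (Ta a y))"
      using B(2) ma by (intro mult_left_mono) auto
    also have "\<dots> = (m * sqrt (t * a / m)) * hellinger n (Ta a y)" by simp
    also have "\<dots> = sqrt t * hellinger (Suc n) y"
      unfolding sqrt_rescale[OF ma(1) Suc.prems(2)] using False by simp
    finally show ?thesis using pull_sets[of "{}" B] B(1) by blast
  qed
qed

lemma orbit_term_geometric_mean:
  "orbit_term (sqrt (m * a)) (sqrt r) a y k = sqrt (orbit_term m r a y k * orbit_term a 1 a y k)"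
  by (simp add: orbit_term_def delta_def real_sqrt_mult real_sqrt_power power_mult_distrib)

lemma orbit_weight_geometric_mean:
  "orbit_weight (sqrt (m * a)) (sqrt r) a y k = sqrt (orbit_weight m r a y k * orbit_weight a 1 a y k)"
  by (simp add: orbit_weight_def real_sqrt_mult real_sqrt_power power_mult_distrib)

text \<open>Scale \<open>a\<close> and ratio 1 play for Lebesgue measure the role of
  \<open>m\<close> and \<open>r\<close> for \<open>qsd\<close>, since each branch of the chain
  contracts lengths by \<open>a\<close>. Comparison with the solution at \<open>2/3\<close>, whose
  sum is 1, brings in the factor \<open>a / (2/3)\<close>.\<close>

lemma lebesgue_terms:
  shows "summable (orbit_term a 1 a 0)" "(\<Sum>k. orbit_term a 1 a 0 k) \<le> 3/2 * a"
proof -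
  have s: "subunit (2/3) 1 (2/3)"
    using char_root(5)[of "2/3" "1/2"] mu_two_thirds_half by simp
  have le: "orbit_sum (2/3) 1 a n 0 \<le> 1" for n
    using s a_pos a_le by (intro orbit_sum_le_1[where b = "2/3"]) auto
  have le': "orbit_sum a 1 a n 0 \<le> 3/2 * a" for n
  proof -
    have "orbit_sum a 1 a n 0 \<le> a / (2/3) * orbit_sum (2/3) 1 a n 0"
      using a_pos a_le by (intro orbit_sum_scale) auto
    also have "\<dots> \<le> a / (2/3) * 1" using le a_pos by (intro mult_left_mono) auto
    finally show ?thesis by simp
  qed
  show sm: "summable (orbit_term a 1 a 0)"
    using le' orbit_term_nonneg[of a 1 a 0] a_pos
    unfolding orbit_sum_def by (intro summableI_nonneg_bounded[where x = "3/2 * a"]) auto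
  show "(\<Sum>k. orbit_term a 1 a 0 k) \<le> 3/2 * a"
    using le' unfolding orbit_sum_def by (intro suminf_le_const[OF sm]) auto
qed

text \<open>Termwise the geometric mean is at most the arithmetic mean of two families with sums 1
  and at most \<open>3/2 * a\<close>, which settles \<open>a < 2/3\<close>. For
  \<open>a = 2/3\<close> the families must differ in some term: in the first one if
  \<open>m \<noteq> a\<close>, and otherwise, as \<open>p \<noteq> 1/2\<close> gives
  \<open>r \<noteq> 1\<close>, at a later visit to \<open>[0,1)\<close>, whose term contains a
  positive power of \<open>r\<close>.\<close>

lemma hellinger_defect:
  assumes "\<not> (a = 2/3 \<and> p = 1/2)"
  shows "summable (orbit_term (sqrt (m * a)) (sqrt r) a 0)"
    and "(\<Sum>k. orbit_term (sqrt (m * a)) (sqrt r) a 0 k) < 1"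
proof -
  define b b' c where "b = orbit_term m r a 0" and "b' = orbit_term a 1 a 0"
    and "c = orbit_term (sqrt (m * a)) (sqrt r) a 0"
  have b: "b sums 1" using char_root(7)[of a p] a_ge a_le p_pos p_less by (simp add: b_def m_def r_def)
  have b0: "0 \<le> b k" "0 \<le> b' k" for k
    using orbit_term_nonneg[of m r a 0 k] orbit_term_nonneg[of a 1 a 0 k] m_props r_pos a_pos
    by (auto simp: b_def b'_def)
  have ck: "c k = sqrt (b k * b' k)" for k
    using orbit_term_geometric_mean[of 0 k] by (simp add: b_def b'_def c_def)
  have c0: "0 \<le> c k" for k using b0 by (simp add: ck)
  have le: "c k \<le> (b k + b' k) / 2" for k using arith_geo_mean_sqrt[OF b0(1)[of k] b0(2)[of k]] by (simp add: ck)
  have sb': "summable b'" using lebesgue_terms by (simp add: b'_def)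
  have sh: "summable (\<lambda>k. (b k + b' k) / 2)"
    using summable_add[OF sums_summable[OF b] sb'] by (rule summable_divide)
  have sc: "summable c" by (rule summable_comparison_test'[OF sh, where N = 0]) (use c0 le in auto)
  thus "summable (orbit_term (sqrt (m * a)) (sqrt r) a 0)" by (simp add: c_def)
  have sum_h: "(\<Sum>k. (b k + b' k) / 2) = (1 + suminf b') / 2"
    using suminf_add[OF sums_summable[OF b] sb'] suminf_divide[OF summable_add[OF sums_summable[OF b] sb'], of 2] sums_unique[OF b]
    by simp
  have B': "suminf b' \<le> 3/2 * a" using lebesgue_terms by (simp add: b'_def)
  have "suminf c < 1"
  proof (cases "a = 2/3")
    case False
    hence "suminf b' < 1" using B' a_le by linarith
    moreover have "suminf c \<le> (1 + suminf b') / 2" unfolding sum_h[symmetric] using sc sh le by (intro suminf_le)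
    moreover have "(1 + suminf b') / 2 < 1" using \<open>suminf b' < 1\<close> by simp
    ultimately show ?thesis by (meson le_less_trans)
  next
    case True
    have "\<exists>k. b k \<noteq> b' k"
    proof (cases "m = a")
      case False
      thus ?thesis by (intro exI[of _ 0]) (simp add: b_def b'_def orbit_term_def delta_0)
    next
      case ma: True
      have "1 - p \<noteq> p" using assms True by auto
      hence r1: "r \<noteq> 1" using p_pos by (simp add: r_def)
      have "1/a < 1/(1-a)" using a_gt a_le by (intro divide_strict_left_mono) auto
      then obtain k where k: "delta a (Ta a 0) k = 1" using visits_below_1[OF a_ge a_le, of "1/a"] by (auto simp: Ta_def)
      hence d: "delta a 0 (Suc k) = 1" by (simp add: delta_Suc)
      have L: "Lk a 0 (Suc k) > 0" by (simp add: Lk_Suc_shift delta_0)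
      have "r ^ Lk a 0 (Suc k) \<noteq> 1" using r1 r_pos L power_eq_1_iff[of r] by (metis less_imp_le less_numeral_extra(3) power_eq_iff_eq_base power_one zero_le_one)
      thus ?thesis using ma a_pos d by (intro exI[of _ "Suc k"]) (simp add: b_def b'_def orbit_term_def)
    qed
    then obtain k where k: "b k \<noteq> b' k" by blast
    have "c k < (b k + b' k) / 2"
    proof (rule ccontr)
      assume "\<not> ?thesis"
      hence "(b k + b' k) / 2 = sqrt (b k * b' k)" using le[of k] ck[of k] by simp
      hence "((b k + b' k) / 2)\<^sup>2 = b k * b' k" using b0[of k] by simp
      hence "(b k - b' k)\<^sup>2 = 0" by (simp add: power2_eq_square field_simps)
      thus False using k by simp
    qed
    hence "0 < (\<Sum>k. (b k + b' k) / 2 - c k)"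
      using le by (intro suminf_pos2[OF summable_diff[OF sh sc], of k]) auto
    also have "\<dots> = (1 + suminf b') / 2 - suminf c" using suminf_diff[OF sh sc] sum_h by simp
    finally show ?thesis using B' True by simp
  qed
  thus "(\<Sum>k. orbit_term (sqrt (m * a)) (sqrt r) a 0 k) < 1" by (simp add: c_def)
qed

lemma hellinger_tendsto_0:
  assumes "\<not> (a = 2/3 \<and> p = 1/2)"
  shows "(\<lambda>n. hellinger n 0) \<longlonglongrightarrow> 0"
proof (rule defective_renewal[OF _ hellinger_defect[OF assms]])
  show "0 \<le> orbit_term (sqrt (m * a)) (sqrt r) a 0 k" for k
    using m_props r_pos a_pos by (intro orbit_term_nonneg) auto
  show "0 \<le> orbit_weight (sqrt (m * a)) (sqrt r) a 0 n * 2" for n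
    using m_props r_pos a_pos orbit_weight_nonneg[of "sqrt (m * a)" "sqrt r" a 0 n] by simp
  show "hellinger n 0 = (\<Sum>k<n. orbit_term (sqrt (m * a)) (sqrt r) a 0 k * hellinger (n - 1 - k) 0)
     + orbit_weight (sqrt (m * a)) (sqrt r) a 0 n * 2" for n
    using unroll_recursion[of UNIV hellinger "sqrt (m * a)" "\<lambda>n. hellinger n 0" "sqrt r" a 0 n] by simp
  have "(\<lambda>n. sqrt (orbit_weight m r a 0 n * orbit_weight a 1 a 0 n) * 2) \<longlonglongrightarrow> sqrt (0 * 0) * 2"
  proof (intro tendsto_intros)
    show "orbit_weight m r a 0 \<longlonglongrightarrow> 0"
      using m_props r_pos by (intro orbit_weight_tendsto_0) (auto simp: subunit_def)
    have "(\<lambda>n. a ^ n) \<longlonglongrightarrow> 0" using a_pos a_le by (intro LIMSEQ_realpow_zero) auto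
    thus "orbit_weight a 1 a 0 \<longlonglongrightarrow> 0" by (simp add: orbit_weight_def[abs_def])
  qed
  thus "(\<lambda>n. orbit_weight (sqrt (m * a)) (sqrt r) a 0 n * 2) \<longlonglongrightarrow> 0"
    by (simp add: orbit_weight_geometric_mean)
qed

text \<open>Separating sets with both costs at most \<open>(1/2) ^ j\<close> feed Borel-Cantelli
  twice: the points of the state space outside infinitely many \<open>A j\<close> are Lebesgue null,
  and \<open>qsd\<close>-almost every point is eventually outside all \<open>A j\<close>.\<close>

lemma qsd_singular:
  assumes "\<not> (a = 2/3 \<and> p = 1/2)"
  shows "\<exists>N\<in>null_sets lborel. emeasure qsd (UNIV - N) = 0"
proof -
  have "\<exists>A\<in>sets borel. measure qsd A + measure lborel ({0..M} - A) \<le> (1/2) ^ j" for j :: nat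
  proof -
    have "eventually (\<lambda>n. hellinger n 0 < (1/2) ^ j) sequentially"
      using hellinger_tendsto_0[OF assms] by (rule order_tendstoD(2)) simp
    then obtain n where "hellinger n 0 < (1/2) ^ j" using eventually_happens'[OF sequentially_bot] by blast
    thus ?thesis using separation[of 0 1 n] by (auto intro!: bexI elim!: order_trans)
  qed
  then obtain A where A: "\<And>j. A j \<in> sets borel"
    "\<And>j. measure qsd (A j) + measure lborel ({0..M} - A j) \<le> (1/2) ^ j" by metis
  define N where "N = limsup (\<lambda>j. {0..M} - A j)"
  have geo: "summable (\<lambda>j. (1/2::real) ^ j)" by (rule summable_geometric) auto
  have N: "N \<in> null_sets lborel" unfolding N_def
  proof (rule borel_cantelli_limsup1)
    show "{0..M} - A j \<in> sets lborel" for j using A by auto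
    show "emeasure lborel ({0..M} - A j) < \<infinity>" for j
    proof -
      have "emeasure lborel ({0..M} - A j) \<le> emeasure lborel {0..M}" using A by (intro emeasure_mono) auto
      also have "\<dots> < \<infinity>" using M_props by simp
      finally show ?thesis .
    qed
    show "summable (\<lambda>j. measure lborel ({0..M} - A j))"
    proof (rule summable_comparison_test'[OF geo, where N = 0])
      fix j
      show "norm (measure lborel ({0..M} - A j)) \<le> (1/2) ^ j"
        using A(2)[of j] measure_nonneg[of qsd "A j"] unfolding real_norm_def abs_of_nonneg[OF measure_nonneg]
        by linarith
    qed
  qed
  have "AE x in qsd. eventually (\<lambda>j. x \<in> space qsd - A j) sequentially"
  proof (rule borel_cantelli_AE1)
    show "summable (\<lambda>j. measure qsd (A j))"
    proof (rule summable_comparison_test'[OF geo, where N = 0])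
      fix j
      show "norm (measure qsd (A j)) \<le> (1/2) ^ j"
        using A(2)[of j] measure_nonneg[of lborel "{0..M} - A j"]
        unfolding real_norm_def abs_of_nonneg[OF measure_nonneg] by linarith
    qed
    show "emeasure qsd (A j) < \<infinity>" for j by (simp add: qsd.emeasure_eq_measure)
  qed (use A in auto)
  with AE_qsd_state_space have "AE x in qsd. x \<notin> UNIV - N"
  proof eventually_elim
    case (elim x)
    then obtain i where i: "\<And>j. i \<le> j \<Longrightarrow> x \<in> {0..M} - A j" by (auto simp: eventually_sequentially)
    have "\<exists>j\<ge>n. x \<in> {0..M} - A j" for n using i[of "max i n"] by (intro exI[of _ "max i n"]) auto
    thus ?case by (auto simp: N_def limsup_INF_SUP)
  qed
  hence "emeasure qsd {x \<in> space qsd. x \<in> UNIV - N} = 0" by (rule emeasure_eq_0_AE)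
  moreover have "{x \<in> space qsd. x \<in> UNIV - N} = UNIV - N" by auto
  ultimately show ?thesis using N by (intro bexI[of _ N]) auto
qed

lemma qsd_uniform:
  assumes "a = 2/3" "p = 1/2"
  shows "qsd = uniform_measure lborel {0..3}"
proof (rule cdf_unique)
  have a1: "1 - a = 1/3" using assms by simp
  have M3: "M = 3" unfolding M_def a1 by simp
  have "mu a p = 2/3" by (simp only: assms mu_two_thirds_half(1))
  moreover have "odds p = 1" using assms(2) by simp
  ultimately have mr: "m = 2/3" "r = 1" by (simp_all only: m_def r_def)
  have H: "H y = 1 - y/3" if "0 \<le> y" "y \<le> 3" for y
  proof -
    have "H y = tail_fun (2/3) 1 (2/3) y" unfolding H_def mr by (simp only: assms(1))
    also have "\<dots> = 1 - y/3"
      using sums_unique[OF orbit_term_two_thirds_sums[OF that]] by (simp add: tail_fun_def)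
    finally show ?thesis .
  qed
  show "real_distribution qsd" ..
  interpret U: prob_space "uniform_measure lborel {0..3::real}" by (rule prob_space_uniform_measure) auto
  show "real_distribution (uniform_measure lborel {0..3::real})" by unfold_locales simp
  show "cdf qsd = cdf (uniform_measure lborel {0..3})"
  proof
    fix y :: real
    have "measure (uniform_measure lborel {0..3}) {..y} = measure lborel ({0..3} \<inter> {..y}) / measure lborel {0..3::real}"
      by (rule measure_uniform_measure) auto
    also have "{0..3} \<inter> {..y} = {0..min 3 y}" by auto
    also have "measure lborel {0..min 3 y} / measure lborel {0..3::real} = F y"
      using H[of y] F_eq_0[of y] F_eq_1[of y] M3 by (cases "y \<le> 0"; cases "3 \<le> y") (auto simp: F_def min_def)
    finally show "cdf qsd y = cdf (uniform_measure lborel {0..3}) y"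
      by (simp add: cdf_def measure_qsd_atMost)
  qed
qed

end

section \<open>Support of the quasi-stationary distribution\<close>

lemma orbit_two_thirds_neq_3: "(Ta (2/3) ^^ k) 0 \<noteq> 3"
proof (induction k)
  case (Suc k)
  thus ?case using orbit_two_thirds_neq_1[of k] by (auto simp: Ta_def)
qed simp

context ar_chain
begin

lemma msupport_iff: "y \<in> msupport qsd \<longleftrightarrow> (\<forall>e>0. F (y - e) < F (y + e))"
proof
  assume y: "y \<in> msupport qsd"
  show "\<forall>e>0. F (y - e) < F (y + e)"
  proof (intro allI impI)
    fix e :: real assume e: "e > 0"
    have "0 < emeasure qsd (ball y e)" using y e by (simp add: msupport_def)
    also have "\<dots> \<le> emeasure qsd {y - e..y + e}" by (intro emeasure_mono) (auto simp: dist_real_def)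
    also have "\<dots> = ennreal (F (y + e) - F (y - e))" using e by (intro emeasure_qsd_Icc) simp
    finally show "F (y - e) < F (y + e)" by simp
  qed
next
  assume R: "\<forall>e>0. F (y - e) < F (y + e)"
  show "y \<in> msupport qsd" unfolding msupport_def
  proof (intro CollectI allI impI)
    fix e :: real assume e: "e > 0"
    have "0 < ennreal (F (y + e/2) - F (y - e/2))" using R e by simp
    also have "\<dots> = emeasure qsd {y - e/2..y + e/2}" using e by (intro emeasure_qsd_Icc[symmetric]) simp
    also have "\<dots> \<le> emeasure qsd (ball y e)" using e by (intro emeasure_mono) (auto simp: dist_real_def)
    finally show "0 < emeasure qsd (ball y e)" .
  qed
qed

lemma not_in_msupport:
  assumes "0 < d" "0 < d'" "F (y - d) = F y" "F (y + d') = F y"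
  shows "y \<notin> msupport qsd"
proof
  assume "y \<in> msupport qsd"
  hence "F (y - min d d') < F (y + min d d')" using assms by (simp add: msupport_iff)
  moreover have "F (y - d) \<le> F (y - min d d')" "F (y + min d d') \<le> F (y + d')" by (auto intro: F_mono)
  ultimately show False using assms by linarith
qed

lemma F_nonneg_arg: "0 \<le> y \<Longrightarrow> F y = 1 - H y"
  by (simp add: F_def)

text \<open>Points slightly to the right share the letters up to time \<open>N\<close> and are still
  at or above \<open>M\<close> at that time, so their \<open>H\<close> is the same finite
  sum.\<close>

lemma right_constant:
  assumes "0 \<le> y" "M \<le> (Ta a ^^ N) y"
  shows "\<exists>d>0. F (y + d) = F y"
proof -
  obtain d where d: "d > 0" "\<And>b x. 0 < b \<Longrightarrow> b \<le> a \<Longrightarrow> a - d < b \<Longrightarrow> y \<le> x \<Longrightarrow> x < y + d \<Longrightarrow>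
     (\<forall>j<N. delta b x j = delta a y j) \<and> (Ta a ^^ N) y \<le> (Ta b ^^ N) x"
    using orbit_near_above[OF a_pos assms(1) zero_less_one, of N] by metis
  have x: "(\<forall>j<N. delta a (y + d/2) j = delta a y j) \<and> (Ta a ^^ N) y \<le> (Ta a ^^ N) (y + d/2)"
    using d(1) a_pos by (intro d(2)) auto
  have "H (y + d/2) = orbit_sum m r a N (y + d/2)" using x assms by (intro H_eq_orbit_sum) linarith
  also have "\<dots> = orbit_sum m r a N y" using x by (intro orbit_cong(1)[of N]) auto
  also have "\<dots> = H y" using assms by (intro H_eq_orbit_sum[symmetric])
  finally show ?thesis using assms d(1) by (intro exI[of _ "d/2"]) (simp add: F_nonneg_arg)
qed

lemma left_constant_avoiding_1:
  assumes "0 < y" "M < (Ta a ^^ N) y" "\<And>j. j < N \<Longrightarrow> (Ta a ^^ j) y \<noteq> 1"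
  shows "\<exists>d>0. F (y - d) = F y"
proof -
  define e where "e = (Ta a ^^ N) y - M"
  have e: "e > 0" using assms by (simp add: e_def)
  obtain d where d: "d > 0" "\<And>x j. \<bar>x - y\<bar> < d \<Longrightarrow> j < N \<Longrightarrow> delta a x j = delta a y j"
    "\<And>x. \<bar>x - y\<bar> < d \<Longrightarrow> \<bar>(Ta a ^^ N) x - (Ta a ^^ N) y\<bar> < e"
    using near_same_code[OF assms(3) e] by metis
  define x where "x = y - min d y / 2"
  have x: "0 \<le> x" "\<bar>x - y\<bar> < d" using d(1) assms(1) by (auto simp: x_def min_def)
  have "M \<le> (Ta a ^^ N) x" using d(3)[OF x(2)] by (simp add: e_def)
  hence "H x = orbit_sum m r a N x" by (rule H_eq_orbit_sum)
  also have "\<dots> = orbit_sum m r a N y" using d(2)[OF x(2)] by (intro orbit_cong(1)[of N]) auto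
  also have "\<dots> = H y" using assms by (intro H_eq_orbit_sum[symmetric]) simp
  finally have "F x = F y" using x assms by (simp add: F_nonneg_arg)
  thus ?thesis using d(1) assms(1) by (intro exI[of _ "min d y / 2"]) (simp add: x_def)
qed

text \<open>For \<open>a < 2/3\<close> the left neighbours of 1 lie in the gap, so their image is
  already above \<open>M\<close> and \<open>H\<close> takes the value \<open>m = H 1\<close> on
  them. The margin \<open>2 - a * M\<close> is the width of the gap.\<close>

lemma left_constant_hitting_1:
  assumes "0 < y" "a < 2/3" "(Ta a ^^ k) y = 1"
  shows "\<exists>d>0. F (y - d) = F y"
proof -
  obtain k where k: "(Ta a ^^ k) y = 1" "\<And>j. j < k \<Longrightarrow> (Ta a ^^ j) y \<noteq> 1"
    using assms(3) exists_least_iff[of "\<lambda>j. (Ta a ^^ j) y = 1"] by auto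
  define e where "e = 2 - a * M"
  have "a * M < 2" using assms(2) by (simp add: M_def field_simps)
  hence e: "e > 0" by (simp add: e_def)
  obtain d where d: "d > 0" "\<And>x j. \<bar>x - y\<bar> < d \<Longrightarrow> j < k \<Longrightarrow> delta a x j = delta a y j"
    "\<And>x. \<bar>x - y\<bar> < d \<Longrightarrow> \<bar>(Ta a ^^ k) x - (Ta a ^^ k) y\<bar> < e"
    using near_same_code[OF k(2) e] by metis
  define x where "x = y - min d y / 2"
  have x: "0 \<le> x" "\<bar>x - y\<bar> < d" "x \<le> y" using d(1) assms(1) by (auto simp: x_def min_def)
  define z where "z = (Ta a ^^ k) x"
  have z: "0 \<le> z" "1 - e < z" "z \<le> 1"
    using Ta_iter_nonneg[OF a_pos x(1)] d(3)[OF x(2)] k(1) orbit_mono[of a a x y k] a_pos x d(2)[OF x(2)]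
    by (auto simp: z_def abs_less_iff)
  have Hz: "H z = m"
  proof (cases "z = 1")
    case True thus ?thesis using H_1 by simp
  next
    case False
    hence "z < 1" using z by simp
    moreover have "M \<le> (z + 1) / a" using z a_pos by (simp add: e_def pos_le_divide_eq mult.commute)
    ultimately show ?thesis using H_step[OF z(1)] H_eq_0[of "(z + 1) / a"] by (simp add: Ta_def)
  qed
  have "H x = H y"
    using H_split[OF x(1), of k] H_split[of y k] orbit_cong[of k a x a y k m r] d(2)[OF x(2)] k(1) Hz H_1 assms(1)
    by (simp add: z_def)
  hence "F x = F y" using x assms by (simp add: F_nonneg_arg)
  thus ?thesis using d(1) assms(1) by (intro exI[of _ "min d y / 2"]) (simp add: x_def)
qed

lemma Qa_iff: "y \<in> Qa a \<longleftrightarrow> 0 \<le> y \<and> y \<le> M \<and> (\<forall>k. (Ta a ^^ k) y \<le> M)"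
  using kappa_eq_infinity_iff[OF a_ge a_le, of y] by (auto simp: Qa_def M_def)

lemma escapes_imp_less:
  assumes "0 \<le> y" "y \<le> M" "M < (Ta a ^^ N) y"
  shows "a < 2/3"
proof (rule ccontr)
  assume "\<not> a < 2/3"
  hence a: "a = 2/3" using a_le by simp
  hence a1: "1 - a = 1/3" by simp
  have "M = 3" unfolding M_def a1 by simp
  thus False using orbit_two_thirds_bounded[of y N] assms a by auto
qed

lemma left_constant_0: "\<exists>d>0. F (0 - d) = F 0"
  by (intro exI[of _ 1]) (simp add: F_eq_0)

text \<open>An orbit escaping beyond \<open>M\<close> makes \<open>F\<close> constant on both sides
  of its starting point; on the left the argument depends on whether the orbit passes through
  1.\<close>

lemma msupport_subset_Qa:
  assumes "y \<in> msupport qsd"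
  shows "y \<in> Qa a"
proof (rule ccontr)
  assume n: "y \<notin> Qa a"
  consider "y < 0" | "M < y" | "0 \<le> y" "y \<le> M" by linarith
  hence "\<exists>d>0. \<exists>d'>0. F (y - d) = F y \<and> F (y + d') = F y"
  proof cases
    case 1
    thus ?thesis using F_eq_0[of y] F_eq_0[of "y - 1"] F_eq_0[of 0]
      by (intro exI[of _ 1] conjI exI[of _ "-y"]) auto
  next
    case 2
    thus ?thesis using F_eq_1[of y] F_eq_1[of M] F_eq_1[of "y + 1"]
      by (intro exI[of _ "y - M"] conjI exI[of _ 1]) auto
  next
    case 3
    then obtain N where N: "M < (Ta a ^^ N) y" using n by (auto simp: Qa_iff not_le)
    have "\<exists>d>0. F (y - d) = F y"
    proof (cases "y = 0")
      case True thus ?thesis using left_constant_0 by simp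
    next
      case False
      hence y: "0 < y" using 3 by simp
      show ?thesis
        using left_constant_hitting_1[OF y escapes_imp_less[OF 3 N]] left_constant_avoiding_1[OF y N] by metis
    qed
    moreover have "\<exists>d>0. F (y + d) = F y" using right_constant[OF 3(1), of N] N by simp
    ultimately show ?thesis by blast
  qed
  thus False using not_in_msupport assms by blast
qed

lemma msupport_if_below_M:
  assumes "0 \<le> y" "\<And>k. (Ta a ^^ k) y < M"
  shows "y \<in> msupport qsd"
  unfolding msupport_iff
proof (intro allI impI)
  fix e :: real assume e: "e > 0"
  have "H (y + e) < H y" unfolding H_def
    using assms e m_props r_pos a_ge a_le by (intro tail_fun_strict) (auto simp: M_def)
  hence "F y < F (y + e)" using assms e by (simp add: F_nonneg_arg)
  thus "F (y - e) < F (y + e)" using F_mono[of "y - e" y] e by simp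
qed

text \<open>When the orbit of \<open>y\<close> sits on \<open>M\<close>, left neighbours with the
  same letters sit strictly below \<open>M\<close> and have a positive rest beyond the common finite
  sum. The growth of \<open>F\<close> at \<open>y\<close> comes from the left.\<close>

lemma msupport_if_reaches_M:
  assumes "0 < y" "(Ta a ^^ k) y = M" "\<And>j. (Ta a ^^ j) y \<noteq> 1"
  shows "y \<in> msupport qsd"
  unfolding msupport_iff
proof (intro allI impI)
  fix e :: real assume e: "e > 0"
  obtain d where d: "d > 0" "\<And>x j. \<bar>x - y\<bar> < d \<Longrightarrow> j < k \<Longrightarrow> delta a x j = delta a y j"
    using near_same_code[of k y 1] assms(3) zero_less_one by metis
  define x where "x = y - Min {d, y, e} / 2"
  have x: "0 \<le> x" "\<bar>x - y\<bar> < d" "x < y" "y - e \<le> x" using d(1) e assms(1) by (auto simp: x_def min_def)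
  have code: "delta a x j = delta a y j" if "j < k" for j using d(2)[OF x(2) that] .
  have "(y - x) / a ^ k \<le> (Ta a ^^ k) y - (Ta a ^^ k) x"
    using x a_pos code by (intro orbit_gap) auto
  moreover have "0 < (y - x) / a ^ k" using x a_pos by simp
  ultimately have "(Ta a ^^ k) x < M" using assms(2) by linarith
  hence "0 < H ((Ta a ^^ k) x)" using Ta_iter_nonneg[OF a_pos x(1)] by (intro H_pos)
  hence "0 < orbit_weight m r a x k * H ((Ta a ^^ k) x)" using weight_pos by simp
  moreover have "H x = orbit_sum m r a k x + orbit_weight m r a x k * H ((Ta a ^^ k) x)" using H_split[OF x(1)] .
  moreover have "orbit_sum m r a k x = H y"
    using orbit_cong(1)[of k a x a y k m r] code H_eq_orbit_sum[of k y] assms(2) by simp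
  ultimately have "H y < H x" by linarith
  hence "F x < F y" using x by (simp add: F_nonneg_arg)
  moreover have "F (y - e) \<le> F x" "F y \<le> F (y + e)" using x e by (auto intro: F_mono)
  ultimately show "F (y - e) < F (y + e)" by linarith
qed

definition zero_reaches_M :: bool where
  "zero_reaches_M \<longleftrightarrow> (\<exists>k\<ge>1. (\<forall>j<k. (Ta a ^^ j) 0 \<notin> Ia a) \<and> (Ta a ^^ k) 0 = M)"

lemma zero_reaches_M_iff: "zero_reaches_M \<longleftrightarrow> (\<exists>k. (Ta a ^^ k) 0 = M)"
proof
  assume "zero_reaches_M"
  thus "\<exists>k. (Ta a ^^ k) 0 = M" by (auto simp: zero_reaches_M_def)
next
  assume "\<exists>k. (Ta a ^^ k) 0 = M"
  then obtain k where k: "(Ta a ^^ k) 0 = M" by blast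
  have "k \<noteq> 0" using k M_props by (cases k) auto
  moreover have "(Ta a ^^ j) 0 \<notin> Ia a" if "j < k" for j
    using Ia_iter[OF a_ge a_le _ that, of 0] k by (auto simp: M_def)
  ultimately show "zero_reaches_M" unfolding zero_reaches_M_def using k
    by (intro exI[of _ k]) auto
qed

text \<open>If 0 reaches \<open>M\<close>, so does \<open>y\<close>, and \<open>F\<close> is
  constant to the right of \<open>y\<close>. To the left, either \<open>y = 0\<close>, or the orbit
  enters 0 through its only nonzero preimage 1, and the gap next to 1 makes \<open>F\<close>
  constant there too.\<close>

lemma Tpre_not_in_msupport:
  assumes "zero_reaches_M" "y \<in> Tpre a j"
  shows "y \<notin> msupport qsd"
proof -
  obtain k where k: "(Ta a ^^ k) 0 = M" using assms(1) zero_reaches_M_iff by blast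
  have y: "0 \<le> y" "(Ta a ^^ j) y = 0" using assms(2) by (auto simp: Tpre_def)
  have a: "a < 2/3"
  proof (rule ccontr)
    assume "\<not> a < 2/3"
    hence "a = 2/3" using a_le by simp
    hence a1: "1 - a = 1/3" by simp
    have "M = 3" unfolding M_def a1 by simp
    thus False using k orbit_two_thirds_neq_3[of k] \<open>a = 2/3\<close> by metis
  qed
  have "(Ta a ^^ (k + j)) y = M" using y k by (simp add: funpow_add)
  hence "\<exists>d>0. F (y + d) = F y" using right_constant[OF y(1), of "k + j"] by simp
  moreover have "\<exists>d>0. F (y - d) = F y"
  proof (cases "y = 0")
    case True thus ?thesis using left_constant_0 by simp
  next
    case False
    then obtain i where i: "(Ta a ^^ i) y \<noteq> 0" "(Ta a ^^ Suc i) y = 0"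
    proof -
      obtain l where l: "(Ta a ^^ l) y = 0" "\<And>i. i < l \<Longrightarrow> (Ta a ^^ i) y \<noteq> 0"
        using y(2) exists_least_iff[of "\<lambda>j. (Ta a ^^ j) y = 0"] by auto
      then obtain i where "l = Suc i" using False by (cases l) auto
      thus ?thesis using l that by blast
    qed
    have "0 \<le> (Ta a ^^ i) y" using Ta_iter_nonneg[OF a_pos y(1)] .
    hence "(Ta a ^^ i) y = 1" using i(2) a_pos by (auto simp: Ta_def split: if_splits)
    thus ?thesis using left_constant_hitting_1[of y i] False y(1) a by simp
  qed
  ultimately show ?thesis using not_in_msupport by blast
qed

text \<open>The critical orbits are those that reach \<open>M\<close> and also meet 1. As nothing
  returns from \<open>M\<close>, the visit to 1 comes first and the next point is 0; hence 0 reaches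
  \<open>M\<close> and \<open>y\<close> is a preimage of 0, which is the excluded case.\<close>

lemma Qa_in_msupport:
  assumes "y \<in> Qa a" "zero_reaches_M \<Longrightarrow> \<forall>j. y \<notin> Tpre a j"
  shows "y \<in> msupport qsd"
proof -
  have y: "0 \<le> y" "y \<le> M" "\<And>k. (Ta a ^^ k) y \<le> M" using assms(1) by (auto simp: Qa_iff)
  show ?thesis
  proof (cases "\<forall>k. (Ta a ^^ k) y < M")
    case True
    thus ?thesis using msupport_if_below_M[OF y(1)] by blast
  next
    case False
    then obtain k where k: "(Ta a ^^ k) y = M" using y(3) by (meson linorder_not_less order_antisym)
    have notIa: "(Ta a ^^ j) y \<notin> Ia a" for j
      using Ia_iter[OF a_ge a_le, of j y "Suc j"] y(3)[of "Suc j"] by (auto simp: M_def)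
    have y0: "y \<noteq> 0"
    proof
      assume "y = 0"
      hence "zero_reaches_M" "y \<in> Tpre a 0" using k zero_reaches_M_iff M_props by (auto simp: Tpre_def M_def[symmetric])
      thus False using assms(2) by blast
    qed
    have "(Ta a ^^ j) y \<noteq> 1" for j
    proof
      assume j: "(Ta a ^^ j) y = 1"
      hence z: "(Ta a ^^ Suc j) y = 0" by (simp add: Ta_def)
      have "y \<in> Tpre a (Suc j)" unfolding Tpre_def using y notIa z by (simp add: M_def)
      moreover have "zero_reaches_M"
      proof -
        have "\<not> k \<le> j"
        proof
          assume "k \<le> j"
          hence "(Ta a ^^ j) y = (Ta a ^^ (j - k)) ((Ta a ^^ k) y)"
            by (metis comp_apply funpow_add le_add_diff_inverse2)
          hence "(Ta a ^^ j) y \<ge> M" using Ta_iter_ge_M[OF a_ge a_le, of M "j - k"] k by (simp add: M_def)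
          thus False using j M_props by simp
        qed
        hence "k = (k - Suc j) + Suc j" by simp
        hence "(Ta a ^^ k) y = (Ta a ^^ (k - Suc j)) ((Ta a ^^ Suc j) y)"
          by (metis comp_apply funpow_add)
        hence "(Ta a ^^ (k - Suc j)) 0 = M" using k z by simp
        thus ?thesis using zero_reaches_M_iff by blast
      qed
      ultimately show False using assms(2) by blast
    qed
    thus ?thesis using msupport_if_reaches_M[of y k] k y y0 by simp
  qed
qed

lemma msupport_qsd:
  shows "\<not> zero_reaches_M \<Longrightarrow> msupport qsd = Qa a"
    and "zero_reaches_M \<Longrightarrow> msupport qsd = Qa a - (\<Union>k. Tpre a k)"
proof -
  assume z: "\<not> zero_reaches_M"
  show "msupport qsd = Qa a"
  proof (intro equalityI subsetI)
    fix y assume "y \<in> Qa a"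
    thus "y \<in> msupport qsd" by (rule Qa_in_msupport) (use z in simp)
  qed (rule msupport_subset_Qa)
next
  assume z: "zero_reaches_M"
  show "msupport qsd = Qa a - (\<Union>k. Tpre a k)"
  proof (intro equalityI subsetI)
    fix y assume y: "y \<in> msupport qsd"
    thus "y \<in> Qa a - (\<Union>k. Tpre a k)" using msupport_subset_Qa[OF y] Tpre_not_in_msupport[OF z] by blast
  next
    fix y assume "y \<in> Qa a - (\<Union>k. Tpre a k)"
    hence "y \<in> Qa a" "\<forall>j. y \<notin> Tpre a j" by auto
    thus "y \<in> msupport qsd" by (rule Qa_in_msupport)
  qed
qed

lemma measure_qsd_Fqs: "0 \<le> y \<Longrightarrow> measure qsd {..y} = Fqs a p y"
  using Fqs_eq[OF a_ge a_le, of p y] by (simp add: measure_qsd_atMost F_def H_def m_def r_def)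

end

theorem theorem1p1:
  fixes a p :: real
  assumes ha: "1/2 < a" "a \<le> 2/3"
      and hp: "0 < p" "p < 1"
  shows
    \<comment> \<open>lambda_a is the unique positive root and exceeds p\<close>
    "(\<exists>!l. l > 0 \<and> char_eq a p l) \<and> lam a p > p
    \<comment> \<open>survival asymptotics\<close>
   \<and> (\<exists>c. 0 < c \<and> c < 1 \<and>
        (\<forall>x \<in> {0..1/(1-a)}.
           (\<lambda>n. Px a p x n (survives a x)) \<sim>[at_top] (\<lambda>n. c * V a p x * lam a p ^ n)))
    \<comment> \<open>properties of a |-> lambda_a on [1/2,2/3]\<close>
   \<and> (\<forall>b \<in> {1/2..2/3}. \<exists>!l. l > 0 \<and> char_eq b p l)
   \<and> lam (1/2) p = p
   \<and> continuous_on {1/2..2/3} (\<lambda>b. lam b p)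
   \<and> mono_on {1/2..2/3} (\<lambda>b. lam b p)
   \<and> (\<forall>J. is_interval J \<and> J \<subseteq> {1/2..2/3} - Sset \<longrightarrow>
          (\<forall>b\<in>J. \<forall>b'\<in>J. lam b p = lam b' p))
   \<and> (\<forall>u v. u < v \<and> {u<..<v} \<inter> Sset \<noteq> {} \<longrightarrow>
          \<not> (\<forall>b\<in>{u<..<v} \<inter> {1/2..2/3}. \<forall>b'\<in>{u<..<v} \<inter> {1/2..2/3}. lam b p = lam b' p))
   \<and> closed Sset \<and> Sset \<in> null_sets lborel
   \<and> (\<forall>t. emeasure (dlam p) {t} = 0)
   \<and> (\<exists>N \<in> null_sets lborel. emeasure (dlam p) (UNIV - N) = 0)
   \<and> msupport (dlam p) = Sset
    \<comment> \<open>convergence of conditional distributions\<close>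
   \<and> (\<forall>x \<in> {0..1/(1-a)}. \<forall>y \<in> {0..1/(1-a)}.
        (\<lambda>n. Px a p x n (\<lambda>xs. survives a x xs \<and> chain a x xs \<le> y) / Px a p x n (survives a x))
          \<longlonglongrightarrow> Fqs a p y)
    \<comment> \<open>the quasi-stationary measure nu_a\<close>
   \<and> (\<exists>\<nu>. prob_space \<nu> \<and> sets \<nu> = sets borel
        \<and> measure \<nu> {0..1/(1-a)} = 1
        \<and> (\<forall>y \<in> {0..1/(1-a)}. measure \<nu> {..y} = Fqs a p y)
        \<and> (\<forall>A \<in> sets borel. A \<subseteq> {0..1/(1-a)} \<longrightarrow>
             (\<integral>x. Px a p x 1 (\<lambda>xs. survives a x xs \<and> chain a x xs \<in> A) \<partial>\<nu>)
               / (\<integral>x. Px a p x 1 (survives a x) \<partial>\<nu>) = measure \<nu> A)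
        \<and> (\<forall>t. measure \<nu> {t} = 0)
        \<and> (\<not> (a = 2/3 \<and> p = 1/2) \<longrightarrow> (\<exists>N \<in> null_sets lborel. emeasure \<nu> (UNIV - N) = 0))
        \<and> (a = 2/3 \<and> p = 1/2 \<longrightarrow> \<nu> = uniform_measure lborel {0..3})
        \<and> ((\<not> (\<exists>k\<ge>1. (\<forall>j<k. (Ta a ^^ j) 0 \<notin> Ia a) \<and> (Ta a ^^ k) 0 = 1/(1-a)))
             \<longrightarrow> msupport \<nu> = Qa a)
        \<and> ((\<exists>k\<ge>1. (\<forall>j<k. (Ta a ^^ j) 0 \<notin> Ia a) \<and> (Ta a ^^ k) 0 = 1/(1-a))
             \<longrightarrow> msupport \<nu> = Qa a - (\<Union>k. Tpre a k)))"
proof -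
  interpret C: ar_chain a p by unfold_locales (use ha hp in auto)
  note M = C.M_def[symmetric]
  have root: "\<exists>!l. l > 0 \<and> char_eq b p l" if "b \<in> {1/2..2/3}" for b
    using char_root(1)[of b p] that hp by simp
  have nonconst: "\<not> (\<forall>b\<in>{u<..<v} \<inter> {1/2..2/3}. \<forall>b'\<in>{u<..<v} \<inter> {1/2..2/3}. lam b p = lam b' p)"
    if uv: "{u<..<v} \<inter> Sset \<noteq> {}" for u v
  proof -
    obtain b where b: "b \<in> Sset" "u < b" "b < v" using uv by auto
    obtain c where "u < c" "c < v" "1/2 \<le> c" "c \<le> 2/3" "lam c p \<noteq> lam b p"
      using lam_not_constant_at_Sset[OF b hp] by blast
    moreover have "b \<in> {1/2..2/3}" using b by (simp add: Sset_def)
    ultimately show ?thesis using b by (metis IntI atLeastAtMost_iff greaterThanLessThan_iff)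
  qed
  show ?thesis
    unfolding M C.zero_reaches_M_def[symmetric]
  proof (intro conjI exI[of _ C.qsd])
    show "\<exists>!l. l > 0 \<and> char_eq a p l" using root ha by simp
    show "p < lam a p" by (rule lam_greater[OF ha hp])
    show "\<exists>c. 0 < c \<and> c < 1 \<and> (\<forall>x \<in> {0..C.M}.
       (\<lambda>n. Px a p x n (survives a x)) \<sim>[at_top] (\<lambda>n. c * V a p x * lam a p ^ n))"
      using survival_asymptotics[OF ha hp] by (simp only: M)
    show "\<forall>b\<in>{1/2..2/3}. \<exists>!l. l > 0 \<and> char_eq b p l" using root by blast
    show "lam (1/2) p = p" by (rule lam_half[OF hp])
    show "continuous_on {1/2..2/3} (\<lambda>b. lam b p)" by (rule continuous_lam[OF hp])
    show "mono_on {1/2..2/3} (\<lambda>b. lam b p)" using lam_mono hp by (intro mono_onI) auto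
    show "\<forall>J. is_interval J \<and> J \<subseteq> {1/2..2/3} - Sset \<longrightarrow> (\<forall>b\<in>J. \<forall>b'\<in>J. lam b p = lam b' p)"
      using lam_constant_off_Sset[OF hp] by blast
    show "\<forall>u v. u < v \<and> {u<..<v} \<inter> Sset \<noteq> {} \<longrightarrow>
          \<not> (\<forall>b\<in>{u<..<v} \<inter> {1/2..2/3}. \<forall>b'\<in>{u<..<v} \<inter> {1/2..2/3}. lam b p = lam b' p)"
      by (intro allI impI, rule nonconst) simp
    show "closed Sset" by (rule closed_Sset)
    show "Sset \<in> null_sets lborel" by (rule Sset_null)
    show "\<forall>t. emeasure (dlam p) {t} = 0" using dlam_no_atoms[OF hp] by blast
    show "\<exists>N\<in>null_sets lborel. emeasure (dlam p) (UNIV - N) = 0"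
      using Sset_null dlam_off_Sset[OF hp] by blast
    show "msupport (dlam p) = Sset" by (rule msupport_dlam[OF hp])
    show "\<forall>x\<in>{0..C.M}. \<forall>y\<in>{0..C.M}.
        (\<lambda>n. Px a p x n (\<lambda>xs. survives a x xs \<and> chain a x xs \<le> y) / Px a p x n (survives a x))
          \<longlonglongrightarrow> Fqs a p y"
      using conditional_limit[OF ha hp] by (simp add: M)
    show "prob_space C.qsd" by (rule C.qsd.prob_space_axioms)
    show "sets C.qsd = sets borel" by simp
    show "measure C.qsd {0..C.M} = 1"
      using C.measure_qsd_Icc[of 0 C.M] C.F_eq_0[of 0] C.F_eq_1[of C.M] C.M_props by simp
    show "\<forall>y\<in>{0..C.M}. measure C.qsd {..y} = Fqs a p y" using C.measure_qsd_Fqs by simp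
    show "\<forall>A\<in>sets borel. A \<subseteq> {0..C.M} \<longrightarrow>
             (\<integral>x. Px a p x 1 (\<lambda>xs. survives a x xs \<and> chain a x xs \<in> A) \<partial>C.qsd)
               / (\<integral>x. Px a p x 1 (survives a x) \<partial>C.qsd) = measure C.qsd A"
      by (intro ballI impI) (rule C.quasi_stationary)
    show "\<forall>t. measure C.qsd {t} = 0" by (intro allI) (rule C.measure_qsd_singleton)
    show "\<not> (a = 2/3 \<and> p = 1/2) \<longrightarrow> (\<exists>N\<in>null_sets lborel. emeasure C.qsd (UNIV - N) = 0)"
      by (intro impI) (rule C.qsd_singular)
    show "a = 2/3 \<and> p = 1/2 \<longrightarrow> C.qsd = uniform_measure lborel {0..3}"
      by (intro impI, elim conjE) (rule C.qsd_uniform)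
    show "\<not> C.zero_reaches_M \<longrightarrow> msupport C.qsd = Qa a" by (intro impI) (rule C.msupport_qsd(1))
    show "C.zero_reaches_M \<longrightarrow> msupport C.qsd = Qa a - (\<Union>k. Tpre a k)"
      by (intro impI) (rule C.msupport_qsd(2))
  qed
qed

end
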